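(* Let $A \subseteq \mathbb{N}$ with $d(A) > 0$, and let $\mathbf{N} = (N_s)_{s \in \mathbb{N}}$ and $\mathbf{H}=(H_s)_{s\in\mathbb{N}}$ be sequences in $\mathbb{N}$ with $1\prec \mathbf{H}\prec \mathbf{N}$ and $\lim_{s\to\infty} N_s/N_{s+1}=0$. If $(\mathbf{N},\mathbf{H})$ is a $U^2$ good scale for $1_A$, then there exists a sequence $\epsilon_s \to 0$ such that for every $n \in \{N_{s-1}+1,\ldots, N_s\}$ there exists $Q_n\in\mathbb{N}$ with $H_s\leq Q_n\leq (1+\epsilon_s)H_s$, where $\lim_{n \to \infty} \min\{m \in \mathbb{N} : m \nmid Q_n\} = \infty$, and such that for any choice of sets $\tilde{B}_s \subseteq [H_s]$ ($s\in\mathbb{N}$), for all but $o(N_s)$ many $n \in \{N_{s-1}+1,\ldots, N_s\}$ there exist sets $A_n\subseteq (A-n)\cap \{0,1,\ldots,Q_n-1\}$ and $B_n\subseteq \tilde{B}_s$ such that: (I) $|((A-n) \cap \{0,1,\ldots,Q_n-1\}) \setminus A_n| \leq \epsilon_s Q_n$; (II) $|\tilde{B}_s \setminus B_n| \leq \epsilon_s Q_n$; (III) $|(A_n +_{\bmod{Q_n}} B_n) \setminus ((A+\tilde{B}_s-n)\cap \{0,1,\ldots,Q_n-1\})| \leq \epsilon_s Q_n$. Moreover, if $\tilde{B}_s = B \cap [H_s]$ for each $s$, where $B\subseteq\mathbb{N}$ meets every residue class in $\mathbb{N}$, then there exists a sequence $D_s \to \infty$ such that each $B_n$ may be chosen to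 additionally satisfy (IV) $B_n$ meets every residue class mod $m$ for every $m \leq D_s$.
   Context: $[M]=\{1,\dots,M\}$, $N_0=0$. $d(A)=\lim_N|A\cap[N]|/N$. $A-n=\{a-n:a\in A\}$. For $E,F\subseteq\{0,\dots,Q-1\}$, $E+_{\bmod Q}F=\{x+y\bmod Q: x\in E,y\in F\}\subseteq\{0,\dots,Q-1\}$. A set meets every residue class in $\mathbb{N}$ if it intersects $a\mathbb{N}+b$ for all $a,b\in\mathbb{N}$; it meets every residue class mod $m$ if it intersects $m\mathbb{Z}+r$ for all $r$. Sequence order: $1\prec\mathbf{H}$ means $H_s\to\infty$; $\mathbf{H}\preceq\mathbf{N}$ means $H_s\le N_s$ eventually; $\mathbf{H}\prec\mathbf{N}$ means $H_s/N_s\to0$. $e(x)=e^{2\pi ix}$, $\|x\|_{\mathbb{T}}$ = distance to nearest integer, $\mathbb{E}_{n\in\mathbf{N}}a(n)=\lim_s\frac1{N_s}\sum_{n=1}^{N_s}a(n)$, $\|g\|_{2,\mathbf{N}}=(\mathbb{E}_{n\in\mathbf{N}}|g|^2)^{1/2}$. Gowers norm: for $u\colon\mathbb{Z}/M\mathbb{Z}\to\mathbb{C}$, $\|u\|^4_{U^2(\mathbb{Z}/M\mathbb{Z})}=M^{-3}\sum_{x,h_1,h_2}u(x)\overline{u(x+h_1)u(x+h_2)}u(x+h_1+h_2)$; for an interval, $\|g\|_{U^2(\{x+1,\dots,x+L\})}=\|\tilde g\|_{U^2(\mathbb{Z}/M\mathbb{Z})}/\|1_{[L]}\|_{U^2(\mathbb{Z}/M\mathbb{Z})}$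 with $M\ge4L$, $\tilde g(n)=1_{[L]}(n)g(x+n)$; $\|g\|_{U^2(\mathbf{N},\mathbf{H})}=\lim_s\frac1{N_s-H_s+1}\sum_{n=1}^{N_s-H_s+1}\|g\|_{U^2(\{n,\dots,n+H_s-1\})}$. $(\mathbf{N},\mathbf{H})$ is a $U^2$ good scale for $f\colon\mathbb{N}\to[0,1]$ if $f=f_{\mathrm{str}}+f_{\mathrm{unf}}$ with: (i) $f_{\mathrm{str}}\in[0,1]$, $\mathbb{E}_{n\in\mathbf{N}}f_{\mathrm{unf}}=0$; (ii) for every $\epsilon>0$ there are $d$, $c_i\colon\mathbb{N}\to\mathbb{C}$ with $\|c_i\|_\infty\le1$ and $\alpha_i\colon\mathbb{N}\to\mathbb{R}$ ($i\le d$) with $\|\sum_ic_i(n)e(n\alpha_i(n))-f_{\mathrm{str}}\|_{2,\mathbf{N}}\le\epsilon$, such that for every $C\ge1$ the sets of $n\in[N_s-H_s+1]$ on which all $\alpha_i(n+\cdot)$ are constant on $[H_s]$, on which all $c_i(n+\cdot)$ are constant on $[H_s]$, and on which every $(w_1,\dots,w_d)\in[-C,C]^d\cap\mathbb{Z}^d$ has $\|\sum w_i\alpha_i(n)\|_{\mathbb{T}}\le\frac1{CH_s}$ or $\ge\frac{C}{H_s}$, each have size $(1-o(1))(N_s-H_s+1)$; (iii) some $\mathbf{H}'$ with $1\prec\mathbf{H}'\prec\mathbf{H}$ has $\|f_{\mathrm{unf}}\|_{U^2(\mathbf{N},\mathbf{H}')}=0$. *)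

theory Defs
  imports "HOL-Analysis.Analysis" "HOL-Number_Theory.Cong" "HOL-Library.Set_Algebras"
begin

text \<open>
  The positive integers are the numbers \<open>n \<ge> 1\<close> of type \<^typ>\<open>nat\<close>. A function on the positive
  integers is a function on \<^typ>\<open>nat\<close> whose value at \<open>0\<close> is never used. Every average and
  seminorm below is a limit; a hypothesis about its value includes that the limit exists.
\<close>

definition has_density :: "nat set \<Rightarrow> real \<Rightarrow> bool" where
  "has_density A \<delta> \<longleftrightarrow> (\<lambda>M. real (card (A \<inter> {1..M})) / real M) \<longlonglongrightarrow> \<delta>"

text \<open>
  The nonnegative part of \<open>A - n = {a - n | a \<in> A}\<close>, the difference being taken in the integers.
  Truncated subtraction would send all \<open>a < n\<close> to \<open>0\<close>.
\<close>
definition shift_down :: "nat set \<Rightarrow> nat \<Rightarrow> nat set" where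
  "shift_down A n = {k. k + n \<in> A}"

definition mod_sumset :: "nat \<Rightarrow> nat set \<Rightarrow> nat set \<Rightarrow> nat set" where
  "mod_sumset Q E F = {(x + y) mod Q | x y. x \<in> E \<and> y \<in> F}"

definition meets_residues_in_nat :: "nat set \<Rightarrow> bool" where
  "meets_residues_in_nat B \<longleftrightarrow> (\<forall>a\<ge>1. \<forall>b\<ge>1. \<exists>k\<ge>1. a * k + b \<in> B)"

definition meets_residues_mod :: "nat set \<Rightarrow> nat \<Rightarrow> bool" where
  "meets_residues_mod B m \<longleftrightarrow> (\<forall>r::int. \<exists>b\<in>B. [int b = r] (mod int m))"

definition tends_to_infinity :: "(nat \<Rightarrow> nat) \<Rightarrow> bool" where
  "tends_to_infinity H \<longleftrightarrow> filterlim H at_top sequentially"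

definition seq_prec :: "(nat \<Rightarrow> nat) \<Rightarrow> (nat \<Rightarrow> nat) \<Rightarrow> bool"  (infix \<open>\<prec>\<^sub>s\<close> 50) where
  "H \<prec>\<^sub>s N \<longleftrightarrow> (\<lambda>s. real (H s) / real (N s)) \<longlonglongrightarrow> 0"

definition e_char :: "real \<Rightarrow> complex" where
  "e_char x = exp (2 * complex_of_real pi * \<i> * complex_of_real x)"

definition circle_norm :: "real \<Rightarrow> real" where
  "circle_norm x = infdist x \<int>"

definition has_average :: "(nat \<Rightarrow> nat) \<Rightarrow> (nat \<Rightarrow> real) \<Rightarrow> real \<Rightarrow> bool" where
  "has_average N a l \<longleftrightarrow> (\<lambda>s. (\<Sum>n=1..N s. a n) / real (N s)) \<longlonglongrightarrow> l"

definition has_L2_norm :: "(nat \<Rightarrow> nat) \<Rightarrow> (nat \<Rightarrow> complex) \<Rightarrow> real \<Rightarrow> bool" where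
  "has_L2_norm N g v \<longleftrightarrow> (\<exists>l. has_average N (\<lambda>n. (cmod (g n))\<^sup>2) l \<and> v = sqrt l)"

text \<open>
  A function on the integers mod \<open>M\<close> is given by its values on the representatives
  \<open>0, \<dots>, M - 1\<close>. The sum is a nonnegative real number, so \<^const>\<open>Re\<close> only changes the type.
\<close>
definition U2_cyclic :: "nat \<Rightarrow> (nat \<Rightarrow> complex) \<Rightarrow> real" where
  "U2_cyclic M u = root 4 (Re (\<Sum>x<M. \<Sum>h1<M. \<Sum>h2<M.
      u x * cnj (u ((x + h1) mod M) * u ((x + h2) mod M)) * u ((x + h1 + h2) mod M)) / real M ^ 3)"

text \<open>
  The norm on \<open>{x+1, \<dots>, x+L}\<close>, computed with \<open>M = 4 L\<close>; by \<open>U2_interval_eq\<close> below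
  every \<open>M \<ge> 4 L\<close> gives the same value.
\<close>
definition U2_interval :: "nat \<Rightarrow> nat \<Rightarrow> (nat \<Rightarrow> complex) \<Rightarrow> real" where
  "U2_interval x L g =
     U2_cyclic (4 * L) (\<lambda>n. indicator {1..L} n * g (x + n)) / U2_cyclic (4 * L) (indicator {1..L})"

definition has_U2_norm :: "(nat \<Rightarrow> nat) \<Rightarrow> (nat \<Rightarrow> nat) \<Rightarrow> (nat \<Rightarrow> complex) \<Rightarrow> real \<Rightarrow> bool" where
  "has_U2_norm N H g v \<longleftrightarrow>
     (\<lambda>s. (\<Sum>n=1..N s + 1 - H s. U2_interval (n - 1) (H s) g) / real (N s + 1 - H s)) \<longlonglongrightarrow> v"

definition almost_all_starts ::
    "(nat \<Rightarrow> nat) \<Rightarrow> (nat \<Rightarrow> nat) \<Rightarrow> (nat \<Rightarrow> nat \<Rightarrow> bool) \<Rightarrow> bool" where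
  "almost_all_starts N H P \<longleftrightarrow>
     (\<lambda>s. real (card {n \<in> {1..N s + 1 - H s}. P s n}) / real (N s + 1 - H s)) \<longlonglongrightarrow> 1"

definition U2_good_scale :: "(nat \<Rightarrow> nat) \<Rightarrow> (nat \<Rightarrow> nat) \<Rightarrow> (nat \<Rightarrow> real) \<Rightarrow> bool" where
  "U2_good_scale N H f \<longleftrightarrow>
     (\<exists>f_str f_unf :: nat \<Rightarrow> real.
        (\<forall>n\<ge>1. f n = f_str n + f_unf n) \<and>
        (\<forall>n\<ge>1. 0 \<le> f_str n \<and> f_str n \<le> 1) \<and>
        has_average N f_unf 0 \<and>
        (\<forall>\<epsilon>>0. \<exists>d\<ge>1. \<exists>(c :: nat \<Rightarrow> nat \<Rightarrow> complex) (\<alpha> :: nat \<Rightarrow> nat \<Rightarrow> real).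
           (\<forall>i\<in>{1..d}. \<forall>n\<ge>1. cmod (c i n) \<le> 1) \<and>
           (\<exists>v\<le>\<epsilon>. has_L2_norm N
              (\<lambda>n. (\<Sum>i=1..d. c i n * e_char (real n * \<alpha> i n)) - complex_of_real (f_str n)) v) \<and>
           (\<forall>C\<ge>1.
              almost_all_starts N H (\<lambda>s n. \<forall>i\<in>{1..d}. (\<lambda>h. \<alpha> i (n + h)) constant_on {1..H s}) \<and>
              almost_all_starts N H (\<lambda>s n. \<forall>i\<in>{1..d}. (\<lambda>h. c i (n + h)) constant_on {1..H s}) \<and>
              almost_all_starts N H (\<lambda>s n. \<forall>w :: nat \<Rightarrow> int.
                 (\<forall>i\<in>{1..d}. \<bar>real_of_int (w i)\<bar> \<le> C) \<longrightarrow>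
                 circle_norm (\<Sum>i=1..d. real_of_int (w i) * \<alpha> i n) \<le> 1 / (C * real (H s)) \<or>
                 circle_norm (\<Sum>i=1..d. real_of_int (w i) * \<alpha> i n) \<ge> C / real (H s)))) \<and>
        (\<exists>H'. tends_to_infinity H' \<and> H' \<prec>\<^sub>s H \<and>
              has_U2_norm N H' (\<lambda>n. complex_of_real (f_unf n)) 0))"

lemma sum_shift_mod:
  fixes f :: "nat \<Rightarrow> 'a::comm_monoid_add"
  assumes "x < M"
  shows "(\<Sum>h<M. f ((x + h) mod M)) = (\<Sum>b<M. f b)"
proof (rule sum.reindex_bij_witness[where i = "\<lambda>b. (b + (M - x)) mod M" and j = "\<lambda>h. (x + h) mod M"])
  fix h assume h: "h \<in> {..<M}"
  have "((x + h) mod M + (M - x)) mod M = (x + h + (M - x)) mod M"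
    by (rule mod_add_left_eq)
  also have "x + h + (M - x) = h + M" using assms by simp
  finally show "((x + h) mod M + (M - x)) mod M = h" using h by simp
next
  fix b assume b: "b \<in> {..<M}"
  have "(x + (b + (M - x)) mod M) mod M = (x + (b + (M - x))) mod M"
    by (rule mod_add_right_eq)
  also have "x + (b + (M - x)) = b + M" using assms by simp
  finally show "(x + (b + (M - x)) mod M) mod M = b" using b by simp
qed (use assms in auto)

lemma U2_cyclic_supported:
  fixes u :: "nat \<Rightarrow> complex"
  assumes M: "4 * L \<le> M" and u: "\<And>n. n \<notin> {1..L} \<Longrightarrow> u n = 0"
  shows "U2_cyclic M u = root 4 (Re (\<Sum>a=1..L. \<Sum>b=1..L. \<Sum>c=1..L.
           u a * cnj (u b * u c) * u (b + c - a)) / real M ^ 3)"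
proof (cases "L = 0")
  case True
  then have "u n = 0" for n using u by simp
  then show ?thesis by (simp add: U2_cyclic_def)
next
  case False
  have sub: "{1..L} \<subseteq> {..<M}" using M False by auto
  have inner: "(\<Sum>h1<M. \<Sum>h2<M.
      u x * cnj (u ((x + h1) mod M) * u ((x + h2) mod M)) * u ((x + h1 + h2) mod M))
      = (\<Sum>b<M. \<Sum>c<M. u x * cnj (u b * u c) * u ((b + c + (M - x)) mod M))" if x: "x < M" for x
  proof -
    define F where "F b c = u x * cnj (u b * u c) * u ((b + c + (M - x)) mod M)" for b c
    have eq: "u x * cnj (u ((x + h1) mod M) * u ((x + h2) mod M)) * u ((x + h1 + h2) mod M)
        = F ((x + h1) mod M) ((x + h2) mod M)" for h1 h2
    proof -
      have "((x + h1) mod M + (x + h2) mod M + (M - x)) mod M = (x + h1 + (x + h2) + (M - x)) mod M"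
        by (metis mod_add_left_eq mod_add_eq)
      also have "x + h1 + (x + h2) + (M - x) = (x + h1 + h2) + M" using x by simp
      finally show ?thesis by (simp add: F_def)
    qed
    have "(\<Sum>h1<M. \<Sum>h2<M. F ((x + h1) mod M) ((x + h2) mod M)) = (\<Sum>h1<M. \<Sum>c<M. F ((x + h1) mod M) c)"
      by (intro sum.cong refl sum_shift_mod[OF x])
    also have "\<dots> = (\<Sum>b<M. \<Sum>c<M. F b c)"
      by (rule sum_shift_mod[OF x, of "\<lambda>b. \<Sum>c<M. F b c"])
    finally show ?thesis by (simp only: eq F_def)
  qed
  have wrap: "u ((b + c + (M - a)) mod M) = u (b + c - a)"
    if "a \<in> {1..L}" "b \<in> {1..L}" "c \<in> {1..L}" for a b c
  proof (cases "a < b + c")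
    case True
    have "b + c + (M - a) = (b + c - a) + M" using that True M by auto
    moreover have "b + c - a < M" using that M False by auto
    ultimately show ?thesis by simp
  next
    case ge: False
    show ?thesis
    proof (cases "a = b + c")
      case True
      then show ?thesis using that M by simp
    next
      case False
      then have "(b + c + (M - a)) mod M = b + c + (M - a)" using that ge M by auto
      moreover have "b + c + (M - a) \<notin> {1..L}" using that M by auto
      moreover have "b + c - a \<notin> {1..L}" using ge by auto
      ultimately show ?thesis using u by simp
    qed
  qed
  have "(\<Sum>x<M. \<Sum>h1<M. \<Sum>h2<M.
      u x * cnj (u ((x + h1) mod M) * u ((x + h2) mod M)) * u ((x + h1 + h2) mod M))
      = (\<Sum>a<M. \<Sum>b<M. \<Sum>c<M. u a * cnj (u b * u c) * u ((b + c + (M - a)) mod M))"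
    by (intro sum.cong refl inner) simp
  also have "\<dots> = (\<Sum>a=1..L. \<Sum>b=1..L. \<Sum>c=1..L. u a * cnj (u b * u c) * u ((b + c + (M - a)) mod M))"
  proof -
    have r: "(\<Sum>a<M. G a) = (\<Sum>a=1..L. G a)" if "\<And>a. a \<notin> {1..L} \<Longrightarrow> G a = 0" for G :: "nat \<Rightarrow> complex"
      using sub that by (intro sum.mono_neutral_right) auto
    define F where "F a b c = u a * cnj (u b * u c) * u ((b + c + (M - a)) mod M)" for a b c
    have "(\<Sum>a<M. \<Sum>b<M. \<Sum>c<M. F a b c) = (\<Sum>a=1..L. \<Sum>b<M. \<Sum>c<M. F a b c)"
      by (rule r) (drule u, simp add: F_def)
    also have "\<dots> = (\<Sum>a=1..L. \<Sum>b=1..L. \<Sum>c<M. F a b c)"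
      by (intro sum.cong refl r) (drule u, simp add: F_def)
    also have "\<dots> = (\<Sum>a=1..L. \<Sum>b=1..L. \<Sum>c=1..L. F a b c)"
      by (intro sum.cong refl r) (drule u, simp add: F_def)
    finally show ?thesis by (simp only: F_def)
  qed
  also have "\<dots> = (\<Sum>a=1..L. \<Sum>b=1..L. \<Sum>c=1..L. u a * cnj (u b * u c) * u (b + c - a))"
    by (intro sum.cong refl arg_cong2[where f = "(*)"] wrap)
  finally show ?thesis by (simp only: U2_cyclic_def)
qed

lemma U2_interval_eq:
  assumes "4 * L \<le> M"
  shows "U2_interval x L g =
     U2_cyclic M (\<lambda>n. indicator {1..L} n * g (x + n)) / U2_cyclic M (indicator {1..L})"
proof (cases "L = 0")
  case True
  then show ?thesis by (simp add: U2_interval_def U2_cyclic_def)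
next
  case False
  define T where "T u = Re (\<Sum>a=1..L. \<Sum>b=1..L. \<Sum>c=1..L. u a * cnj (u b * u c) * u (b + c - a))"
    for u :: "nat \<Rightarrow> complex"
  have *: "U2_cyclic K v / U2_cyclic K w = root 4 (T v / T w)"
    if "4 * L \<le> K" and "\<And>n. n \<notin> {1..L} \<Longrightarrow> v n = 0" and "\<And>n. n \<notin> {1..L} \<Longrightarrow> w n = 0" for K v w
  proof -
    have "U2_cyclic K v / U2_cyclic K w = root 4 (T v / real K ^ 3) / root 4 (T w / real K ^ 3)"
      unfolding T_def
      by (rule arg_cong2[where f = "(/)"]; rule U2_cyclic_supported; fact that)
    also have "\<dots> = root 4 ((T v / real K ^ 3) / (T w / real K ^ 3))"
      by (simp only: real_root_divide)
    also have "(T v / real K ^ 3) / (T w / real K ^ 3) = T v / T w"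
      using that(1) False by simp
    finally show ?thesis .
  qed
  show ?thesis unfolding U2_interval_def
    by (rule trans[OF * *[symmetric]]) (use assms in auto)
qed

text \<open>
  \<open>An\<close> and \<open>Bn\<close> are the sets found inside the window of length \<open>Q\<close> starting at \<open>n\<close>. Elements of
  \<open>Bn\<close> may equal \<open>Q\<close>, which \<^const>\<open>mod_sumset\<close> identifies with \<open>0\<close>.
\<close>
definition window_sumset_approx ::
    "nat set \<Rightarrow> nat set \<Rightarrow> nat \<Rightarrow> nat \<Rightarrow> real \<Rightarrow> nat set \<Rightarrow> nat set \<Rightarrow> bool" where
  "window_sumset_approx A Bt n Q \<epsilon> An Bn \<longleftrightarrow>
     An \<subseteq> shift_down A n \<inter> {0..<Q} \<and>
     Bn \<subseteq> Bt \<and>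
     real (card ((shift_down A n \<inter> {0..<Q}) - An)) \<le> \<epsilon> * real Q \<and>
     real (card (Bt - Bn)) \<le> \<epsilon> * real Q \<and>
     real (card (mod_sumset Q An Bn - (shift_down (A + Bt) n \<inter> {0..<Q}))) \<le> \<epsilon> * real Q"

end

theory Submission
  imports Defs "HOL-Real_Asymp.Real_Asymp"
begin

text \<open>
  Fix a long window on which the frequencies \<open>\<alpha>\<^sub>i\<close> and coefficients \<open>c\<^sub>i\<close> are constant. The structured
  part of the indicator function of \<open>A\<close> is then close in mean to a trigonometric polynomial \<open>p\<close>, and the
  spectral gap says that the phases \<open>w \<cdot> \<alpha>\<close> are either negligible or equidistributed at scale \<open>H\<close>.
  Consequently the positive definite kernel \<open>k(t) = |(1 + \<Sum>\<^sub>i e(t\<alpha>\<^sub>i)) / (d + 1)|\<^bsup>2R\<^esup>\<close>, which lives on the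
  almost periods of \<open>p\<close>, has the same mean on all long progressions; this yields an almost period \<open>Q\<close>
  slightly larger than \<open>H\<close> and divisible by any prescribed number.

  A sum \<open>a + b < Q\<close> needs no argument. If \<open>a + b = x + Q\<close>, then \<open>p(x - b') \<approx> p(a)\<close> for all \<open>b'\<close> for which
  \<open>b - b'\<close> is an almost period. After removing few elements, \<open>p(a)\<close> is not small, the mean error of
  \<open>p\<close> near \<open>a\<close> is small, and there are many such \<open>b'\<close> in the given set; the last point rests
  on positive definiteness, which avoids any loss depending on \<open>d\<close>. So the convolution of the structured
  part with the given set is large at \<open>x\<close>, and since the uniform part hardly contributes for most \<open>x\<close>,
  \<open>x\<close> is again a sum. No removal lemma is needed. Small \<open>b\<close> may always be kept, since they produce few
  wrapped sums; they take care of the residue classes.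
\<close>

section \<open>Linear phases\<close>

text \<open>The obstacle is circularity: the number d of frequencies is known only after the
  accuracy \<epsilon> of the approximation is fixed, while the proportion of almost periods at scale
  H is bounded below only by a quantity m0 that may decay with d. So \<epsilon> must not be compared
  with m0. The kernel k serves this purpose: the weighted errors, the number of partners b' of b and
  the resulting lower bound for the convolution are all multiples of \<mu>, which cancels. Only the
  uniformity parameter \<sigma> is compared with m0; it may be chosen after d, because the averaged
  Gowers norms of the uniform part tend to 0. The exponent 2R comes from a similar comparison. Off
  the almost periods k is at most (1-\<delta>)^(2R), exponentially small in R; its mean is at least
  about (R+1)^(-d), polynomial in R for fixed d, because words of length R have at most (R+1)^d
  vectors of letter counts. The constant term 1 in k makes a large value force every e(t\<alpha>_i)
  near 1, instead of merely near one another.\<close>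

lemma e_char_eq_cis: "e_char x = cis (2 * pi * x)"
  by (simp add: e_char_def cis_conv_exp algebra_simps)

lemma norm_e_char [simp]: "cmod (e_char x) = 1"
  by (simp add: e_char_eq_cis)

lemma e_char_zero [simp]: "e_char 0 = 1"
  by (simp add: e_char_eq_cis)

lemma e_char_add: "e_char (x + y) = e_char x * e_char y"
  by (simp add: e_char_eq_cis cis_mult algebra_simps)

lemma e_char_minus: "e_char (- x) = cnj (e_char x)"
  by (simp add: e_char_eq_cis cis_cnj)

lemma e_char_diff: "e_char (x - y) = e_char x * cnj (e_char y)"
  using e_char_add[of x "- y"] by (simp add: e_char_minus)

lemma e_char_of_int [simp]: "e_char (of_int m) = 1"
  by (simp add: e_char_eq_cis cis.ctr complex_eq_iff)

lemma e_char_sum: "finite I \<Longrightarrow> e_char (\<Sum>i\<in>I. f i) = (\<Prod>i\<in>I. e_char (f i))"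
  by (induction I rule: finite_induct) (auto simp: e_char_add)

lemma norm_e_char_minus_one: "cmod (e_char x - 1) = 2 * \<bar>sin (pi * x)\<bar>"
  using dist_exp_i_1[of "2 * pi * x"] by (simp add: e_char_eq_cis cis_conv_exp)

lemma norm_e_char_minus_one_le: "cmod (e_char x - 1) \<le> 2 * pi * \<bar>x\<bar>"
  using abs_sin_x_le_abs_x[of "pi * x"] by (simp add: norm_e_char_minus_one abs_mult)

lemma circle_norm_eq: "circle_norm x = \<bar>x - of_int (round x)\<bar>"
proof (rule antisym)
  show "circle_norm x \<le> \<bar>x - of_int (round x)\<bar>"
    unfolding circle_norm_def by (rule infdist_le2[where a = "of_int (round x)"]) (auto simp: dist_real_def)
  show "\<bar>x - of_int (round x)\<bar> \<le> circle_norm x"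
    unfolding circle_norm_def infdist_def
    by (auto intro!: cINF_greatest elim!: Ints_cases simp: dist_real_def round_diff_minimal)
qed

lemma e_char_minus_round: "e_char (x - of_int (round x)) = e_char x"
  by (simp add: e_char_diff)

lemma norm_e_char_minus_one_ge: "2 * circle_norm x \<le> cmod (e_char x - 1)"
proof -
  define r where "r = \<bar>x - of_int (round x)\<bar>"
  have r: "0 \<le> r" "r \<le> 1/2" 
    using of_int_round_abs_le[of x] by (auto simp: r_def abs_minus_commute)
  have "r \<le> sin (pi * r)"
  proof -
    have *: "x \<le> sin (pi * x)" if "0 \<le> x" "x \<le> 1/2" for x :: real
    proof -
      have conc: "concave_on {0..pi} sin"
        unfolding concave_on_def
      proof (rule f''_ge0_imp_convex)
        show "((\<lambda>x. - sin x) has_real_derivative - cos x) (at x)" for x :: real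
          by (auto intro!: derivative_eq_intros)
        show "((\<lambda>x. - cos x) has_real_derivative sin x) (at x)" for x :: real
          by (auto intro!: derivative_eq_intros)
      qed (auto simp: sin_ge_zero)
      \<comment> \<open>The chord of the concave sine from 0 to pi/2 yields 2x \<le> sin(pi
        x).\<close>
      have "(1 - 2*x) * sin 0 + (2*x) * sin (pi/2) \<le> sin ((1 - 2*x) *\<^sub>R 0 + (2*x) *\<^sub>R (pi/2))"
        by (rule concave_onD[OF conc]) (use that in auto)
      then show ?thesis using that by (simp add: mult.commute)
    qed
    show ?thesis using * r by simp
  qed
  moreover have "cmod (e_char x - 1) = 2 * \<bar>sin (pi * (x - of_int (round x)))\<bar>"
    by (metis e_char_minus_round norm_e_char_minus_one)
  moreover have "\<bar>sin (pi * (x - of_int (round x)))\<bar> \<ge> sin (pi * r)"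
    unfolding r_def by (cases "x - of_int (round x) \<ge> 0") (auto simp: abs_if mult_minus_right right_diff_distrib sin_diff)
  ultimately show ?thesis by (simp add: circle_norm_eq r_def)
qed

text \<open>Since \<open>j\<close> is an integer, replacing \<open>x\<close> by its signed distance
  to the nearest integer leaves the phase unchanged.\<close>

lemma norm_e_char_multiple_minus_one_le:
  "cmod (e_char (of_int j * x) - 1) \<le> 2 * pi * \<bar>of_int j\<bar> * circle_norm x"
proof -
  have "of_int j * x = of_int j * (x - of_int (round x)) + of_int (j * round x)"
    by (simp add: algebra_simps)
  then have "e_char (of_int j * x) = e_char (of_int j * (x - of_int (round x))) * e_char (of_int (j * round x))"
    by (metis e_char_add)
  then have "e_char (of_int j * x) = e_char (of_int j * (x - of_int (round x)))"
    by (simp only: e_char_of_int) simp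
  then show ?thesis
    using norm_e_char_minus_one_le[of "of_int j * (x - of_int (round x))"]
    by (simp add: circle_norm_eq abs_mult mult.assoc)
qed

text \<open>Telescoping; the real offset \<open>x\<close> lets the bound apply to intervals of
  naturals and of integers alike.\<close>

lemma e_char_geometric_sum:
  "(e_char \<theta> - 1) * (\<Sum>j<n. e_char ((x + real j) * \<theta>)) = e_char ((x + real n) * \<theta>) - e_char (x * \<theta>)"
proof (induction n)
  case (Suc n)
  have "e_char ((x + real (Suc n)) * \<theta>) = e_char \<theta> * e_char ((x + real n) * \<theta>)"
    by (simp add: e_char_add[symmetric] algebra_simps)
  then show ?case using Suc by (simp add: algebra_simps)
qed simp

lemma norm_e_char_interval_sum_le:
  assumes "0 < circle_norm \<theta>"
  shows "cmod (\<Sum>j<n. e_char ((x + real j) * \<theta>)) \<le> 1 / circle_norm \<theta>"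
proof -
  have "2 * circle_norm \<theta> * cmod (\<Sum>j<n. e_char ((x + real j) * \<theta>))
      \<le> cmod (e_char \<theta> - 1) * cmod (\<Sum>j<n. e_char ((x + real j) * \<theta>))"
    by (intro mult_right_mono norm_e_char_minus_one_ge) auto
  also have "\<dots> = cmod (e_char ((x + real n) * \<theta>) - e_char (x * \<theta>))"
    by (simp add: e_char_geometric_sum flip: norm_mult)
  also have "\<dots> \<le> 2"
    using norm_triangle_ineq4[of "e_char ((x + real n) * \<theta>)" "e_char (x * \<theta>)"] by simp
  finally show ?thesis using assms by (simp add: field_simps)
qed

lemma norm_e_char_int_interval_sum_le:
  assumes "0 < circle_norm \<theta>"
  shows "cmod (\<Sum>t\<in>{x..<y::int}. e_char (of_int t * \<theta>)) \<le> 1 / circle_norm \<theta>"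
proof -
  have "(\<Sum>t\<in>{x..<y}. e_char (of_int t * \<theta>)) = (\<Sum>j<nat (y - x). e_char ((of_int x + real j) * \<theta>))"
    by (rule sum.reindex_bij_witness[of _ "\<lambda>j. x + int j" "\<lambda>t. nat (t - x)"]) auto
  then show ?thesis using norm_e_char_interval_sum_le[OF assms] by simp
qed

section \<open>Fourier analysis modulo an integer\<close>

lemma e_char_orthogonality:
  fixes k :: int
  assumes "\<bar>k\<bar> < int M"
  shows "(\<Sum>\<xi><M. e_char (of_int k * real \<xi> / real M)) = (if k = 0 then of_nat M else 0)"
proof (cases "k = 0")
  case False
  define \<theta> where "\<theta> = of_int k / real M"
  have M: "M > 0" using assms by auto
  \<comment> \<open>A vanishing circle norm would make \<open>M\<close> divide the nonzero
    \<open>k\<close>, which the bound on \<open>k\<close> excludes.\<close>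
  have "0 < circle_norm \<theta>"
  proof (rule ccontr)
    assume "\<not> ?thesis"
    then have "\<theta> = of_int (round \<theta>)" by (auto simp: circle_norm_eq)
    then have "real_of_int k = real_of_int (round \<theta> * int M)"
      using M by (simp add: \<theta>_def field_simps)
    then have "k = round \<theta> * int M" by linarith
    then have "int M dvd k" by simp
    then show False using False assms zdvd_imp_le[of "int M" "\<bar>k\<bar>"] by auto
  qed
  then have ne: "e_char \<theta> - 1 \<noteq> 0" using norm_e_char_minus_one_ge[of \<theta>] by auto
  have "real M * \<theta> = of_int k" using M by (simp add: \<theta>_def)
  then have "(e_char \<theta> - 1) * (\<Sum>j<M. e_char ((0 + real j) * \<theta>)) = 0"
    by (subst e_char_geometric_sum) simp
  then have "(\<Sum>j<M. e_char (real j * \<theta>)) = 0" using ne by simp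
  then show ?thesis using False by (simp add: \<theta>_def mult.commute)
qed simp

text \<open>Points of \<open>X\<close> differ by less than \<open>M\<close>, so they are distinct
  modulo \<open>M\<close> and only the diagonal terms survive orthogonality.\<close>

lemma parseval:
  fixes h :: "int \<Rightarrow> complex"
  assumes "finite X" and small: "\<And>x y. x \<in> X \<Longrightarrow> y \<in> X \<Longrightarrow> \<bar>x - y\<bar> < int M"
  shows "(\<Sum>\<xi><M. (cmod (\<Sum>x\<in>X. h x * e_char (of_int x * real \<xi> / real M)))\<^sup>2)
    = real M * (\<Sum>x\<in>X. (cmod (h x))\<^sup>2)"
proof -
  define E where "E x \<xi> = e_char (of_int x * real \<xi> / real M)" for x :: int and \<xi> :: nat
  have E: "E x \<xi> * cnj (E y \<xi>) = e_char (of_int (x - y) * real \<xi> / real M)" for x y \<xi>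
    by (simp add: E_def e_char_diff[symmetric] diff_divide_distrib left_diff_distrib)
  have "complex_of_real (\<Sum>\<xi><M. (cmod (\<Sum>x\<in>X. h x * E x \<xi>))\<^sup>2)
      = (\<Sum>\<xi><M. (\<Sum>x\<in>X. h x * E x \<xi>) * cnj (\<Sum>y\<in>X. h y * E y \<xi>))"
    by (simp only: complex_norm_square of_real_sum)
  also have "\<dots> = (\<Sum>\<xi><M. \<Sum>x\<in>X. \<Sum>y\<in>X. h x * cnj (h y) * (E x \<xi> * cnj (E y \<xi>)))"
    by (simp add: sum_product algebra_simps)
  also have "\<dots> = (\<Sum>x\<in>X. \<Sum>\<xi><M. \<Sum>y\<in>X. h x * cnj (h y) * (E x \<xi> * cnj (E y \<xi>)))"
    by (rule sum.swap)
  also have "\<dots> = (\<Sum>x\<in>X. \<Sum>y\<in>X. \<Sum>\<xi><M. h x * cnj (h y) * (E x \<xi> * cnj (E y \<xi>)))"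
    by (intro sum.cong refl sum.swap)
  also have "\<dots> = (\<Sum>x\<in>X. \<Sum>y\<in>X. h x * cnj (h y) * (\<Sum>\<xi><M. e_char (of_int (x - y) * real \<xi> / real M)))"
    by (simp add: sum_distrib_left E)
  also have "\<dots> = (\<Sum>x\<in>X. \<Sum>y\<in>X. h x * cnj (h y) * (if x = y then of_nat M else 0))"
    by (intro sum.cong refl, subst e_char_orthogonality) (use small in auto)
  also have "\<dots> = (\<Sum>x\<in>X. h x * cnj (h x) * of_nat M)"
    using assms(1) by (simp add: if_distrib cong: if_cong)
  also have "\<dots> = complex_of_real (real M * (\<Sum>x\<in>X. (cmod (h x))\<^sup>2))"
    by (simp only: complex_norm_square of_real_sum of_real_mult of_real_of_nat_eq sum_distrib_left mult.commute)
  finally show ?thesis unfolding E_def of_real_eq_iff .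
qed

text \<open>The transform of the convolution is the product of the transforms: one factor is bounded
  by \<open>S\<close>, and the mean square of the other is \<open>card B\<close> by
  Parseval.\<close>

lemma convolution_L2_bound:
  fixes g :: "int \<Rightarrow> real" and B :: "int set"
  assumes supp: "\<And>z. z \<notin> {u..v} \<Longrightarrow> g z = 0"
    and bound: "\<And>\<theta>. cmod (\<Sum>z\<in>{u..v}. of_real (g z) * e_char (of_int z * \<theta>)) \<le> S"
    and B: "B \<subseteq> {0..K}" and X: "finite X"
  shows "(\<Sum>x\<in>X. (\<Sum>b\<in>B. g (x - b))\<^sup>2) \<le> S\<^sup>2 * real (card B)"
proof -
  \<comment> \<open>\<open>Y\<close> contains the support of the convolution, and \<open>M\<close>
    exceeds its diameter, so Parseval applies without wrapping around.\<close>
  define Y where "Y = {u..v + K}"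
  define M where "M = nat (\<bar>v\<bar> + \<bar>u\<bar> + \<bar>K\<bar> + 1)"
  define h where "h x = (\<Sum>b\<in>B. g (x - b))" for x
  have finB: "finite B" using B finite_subset by blast
  have M: "M > 0" by (simp add: M_def)
  have h0: "h x = 0" if "x \<notin> Y" for x
    unfolding h_def by (rule sum.neutral, intro ballI supp) (use that B in \<open>auto simp: Y_def\<close>)
  have F: "(\<Sum>x\<in>Y. of_real (h x) * e_char (of_int x * \<theta>)) =
      (\<Sum>b\<in>B. e_char (of_int b * \<theta>)) * (\<Sum>z\<in>{u..v}. of_real (g z) * e_char (of_int z * \<theta>))" for \<theta>
  proof -
    have "(\<Sum>x\<in>Y. complex_of_real (h x) * e_char (of_int x * \<theta>))
        = (\<Sum>x\<in>Y. \<Sum>b\<in>B. of_real (g (x - b)) * e_char (of_int x * \<theta>))"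
      by (simp add: h_def of_real_sum sum_distrib_right)
    also have "\<dots> = (\<Sum>b\<in>B. \<Sum>x\<in>Y. of_real (g (x - b)) * e_char (of_int x * \<theta>))" by (rule sum.swap)
    also have "\<dots> = (\<Sum>b\<in>B. \<Sum>z\<in>{u..v}. e_char (of_int b * \<theta>) * (of_real (g z) * e_char (of_int z * \<theta>)))"
    proof (rule sum.cong[OF refl])
      fix b assume b: "b \<in> B"
      have "(\<Sum>x\<in>Y. of_real (g (x - b)) * e_char (of_int x * \<theta>))
          = (\<Sum>x\<in>{u + b..v + b}. of_real (g (x - b)) * e_char (of_int x * \<theta>))"
        by (rule sum.mono_neutral_right) (use b B supp in \<open>auto simp: Y_def\<close>)
      also have "\<dots> = (\<Sum>z\<in>{u..v}. e_char (of_int b * \<theta>) * (of_real (g z) * e_char (of_int z * \<theta>)))"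
        by (rule sum.reindex_bij_witness[of _ "\<lambda>z. z + b" "\<lambda>x. x - b"])
           (auto simp: e_char_add[symmetric] algebra_simps)
      finally show "(\<Sum>x\<in>Y. of_real (g (x - b)) * e_char (of_int x * \<theta>)) = \<dots>" .
    qed
    also have "\<dots> = (\<Sum>b\<in>B. e_char (of_int b * \<theta>)) * (\<Sum>z\<in>{u..v}. of_real (g z) * e_char (of_int z * \<theta>))"
      by (simp add: sum_product)
    finally show ?thesis .
  qed
  have "real M * (\<Sum>x\<in>Y. (cmod (of_real (h x)))\<^sup>2)
      = (\<Sum>\<xi><M. (cmod (\<Sum>x\<in>Y. of_real (h x) * e_char (of_int x * real \<xi> / real M)))\<^sup>2)"
    by (rule parseval[symmetric]) (use B in \<open>auto simp: Y_def M_def\<close>)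
  also have "\<dots> \<le> (\<Sum>\<xi><M. S\<^sup>2 * (cmod (\<Sum>b\<in>B. 1 * e_char (of_int b * real \<xi> / real M)))\<^sup>2)"
  proof (rule sum_mono)
    fix \<xi> :: nat
    have "(cmod (\<Sum>z\<in>{u..v}. of_real (g z) * e_char (of_int z * (real \<xi> / real M))))\<^sup>2 \<le> S\<^sup>2"
      by (intro power_mono bound) auto
    then show "(cmod (\<Sum>x\<in>Y. of_real (h x) * e_char (of_int x * real \<xi> / real M)))\<^sup>2
       \<le> S\<^sup>2 * (cmod (\<Sum>b\<in>B. 1 * e_char (of_int b * real \<xi> / real M)))\<^sup>2"
      using F[of "real \<xi> / real M"]
        mult_left_mono[of _ "S\<^sup>2" "(cmod (\<Sum>b\<in>B. e_char (of_int b * real \<xi> / real M)))\<^sup>2"]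
      by (simp add: norm_mult power_mult_distrib mult.commute[of "S\<^sup>2"])
  qed
  also have "\<dots> = S\<^sup>2 * (\<Sum>\<xi><M. (cmod (\<Sum>b\<in>B. 1 * e_char (of_int b * real \<xi> / real M)))\<^sup>2)"
    by (simp add: sum_distrib_left)
  also have "\<dots> = S\<^sup>2 * (real M * (\<Sum>b\<in>B. (cmod 1)\<^sup>2))"
  proof (subst parseval)
    show "\<bar>x - y\<bar> < int M" if "x \<in> B" "y \<in> B" for x y
      using subsetD[OF B that(1)] subsetD[OF B that(2)] by (auto simp: M_def)
  qed (auto simp: finB)
  finally have *: "(\<Sum>x\<in>Y. (h x)\<^sup>2) \<le> S\<^sup>2 * real (card B)" using M by simp
  have "(\<Sum>x\<in>X. (h x)\<^sup>2) = (\<Sum>x\<in>X \<inter> Y. (h x)\<^sup>2)"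
    by (rule sum.mono_neutral_right) (use X h0 in auto)
  also have "\<dots> \<le> (\<Sum>x\<in>Y. (h x)\<^sup>2)" by (rule sum_mono2) (auto simp: Y_def)
  finally show ?thesis using * by (simp add: h_def)
qed

section \<open>The Gowers norm controls linear phases\<close>

lemma norm_sum_squared_le_card:
  fixes f :: "'a \<Rightarrow> complex"
  shows "(cmod (\<Sum>x\<in>X. f x))\<^sup>2 \<le> real (card X) * (\<Sum>x\<in>X. (cmod (f x))\<^sup>2)"
proof -
  have "(cmod (\<Sum>x\<in>X. f x))\<^sup>2 \<le> (\<Sum>x\<in>X. 1 * cmod (f x))\<^sup>2"
    using norm_sum[of f X] by (intro power_mono) auto
  also have "\<dots> \<le> (\<Sum>x\<in>X. 1\<^sup>2) * (\<Sum>x\<in>X. (cmod (f x))\<^sup>2)" by (rule Cauchy_Schwarz_ineq_sum)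
  finally show ?thesis by simp
qed

text \<open>For \<open>m \<le> b\<close> the truncated \<open>m - b\<close> is 0, which lies outside
  the support, so only the shift of {1..L} by \<open>b\<close> contributes.\<close>

lemma sum_shift_supported:
  fixes F :: "nat \<Rightarrow> nat \<Rightarrow> 'a::comm_monoid_add"
  assumes b: "b \<in> {1..L}" and F: "\<And>m c. c \<notin> {1..L} \<Longrightarrow> F m c = 0"
  shows "(\<Sum>m=1..2*L. F m (m - b)) = (\<Sum>c=1..L. F (b + c) c)"
proof -
  have "(\<Sum>m=1..2*L. F m (m - b)) = (\<Sum>m=b+1..b+L. F m (m - b))"
    by (rule sum.mono_neutral_right) (use b in \<open>auto intro!: F\<close>)
  also have "\<dots> = (\<Sum>c=1..L. F (b + c) c)"
    by (rule sum.reindex_bij_witness[of _ "\<lambda>c. b + c" "\<lambda>m. m - b"]) auto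
  finally show ?thesis .
qed

text \<open>
  Grouping the additive quadruples \<open>a + d = b + c\<close> by the common value \<open>m\<close> writes the fourth power of
  the norm as a sum of squares, so a single application of Cauchy--Schwarz suffices.
\<close>
lemma sum_fourth_power_le_quadruples:
  fixes v :: "nat \<Rightarrow> complex"
  assumes v: "\<And>n. n \<notin> {1..L} \<Longrightarrow> v n = 0"
  shows "cmod (\<Sum>a=1..L. v a) ^ 4 \<le>
    2 * real L * Re (\<Sum>a=1..L. \<Sum>b=1..L. \<Sum>c=1..L. v a * cnj (v b * v c) * v (b + c - a))"
proof -
  \<comment> \<open>\<open>r\<close> is the self-convolution of \<open>v\<close>; the range up to
    \<open>2 * L\<close> covers every sum of two points of the support.\<close>
  define r where "r m = (\<Sum>a=1..L. v a * v (m - a))" for m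
  have "(\<Sum>m=1..2*L. r m) = (\<Sum>a=1..L. \<Sum>m=1..2*L. v a * v (m - a))"
    unfolding r_def by (rule sum.swap)
  also have "\<dots> = (\<Sum>a=1..L. \<Sum>c=1..L. v a * v c)"
    by (intro sum.cong refl sum_shift_supported[where F = "\<lambda>m c. v _ * v c"]) (auto simp: v)
  also have "\<dots> = (\<Sum>a=1..L. v a)\<^sup>2"
    by (simp add: sum_product power2_eq_square)
  finally have sum_r: "(\<Sum>m=1..2*L. r m) = (\<Sum>a=1..L. v a)\<^sup>2" .
  have "complex_of_real (\<Sum>m=1..2*L. (cmod (r m))\<^sup>2) = (\<Sum>m=1..2*L. r m * cnj (r m))"
    by (simp only: complex_norm_square of_real_sum)
  also have "\<dots> = (\<Sum>m=1..2*L. \<Sum>a=1..L. \<Sum>b=1..L. v a * cnj (v b * v (m - b)) * v (m - a))"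
    by (simp add: r_def sum_product algebra_simps)
  also have "\<dots> = (\<Sum>a=1..L. \<Sum>m=1..2*L. \<Sum>b=1..L. v a * cnj (v b * v (m - b)) * v (m - a))"
    by (rule sum.swap)
  also have "\<dots> = (\<Sum>a=1..L. \<Sum>b=1..L. \<Sum>m=1..2*L. v a * cnj (v b * v (m - b)) * v (m - a))"
    by (intro sum.cong refl sum.swap)
  also have "\<dots> = (\<Sum>a=1..L. \<Sum>b=1..L. \<Sum>c=1..L. v a * cnj (v b * v c) * v (b + c - a))"
    by (intro sum.cong refl sum_shift_supported[where F = "\<lambda>m c. v _ * cnj (v _ * v c) * v (m - _)"])
       (auto simp: v)
  finally have sq: "Re (\<Sum>a=1..L. \<Sum>b=1..L. \<Sum>c=1..L. v a * cnj (v b * v c) * v (b + c - a))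
      = (\<Sum>m=1..2*L. (cmod (r m))\<^sup>2)"
    by (metis Re_complex_of_real)
  have "cmod (\<Sum>a=1..L. v a) ^ 4 = (cmod (\<Sum>m=1..2*L. r m))\<^sup>2"
    unfolding sum_r by (simp add: norm_power flip: power_mult)
  also have "\<dots> \<le> real (card {1..2*L}) * (\<Sum>m=1..2*L. (cmod (r m))\<^sup>2)"
    by (rule norm_sum_squared_le_card)
  finally show ?thesis unfolding sq by simp
qed

text \<open>Multiplication by a linear phase leaves every product over an additive quadruple
  unchanged, so the phase can be absorbed into the function before the fourth power bound is
  applied. The normalising quadruple count of the interval is at most \<open>L ^ 3\<close>.\<close>

lemma linear_phase_le_U2_interval:
  assumes L: "L \<ge> 1"
  shows "cmod (\<Sum>j=1..L. g (x + j) * e_char (real j * \<theta>)) \<le> 2 * real L * U2_interval x L g"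
proof -
  define T where "T u = Re (\<Sum>a=1..L. \<Sum>b=1..L. \<Sum>c=1..L. u a * cnj (u b * u c) * u (b + c - a))"
    for u :: "nat \<Rightarrow> complex"
  define w :: "nat \<Rightarrow> complex" where "w = indicator {1..L}"
  define u where "u n = w n * g (x + n)" for n
  define v where "v n = u n * e_char (real n * \<theta>)" for n
  have w0: "w n = 0" and u0: "u n = 0" and v0: "v n = 0" if "n \<notin> {1..L}" for n
    using that by (auto simp: w_def u_def v_def)
  have phase: "v a * cnj (v b * v c) * v (b + c - a) = u a * cnj (u b * u c) * u (b + c - a)" for a b c
  proof (cases "a \<le> b + c")
    case True
    have "e_char (real a * \<theta>) * e_char (real (b + c - a) * \<theta>) = e_char (real b * \<theta>) * e_char (real c * \<theta>)"
      unfolding e_char_add[symmetric] using True by (simp add: algebra_simps of_nat_diff)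
    moreover have "e_char (real b * \<theta>) * cnj (e_char (real b * \<theta>)) = 1"
      "e_char (real c * \<theta>) * cnj (e_char (real c * \<theta>)) = 1"
      by (simp_all add: complex_norm_square[symmetric])
    ultimately have "(e_char (real a * \<theta>) * e_char (real (b + c - a) * \<theta>)) *
       cnj (e_char (real b * \<theta>) * e_char (real c * \<theta>)) = 1"
      by (simp add: algebra_simps)
    then show ?thesis by (simp add: v_def) (metis (no_types, lifting) mult.assoc mult.left_commute mult.right_neutral)
  next
    \<comment> \<open>Here b + c < a, so the truncated index is 0, where both functions
      vanish.\<close>
    case False
    then show ?thesis by (simp add: v0 u0)
  qed
  have Tv: "T v = T u" unfolding T_def phase ..
  have four: "cmod (\<Sum>a=1..L. v a) ^ 4 \<le> 2 * real L * T u"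
  proof -
    have "cmod (\<Sum>a=1..L. v a) ^ 4 \<le> 2 * real L * T v"
      unfolding T_def by (rule sum_fourth_power_le_quadruples) (rule v0)
    then show ?thesis by (simp only: Tv)
  qed
  have Tw_le: "T w \<le> real L ^ 3"
  proof -
    have "cmod (\<Sum>a=1..L. \<Sum>b=1..L. \<Sum>c=1..L. w a * cnj (w b * w c) * w (b + c - a))
        \<le> (\<Sum>a=1..L. \<Sum>b=1..L. \<Sum>c=1..L. 1)"
      by (intro sum_norm_le) (auto simp: w_def indicator_def norm_mult)
    then show ?thesis
      unfolding T_def by (intro order_trans[OF complex_Re_le_cmod]) (simp add: power3_eq_cube)
  qed
  \<comment> \<open>The same inequality for the indicator shows that the denominator of the norm is
    positive.\<close>
  have "cmod (\<Sum>a=1..L. w a) ^ 4 \<le> 2 * real L * T w"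
    unfolding T_def by (rule sum_fourth_power_le_quadruples) (rule w0)
  moreover have "(\<Sum>a=1..L. w a) = of_nat L" by (simp add: w_def)
  ultimately have "real L ^ 4 \<le> 2 * real L * T w" by (simp del: sum.cl_ivl_Suc)
  then have "0 < 2 * real L * T w" using L by (intro less_le_trans[OF _ \<open>real L ^ 4 \<le> _\<close>]) simp
  then have Tw_pos: "T w > 0" by (simp add: zero_less_mult_iff)
  have "0 \<le> 2 * real L * T u" by (rule order_trans[OF _ four]) simp
  then have Tu: "0 \<le> T u" using L by (simp add: zero_le_mult_iff)
  have "U2_interval x L g = root 4 (T u / real (4 * L) ^ 3) / root 4 (T w / real (4 * L) ^ 3)"
    unfolding U2_interval_def T_def
    by (rule arg_cong2[where f = "(/)"]; subst U2_cyclic_supported[where L = L])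
       (auto simp: u_def w_def)
  also have "\<dots> = root 4 (T u / T w)" using L by (simp flip: real_root_divide)
  finally have U: "U2_interval x L g ^ 4 = T u / T w" "U2_interval x L g \<ge> 0"
    using Tu Tw_pos by auto
  have "cmod (\<Sum>a=1..L. v a) ^ 4 \<le> 2 * real L * (T w * U2_interval x L g ^ 4)"
    using four Tw_pos by (simp add: U)
  also have "\<dots> \<le> 2 * real L * (real L ^ 3 * U2_interval x L g ^ 4)"
    by (intro mult_left_mono mult_right_mono Tw_le) auto
  also have "\<dots> \<le> (2 * real L * U2_interval x L g) ^ 4"
  proof -
    have "2 * real L * (real L ^ 3 * U2_interval x L g ^ 4) = 2 * (real L * U2_interval x L g) ^ 4"
      by (simp add: power_mult_distrib power4_eq_xxxx power3_eq_cube)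
    \<comment> \<open>The constant 2 of the conclusion has fourth power 16, more than the factor 2
      present here.\<close>
    also have "\<dots> \<le> 16 * (real L * U2_interval x L g) ^ 4" by simp
    finally show ?thesis by (simp add: power_mult_distrib)
  qed
  finally have "cmod (\<Sum>a=1..L. v a) \<le> 2 * real L * U2_interval x L g"
    by (rule power_le_imp_le_base[of _ 3, simplified]) (use U(2) in auto)
  moreover have "(\<Sum>a=1..L. v a) = (\<Sum>j=1..L. g (x + j) * e_char (real j * \<theta>))"
    by (intro sum.cong) (auto simp: v_def u_def w_def)
  ultimately show ?thesis by simp
qed

text \<open>Averaging over all shifts by at most \<open>K\<close> replaces a long exponential sum by short ones.\<close>
lemma long_phase_le_short_U2:
  fixes g :: "nat \<Rightarrow> real"
  assumes K: "K \<ge> 1" and g: "\<And>z. z \<in> {x..y + K} \<Longrightarrow> \<bar>g z\<bar> \<le> 1"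
  shows "cmod (\<Sum>z\<in>{x..y}. of_real (g z) * e_char (real z * \<theta>))
    \<le> 2 * (\<Sum>t\<in>{x..y}. U2_interval t K (\<lambda>n. of_real (g n))) + 2 * real K"
proof -
  define v where "v z = of_real (g z) * e_char (real z * \<theta>)" for z
  define \<Sigma> where "\<Sigma> = (\<Sum>z\<in>{x..y}. v z)"
  have v1: "cmod (v z) \<le> 1" if "z \<in> {x..y + K}" for z
    using g[OF that] by (simp add: v_def norm_mult)
  \<comment> \<open>Shifting the interval of summation by \<open>j\<close> exchanges at most
    \<open>j\<close> terms at each end, each of modulus at most 1.\<close>
  have shift: "cmod (\<Sigma> - (\<Sum>t\<in>{x..y}. v (t + j))) \<le> 2 * real K" if j: "j \<in> {1..K}" for j
  proof (cases "x \<le> y")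
    case True
    have sm: "cmod (\<Sum>z\<in>Z. v z) \<le> real K" if "Z \<subseteq> {x..y + K}" "card Z \<le> K" for Z
    proof -
      have "cmod (\<Sum>z\<in>Z. v z) \<le> (\<Sum>z\<in>Z. 1)" by (rule sum_norm_le) (use v1 that in auto)
      then show ?thesis using that by simp
    qed
    have "(\<Sum>t\<in>{x..y}. v (t + j)) = (\<Sum>z\<in>{x+j..y+j}. v z)"
      by (rule sum.reindex_bij_witness[of _ "\<lambda>z. z - j" "\<lambda>t. t + j"]) auto
    moreover have "\<Sigma> = (\<Sum>z\<in>{x..y} - {x+j..y+j}. v z) + (\<Sum>z\<in>{x..y} \<inter> {x+j..y+j}. v z)"
      unfolding \<Sigma>_def by (subst add.commute, rule sum.Int_Diff) simp
    moreover have "(\<Sum>z\<in>{x+j..y+j}. v z) =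
        (\<Sum>z\<in>{x+j..y+j} - {x..y}. v z) + (\<Sum>z\<in>{x..y} \<inter> {x+j..y+j}. v z)"
      by (subst add.commute, subst Int_commute, rule sum.Int_Diff) simp
    ultimately have eq: "\<Sigma> - (\<Sum>t\<in>{x..y}. v (t + j)) =
        (\<Sum>z\<in>{x..y} - {x+j..y+j}. v z) - (\<Sum>z\<in>{x+j..y+j} - {x..y}. v z)" by simp
    have c1: "card ({x..y} - {x+j..y+j}) \<le> K"
    proof -
      have "card ({x..y} - {x+j..y+j}) \<le> card {x..<x+j}" by (rule card_mono) auto
      then show ?thesis using j by simp
    qed
    have c2: "card ({x+j..y+j} - {x..y}) \<le> K"
    proof -
      have "card ({x+j..y+j} - {x..y}) \<le> card {y+1..<y+1+j}" by (rule card_mono) auto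
      then show ?thesis using j by simp
    qed
    have "cmod (\<Sigma> - (\<Sum>t\<in>{x..y}. v (t + j))) \<le> real K + real K"
      unfolding eq by (intro order_trans[OF norm_triangle_ineq4] add_mono sm c1 c2) (use j in auto)
    then show ?thesis by simp
  qed (simp add: \<Sigma>_def)
  have "cmod (\<Sum>j=1..K. \<Sigma> - (\<Sum>t\<in>{x..y}. v (t + j))) \<le> (\<Sum>j=1..K. 2 * real K)"
    by (intro sum_norm_le shift)
  also have "(\<Sum>j=1..K. \<Sigma> - (\<Sum>t\<in>{x..y}. v (t + j))) = of_nat K * \<Sigma> - (\<Sum>t\<in>{x..y}. \<Sum>j=1..K. v (t + j))"
    by (simp add: sum_subtractf sum.swap[of _ "{x..y}"])
  finally have *: "cmod (of_nat K * \<Sigma> - (\<Sum>t\<in>{x..y}. \<Sum>j=1..K. v (t + j))) \<le> 2 * real K * real K"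
    by (simp add: algebra_simps)
  have "cmod (\<Sum>t\<in>{x..y}. \<Sum>j=1..K. v (t + j))
      \<le> (\<Sum>t\<in>{x..y}. 2 * real K * U2_interval t K (\<lambda>n. of_real (g n)))"
  proof (rule sum_norm_le)
    fix t
    \<comment> \<open>The position \<open>t\<close> contributes only a unimodular factor.\<close>
    have "(\<Sum>j=1..K. v (t + j)) = e_char (real t * \<theta>) * (\<Sum>j=1..K. of_real (g (t + j)) * e_char (real j * \<theta>))"
      by (simp add: v_def sum_distrib_left e_char_add distrib_right mult.left_commute)
    then show "cmod (\<Sum>j=1..K. v (t + j)) \<le> 2 * real K * U2_interval t K (\<lambda>n. of_real (g n))"
      using linear_phase_le_U2_interval[OF K, of "\<lambda>n. of_real (g n)" t \<theta>] by (simp add: norm_mult)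
  qed
  then have "cmod (of_nat K * \<Sigma>) \<le>
      (\<Sum>t\<in>{x..y}. 2 * real K * U2_interval t K (\<lambda>n. of_real (g n))) + 2 * real K * real K"
    using * norm_triangle_sub[of "of_nat K * \<Sigma>" "\<Sum>t\<in>{x..y}. \<Sum>j=1..K. v (t + j)"] by linarith
  also have "\<dots> = real K * (2 * (\<Sum>t\<in>{x..y}. U2_interval t K (\<lambda>n. of_real (g n))) + 2 * real K)"
    by (simp add: sum_distrib_left algebra_simps)
  finally show ?thesis using K by (simp add: norm_mult \<Sigma>_def v_def)
qed

text \<open>At frequency 0 the phase bound places a modulus below a positive multiple of the
  norm.\<close>

lemma U2_interval_nonneg:
  assumes "L \<ge> 1"
  shows "U2_interval x L g \<ge> 0"
proof -
  have "0 \<le> 2 * real L * U2_interval x L g"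
    using linear_phase_le_U2_interval[OF assms, of g x 0] norm_ge_zero order_trans by blast
  then show ?thesis using assms by (simp add: zero_le_mult_iff)
qed

section \<open>Bohr kernels\<close>

text \<open>An average of cosines, hence positive definite. The frequencies stay explicit so that
  the spectral gap can be applied to each of them.\<close>

definition phase_kernel :: "'q set \<Rightarrow> ('q \<Rightarrow> real) \<Rightarrow> int \<Rightarrow> real" where
  "phase_kernel P \<theta> t = (\<Sum>q\<in>P. Re (e_char (of_int t * \<theta> q))) / real (card P)"

text \<open>A frequency negligible at scale \<open>H\<close> contributes at most the length of the
  interval; any other one has circle norm at least C/H, and its geometric sum is at most
  H/C.\<close>

lemma phase_kernel_sum_le:
  assumes P: "finite P" "P \<noteq> {}" and C: "C > 0" and H: "H \<ge> 1"
    and gap: "\<And>q. q \<in> P \<Longrightarrow> circle_norm (\<theta> q) \<le> 1 / (C * real H) \<or> C / real H \<le> circle_norm (\<theta> q)"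
  shows "(\<Sum>t\<in>{1 - int H..<int H}. phase_kernel P \<theta> t)
    \<le> 2 * real H * (real (card {q\<in>P. circle_norm (\<theta> q) \<le> 1 / (C * real H)}) / real (card P)) + real H / C"
proof -
  define Z where "Z = {q\<in>P. circle_norm (\<theta> q) \<le> 1 / (C * real H)}"
  define I where "I = {1 - int H..<int H}"
  have ZP: "Z \<subseteq> P" by (auto simp: Z_def)
  have cI: "real (card I) \<le> 2 * real H" by (auto simp: I_def)
  have cP: "real (card P) > 0" using P by (simp add: card_gt_0_iff)
  have one: "(\<Sum>t\<in>I. Re (e_char (of_int t * \<theta> q))) \<le> (if q \<in> Z then 2 * real H else 0) + real H / C" if q: "q \<in> P" for q
  proof (cases "q \<in> Z")
    case True
    have "(\<Sum>t\<in>I. Re (e_char (of_int t * \<theta> q))) \<le> (\<Sum>t\<in>I. 1)"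
      by (intro sum_mono) (metis complex_Re_le_cmod norm_e_char)
    also have "\<dots> \<le> 2 * real H" using cI by simp
    finally show ?thesis using True C by (simp add: add_increasing2)
  next
    case False
    then have c: "C / real H \<le> circle_norm (\<theta> q)" using gap[OF q] q by (auto simp: Z_def)
    then have c0: "0 < circle_norm (\<theta> q)" using C H by (intro less_le_trans[OF _ c]) simp
    have "(\<Sum>t\<in>I. Re (e_char (of_int t * \<theta> q))) \<le> cmod (\<Sum>t\<in>I. e_char (of_int t * \<theta> q))"
      by (metis Re_sum complex_Re_le_cmod)
    also have "\<dots> \<le> 1 / circle_norm (\<theta> q)" unfolding I_def by (rule norm_e_char_int_interval_sum_le[OF c0])
    also have "\<dots> \<le> 1 / (C / real H)" using c c0 C H by (intro divide_left_mono mult_pos_pos divide_pos_pos) auto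
    finally show ?thesis using False by simp
  qed
  have "real (card P) * (\<Sum>t\<in>I. phase_kernel P \<theta> t) = (\<Sum>t\<in>I. \<Sum>q\<in>P. Re (e_char (of_int t * \<theta> q)))"
    using cP by (simp add: phase_kernel_def flip: sum_divide_distrib)
  also have "\<dots> = (\<Sum>q\<in>P. \<Sum>t\<in>I. Re (e_char (of_int t * \<theta> q)))" by (rule sum.swap)
  also have "\<dots> \<le> (\<Sum>q\<in>P. (if q \<in> Z then 2 * real H else 0) + real H / C)"
    by (intro sum_mono one)
  also have "\<dots> = 2 * real H * real (card Z) + real (card P) * (real H / C)"
    using P ZP by (simp add: sum.distrib sum.If_cases Int_absorb1)
  finally show ?thesis using cP unfolding Z_def[symmetric] I_def[symmetric] by (simp add: field_simps)
qed

text \<open>The double sum is the average over \<open>P\<close> of the squared moduli of the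
  exponential sums of \<open>U\<close>. Every term is nonnegative, and a negligible frequency loses
  at most half of the modulus to cancellation.\<close>

lemma phase_kernel_positive_definite:
  assumes P: "finite P" "P \<noteq> {}" and C: "C \<ge> 4 * pi" and H: "H \<ge> 1" and U: "U \<subseteq> {1..int H}"
  shows "real (card {q\<in>P. circle_norm (\<theta> q) \<le> 1 / (C * real H)}) / real (card P) * (real (card U))\<^sup>2 / 4
    \<le> (\<Sum>b\<in>U. \<Sum>b'\<in>U. phase_kernel P \<theta> (b - b'))"
proof -
  define Z where "Z = {q\<in>P. circle_norm (\<theta> q) \<le> 1 / (C * real H)}"
  define S where "S q = (\<Sum>b\<in>U. e_char (of_int b * \<theta> q))" for q
  have cP: "real (card P) > 0" using P by (simp add: card_gt_0_iff)
  have C0: "C > 0" using C pi_gt_zero by linarith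
  have S_eq: "(\<Sum>b\<in>U. \<Sum>b'\<in>U. Re (e_char (of_int (b - b') * \<theta> q))) = (cmod (S q))\<^sup>2" for q
  proof -
    have "complex_of_real ((cmod (S q))\<^sup>2) = (\<Sum>b\<in>U. \<Sum>b'\<in>U. e_char (of_int (b - b') * \<theta> q))"
      by (simp only: complex_norm_square S_def cnj_sum sum_product e_char_diff[symmetric] of_int_diff left_diff_distrib)
    then show ?thesis by (metis (no_types, lifting) Re_complex_of_real Re_sum sum.cong)
  qed
  have SZ: "(real (card U))\<^sup>2 / 4 \<le> (cmod (S q))\<^sup>2" if "q \<in> Z" for q
  proof -
    have "cmod (S q - of_nat (card U)) = cmod (\<Sum>b\<in>U. e_char (of_int b * \<theta> q) - 1)"
      by (simp add: S_def sum_subtractf)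
    also have "\<dots> \<le> (\<Sum>b\<in>U. 1 / 2)"
    proof (rule sum_norm_le)
      fix b assume b: "b \<in> U"
      have "cmod (e_char (of_int b * \<theta> q) - 1) \<le> 2 * pi * \<bar>of_int b\<bar> * circle_norm (\<theta> q)"
        by (rule norm_e_char_multiple_minus_one_le)
      also have "\<dots> \<le> 2 * pi * real H * (1 / (C * real H))"
        using b U that by (intro mult_mono) (auto simp: Z_def circle_norm_eq)
      also have "\<dots> = 2 * pi / C" using H by simp
      \<comment> \<open>The bound \<open>C \<ge> 4 * pi\<close> keeps every phase on {1..H} within
        1/2 of 1.\<close>
      also have "\<dots> \<le> 1 / 2" using C C0 by (simp add: field_simps)
      finally show "cmod (e_char (of_int b * \<theta> q) - 1) \<le> 1 / 2" .
    qed
    finally have "cmod (of_nat (card U) - S q) \<le> real (card U) / 2" by (simp add: norm_minus_commute)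
    moreover have "real (card U) \<le> cmod (S q) + cmod (of_nat (card U) - S q)"
      by (metis norm_of_nat norm_triangle_sub)
    ultimately have "real (card U) / 2 \<le> cmod (S q)" by linarith
    then have "(real (card U) / 2)\<^sup>2 \<le> (cmod (S q))\<^sup>2" by (intro power_mono) auto
    then show ?thesis by (simp add: power_divide)
  qed
  have "(\<Sum>b\<in>U. \<Sum>b'\<in>U. phase_kernel P \<theta> (b - b')) =
      (\<Sum>b\<in>U. \<Sum>b'\<in>U. \<Sum>q\<in>P. Re (e_char (of_int (b - b') * \<theta> q))) / real (card P)"
    by (simp add: phase_kernel_def sum_divide_distrib)
  also have "(\<Sum>b\<in>U. \<Sum>b'\<in>U. \<Sum>q\<in>P. Re (e_char (of_int (b - b') * \<theta> q)))
      = (\<Sum>b\<in>U. \<Sum>q\<in>P. \<Sum>b'\<in>U. Re (e_char (of_int (b - b') * \<theta> q)))"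
    by (intro sum.cong refl sum.swap)
  also have "\<dots> = (\<Sum>q\<in>P. (cmod (S q))\<^sup>2)"
    by (subst sum.swap) (simp only: S_eq)
  finally have eq: "(\<Sum>b\<in>U. \<Sum>b'\<in>U. phase_kernel P \<theta> (b - b')) = (\<Sum>q\<in>P. (cmod (S q))\<^sup>2) / real (card P)" .
  have "real (card Z) * ((real (card U))\<^sup>2 / 4) = (\<Sum>q\<in>Z. (real (card U))\<^sup>2 / 4)" by simp
  also have "\<dots> \<le> (\<Sum>q\<in>Z. (cmod (S q))\<^sup>2)" by (intro sum_mono SZ)
  also have "\<dots> \<le> (\<Sum>q\<in>P. (cmod (S q))\<^sup>2)" by (rule sum_mono2) (use P in \<open>auto simp: Z_def\<close>)
  finally show ?thesis unfolding eq Z_def[symmetric] using cP by (simp add: field_simps)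
qed

text \<open>A frequency that vanishes exactly contributes \<open>n\<close>. If L\<theta> is
  negligible, its multiples up to 2H still have phases with nonnegative real part; otherwise the
  geometric sum costs at most H/C. The gap is required of L\<theta> because the progression has step
  \<open>L\<close>.\<close>

lemma phase_kernel_progression_sum_ge:
  assumes P: "finite P" "P \<noteq> {}" and C: "C \<ge> 4 * pi" and H: "H \<ge> 1"
    and gap: "\<And>q. q \<in> P \<Longrightarrow> circle_norm (real L * \<theta> q) \<le> 1 / (C * real H) \<or> C / real H \<le> circle_norm (real L * \<theta> q)"
    and J: "j0 + n \<le> 2 * H"
  shows "real n * (real (card {q\<in>P. \<theta> q = 0}) / real (card P)) - real H / C
    \<le> (\<Sum>j<n. phase_kernel P \<theta> (int (L * (j0 + j))))"
proof -
  define Z where "Z = {q\<in>P. \<theta> q = 0}"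
  have cP: "real (card P) > 0" using P by (simp add: card_gt_0_iff)
  have C0: "C > 0" using C pi_gt_zero by linarith
  have one: "(if q \<in> Z then real n else 0) - real H / C \<le> (\<Sum>j<n. Re (e_char (real (L * (j0 + j)) * \<theta> q)))"
    if q: "q \<in> P" for q
  proof -
    define x where "x = real L * \<theta> q"
    have x: "real (L * (j0 + j)) * \<theta> q = of_int (int (j0 + j)) * x" for j
      by (simp add: x_def algebra_simps)
    show ?thesis
    proof (cases "q \<in> Z")
      case True
      then have "\<theta> q = 0" by (simp add: Z_def)
      then show ?thesis using True C0 by simp
    next
      case False
      show ?thesis
      proof (cases "circle_norm x \<le> 1 / (C * real H)")
        case True
        have "0 \<le> Re (e_char (of_int (int (j0 + j)) * x))" if j: "j < n" for j
        proof -
          have "cmod (e_char (of_int (int (j0 + j)) * x) - 1) \<le> 2 * pi * \<bar>of_int (int (j0 + j))\<bar> * circle_norm x"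
            by (rule norm_e_char_multiple_minus_one_le)
          also have "\<dots> \<le> 2 * pi * (2 * real H) * (1 / (C * real H))"
            using True j J by (intro mult_mono) (auto simp: circle_norm_eq)
          also have "\<dots> = 4 * pi / C" using H by simp
          also have "\<dots> \<le> 1" using C C0 by (simp add: field_simps)
          finally show ?thesis
            using abs_Re_le_cmod[of "e_char (of_int (int (j0 + j)) * x) - 1"] by simp
        qed
        then have "0 \<le> (\<Sum>j<n. Re (e_char (real (L * (j0 + j)) * \<theta> q)))"
          unfolding x by (intro sum_nonneg) auto
        then show ?thesis using False C0 by simp (smt (verit) divide_nonneg_nonneg of_nat_0_le_iff)
      next
        case far: False
        then have c: "C / real H \<le> circle_norm x" using gap[OF q] by (auto simp: x_def)
        then have c0: "0 < circle_norm x" using C0 H by (intro less_le_trans[OF _ c]) simp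
        have "\<bar>\<Sum>j<n. Re (e_char (real (L * (j0 + j)) * \<theta> q))\<bar> \<le> cmod (\<Sum>j<n. e_char ((real j0 + real j) * x))"
          unfolding x by (metis (no_types, lifting) Re_sum abs_Re_le_cmod of_int_of_nat_eq of_nat_add sum.cong)
        also have "\<dots> \<le> 1 / circle_norm x" by (rule norm_e_char_interval_sum_le[OF c0])
        also have "\<dots> \<le> 1 / (C / real H)" using c c0 C0 H by (intro divide_left_mono mult_pos_pos divide_pos_pos) auto
        finally show ?thesis using False by simp
      qed
    qed
  qed
  have "real n * real (card Z) - real (card P) * (real H / C) = (\<Sum>q\<in>P. (if q \<in> Z then real n else 0) - real H / C)"
    using P by (simp add: sum_subtractf sum.If_cases Z_def Int_def)
  also have "\<dots> \<le> (\<Sum>q\<in>P. \<Sum>j<n. Re (e_char (real (L * (j0 + j)) * \<theta> q)))"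
    by (intro sum_mono one)
  also have "\<dots> = (\<Sum>j<n. \<Sum>q\<in>P. Re (e_char (real (L * (j0 + j)) * \<theta> q)))" by (rule sum.swap)
  also have "\<dots> = real (card P) * (\<Sum>j<n. phase_kernel P \<theta> (int (L * (j0 + j))))"
    using cP by (simp add: phase_kernel_def del: of_nat_mult of_nat_add flip: sum_divide_distrib)
  finally show ?thesis unfolding Z_def[symmetric] using cP by (simp add: field_simps)
qed

section \<open>Kernels with many almost periods from the spectral gap\<close>

lemma card_square_le_pairs_in_fibres:
  assumes "finite W" "finite V" "h ` W \<subseteq> V"
  shows "(real (card W))\<^sup>2 \<le> real (card V) * real (card {p \<in> W \<times> W. h (fst p) = h (snd p)})"
proof -
  define F where "F v = {f\<in>W. h f = v}" for v
  have "card W = card (\<Union>v\<in>V. F v)" by (rule arg_cong[where f = card]) (use assms in \<open>auto simp: F_def\<close>)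
  also have "\<dots> = (\<Sum>v\<in>V. card (F v))"
    by (rule card_UN_disjoint) (use assms in \<open>auto simp: F_def\<close>)
  finally have W: "real (card W) = (\<Sum>v\<in>V. 1 * real (card (F v)))" by simp
  have "card {p \<in> W \<times> W. h (fst p) = h (snd p)} = card (\<Union>v\<in>V. F v \<times> F v)"
    by (rule arg_cong[where f = card]) (use assms in \<open>auto simp: F_def\<close>)
  also have "\<dots> = (\<Sum>v\<in>V. card (F v \<times> F v))"
    by (rule card_UN_disjoint) (use assms in \<open>auto simp: F_def\<close>)
  finally have pairs: "real (card {p \<in> W \<times> W. h (fst p) = h (snd p)}) = (\<Sum>v\<in>V. (real (card (F v)))\<^sup>2)"
    by (simp add: card_cartesian_product power2_eq_square)
  show ?thesis
    using Cauchy_Schwarz_ineq_sum[of "\<lambda>_. 1::real" "\<lambda>v. real (card (F v))" V] by (simp add: W pairs)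
qed

text \<open>The clause of \<open>U2_good_scale\<close> on integer combinations of the frequencies,
  at a single start and with \<open>C\<close> fixed.\<close>

definition spectral_gap :: "nat \<Rightarrow> real \<Rightarrow> nat \<Rightarrow> (nat \<Rightarrow> real) \<Rightarrow> bool" where
  "spectral_gap d C H \<alpha> \<longleftrightarrow> (\<forall>w :: nat \<Rightarrow> int. (\<forall>i\<in>{1..d}. \<bar>real_of_int (w i)\<bar> \<le> C) \<longrightarrow>
     circle_norm (\<Sum>i=1..d. real_of_int (w i) * \<alpha> i) \<le> 1 / (C * real H) \<or>
     circle_norm (\<Sum>i=1..d. real_of_int (w i) * \<alpha> i) \<ge> C / real H)"

text \<open>The left side will bound the kernel off the almost periods, and
  \<open>1 / real (R + 1) ^ d\<close> will bound from below the proportion of vanishing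
  frequencies.\<close>

lemma exists_power_beating_polynomial:
  fixes \<delta> \<rho> :: real
  assumes "0 < \<delta>" "\<delta> < 1" "0 < \<rho>"
  shows "\<exists>R\<ge>1. (1 - \<delta>) ^ (2 * R) \<le> \<rho> / real (R + 1) ^ d"
proof -
  have "(\<lambda>R::nat. (1 - \<delta>) ^ (2 * R) * real (R + 1) ^ d) \<longlonglongrightarrow> 0"
    using assms by real_asymp
  then have "eventually (\<lambda>R::nat. (1 - \<delta>) ^ (2 * R) * real (R + 1) ^ d < \<rho>) sequentially"
    using assms by (intro order_tendstoD) auto
  then have "eventually (\<lambda>R::nat. (1 - \<delta>) ^ (2 * R) * real (R + 1) ^ d < \<rho> \<and> R \<ge> 1) sequentially"
    by (intro eventually_conj eventually_ge_at_top)
  then obtain R where "(1 - \<delta>) ^ (2 * R) * real (R + 1) ^ d < \<rho>" "R \<ge> 1"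
    by (auto simp: eventually_sequentially)
  then show ?thesis by (intro exI[of _ R]) (simp add: field_simps less_imp_le)
qed

text \<open>
  Expanding the power on the right gives an average of pure phases indexed by pairs of words in
  \<open>{0..d}\<close>, where \<open>0\<close> stands for the constant term; a phase depends only on how often each
  letter occurs.
\<close>
lemma bohr_phase_kernel:
  fixes \<alpha> :: "nat \<Rightarrow> real"
  defines "W \<equiv> \<lambda>R d. {..<R} \<rightarrow>\<^sub>E {0..d}"
    and "cnt \<equiv> \<lambda>R d f. restrict (\<lambda>i. card {j\<in>{..<R}. f j = i}) {1..d}"
  defines "\<theta> \<equiv> \<lambda>R d p. \<Sum>i=1..d. real_of_int (int (cnt R d (fst p) i) - int (cnt R d (snd p) i)) * \<alpha> i"
  shows "phase_kernel (W R d \<times> W R d) (\<theta> R d) t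
    = (cmod (1 + (\<Sum>i=1..d. e_char (of_int t * \<alpha> i))) / real (d + 1)) ^ (2 * R)"
proof -
  \<comment> \<open>Letter 0 carries frequency 0, so that the constant term is treated like the
    other letters.\<close>
  define \<beta> where "\<beta> i = (if i = 0 then 0 else \<alpha> i)" for i
  define \<phi> where "\<phi> f = (\<Sum>j<R. \<beta> (f j))" for f :: "nat \<Rightarrow> nat"
  have \<phi>: "\<phi> f = (\<Sum>i=1..d. real (cnt R d f i) * \<alpha> i)" if f: "f \<in> W R d" for f
  proof -
    have "\<phi> f = (\<Sum>i\<in>{0..d}. \<Sum>j\<in>{j\<in>{..<R}. f j = i}. \<beta> (f j))"
      unfolding \<phi>_def using f by (intro sum.group[symmetric]) (auto simp: W_def)
    also have "\<dots> = (\<Sum>i\<in>{0..d}. real (card {j\<in>{..<R}. f j = i}) * \<beta> i)"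
      by (intro sum.cong refl) simp
    also have "\<dots> = (\<Sum>i=1..d. real (card {j\<in>{..<R}. f j = i}) * \<beta> i)"
      by (intro sum.mono_neutral_right) (auto simp: \<beta>_def)
    also have "\<dots> = (\<Sum>i=1..d. real (cnt R d f i) * \<alpha> i)"
      by (intro sum.cong) (auto simp: \<beta>_def cnt_def)
    finally show ?thesis .
  qed
  have cW: "card (W R d) = (d + 1) ^ R" by (simp add: W_def card_PiE)
  have base: "1 + (\<Sum>i=1..d. e_char (of_int t * \<alpha> i)) = (\<Sum>i\<in>{0..d}. e_char (of_int t * \<beta> i))"
  proof -
    have "{0..d} = insert 0 {1..d}" by auto
    then show ?thesis by (simp add: \<beta>_def)
  qed
  have pow: "(\<Sum>i\<in>{0..d}. e_char (of_int t * \<beta> i)) ^ R = (\<Sum>f\<in>W R d. e_char (of_int t * \<phi> f))"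
  proof -
    have "(\<Sum>i\<in>{0..d}. e_char (of_int t * \<beta> i)) ^ R = (\<Prod>j<R. \<Sum>i\<in>{0..d}. e_char (of_int t * \<beta> i))"
      by simp
    also have "\<dots> = (\<Sum>f\<in>W R d. \<Prod>j<R. e_char (of_int t * \<beta> (f j)))"
      unfolding W_def by (rule prod_sum_PiE) auto
    also have "\<dots> = (\<Sum>f\<in>W R d. e_char (of_int t * \<phi> f))"
      by (simp add: \<phi>_def sum_distrib_left e_char_sum)
    finally show ?thesis .
  qed
  have "complex_of_real ((cmod (\<Sum>f\<in>W R d. e_char (of_int t * \<phi> f)))\<^sup>2)
      = (\<Sum>f\<in>W R d. \<Sum>f'\<in>W R d. e_char (of_int t * (\<phi> f - \<phi> f')))"
    by (simp only: complex_norm_square cnj_sum sum_product e_char_diff[symmetric] right_diff_distrib)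
  also have "\<dots> = (\<Sum>p\<in>W R d \<times> W R d. e_char (of_int t * (\<phi> (fst p) - \<phi> (snd p))))"
    by (simp add: sum.cartesian_product case_prod_unfold)
  also have "\<dots> = (\<Sum>p\<in>W R d \<times> W R d. e_char (of_int t * \<theta> R d p))"
    by (intro sum.cong refl) (auto simp: \<phi> \<theta>_def sum_subtractf left_diff_distrib)
  finally have "(cmod (\<Sum>f\<in>W R d. e_char (of_int t * \<phi> f)))\<^sup>2 = (\<Sum>p\<in>W R d \<times> W R d. Re (e_char (of_int t * \<theta> R d p)))"
    by (metis Re_complex_of_real Re_sum)
  moreover have "(cmod (\<Sum>f\<in>W R d. e_char (of_int t * \<phi> f)))\<^sup>2
      = cmod (1 + (\<Sum>i=1..d. e_char (of_int t * \<alpha> i))) ^ (2 * R)"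
    unfolding base pow[symmetric] by (simp add: norm_power power_mult[symmetric] mult.commute)
  ultimately show ?thesis
    by (simp add: phase_kernel_def card_cartesian_product cW power_divide power_mult power2_eq_square
        power_mult_distrib flip: power_add)
qed

text \<open>Some \<open>z i\<close> is at distance more than \<kappa>/d from 1, and adding it to the
  constant term 1 loses a definite amount; the other terms are bounded trivially.\<close>

lemma norm_average_le_of_far_from_one:
  assumes z: "\<And>i. i \<in> {1..d} \<Longrightarrow> cmod (z i) = 1" and d: "d \<ge> 1" and \<kappa>: "\<kappa> > 0"
    and far: "(\<Sum>i=1..d. cmod (z i - 1)) > \<kappa>"
  shows "cmod (1 + (\<Sum>i=1..d. z i)) / real (d + 1) \<le> 1 - \<kappa>\<^sup>2 / (4 * real d ^ 2 * real (d + 1))"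
proof -
  obtain i where i: "i \<in> {1..d}" and ki: "\<kappa> / real d < cmod (z i - 1)"
  proof (rule ccontr)
    assume "\<not> thesis"
    then have "\<And>i. i \<in> {1..d} \<Longrightarrow> cmod (z i - 1) \<le> \<kappa> / real d" using that by force
    then have "(\<Sum>i=1..d. cmod (z i - 1)) \<le> (\<Sum>i=1..d. \<kappa> / real d)" by (intro sum_mono)
    then show False using far d by simp
  qed
  define x where "x = (\<kappa> / real d)\<^sup>2"
  \<comment> \<open>The parallelogram law for two unit vectors.\<close>
  have "(cmod (1 + z i))\<^sup>2 + (cmod (z i - 1))\<^sup>2 = 4"
  proof -
    have "(Re (z i))\<^sup>2 + (Im (z i))\<^sup>2 = 1" using z[OF i] by (metis cmod_power2 one_power2)
    then show ?thesis unfolding cmod_power2 by (simp add: power2_eq_square algebra_simps)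
  qed
  moreover have "x \<le> (cmod (z i - 1))\<^sup>2"
    unfolding x_def using ki \<kappa> by (intro power_mono) auto
  ultimately have x: "(cmod (1 + z i))\<^sup>2 \<le> 4 - x" by linarith
  have "cmod (1 + z i) \<le> 2 - x / 4"
  proof (rule power2_le_imp_le)
    have "(2 - x / 4)\<^sup>2 = 4 - x + (x / 4)\<^sup>2" by (simp add: power2_eq_square algebra_simps)
    then show "(cmod (1 + z i))\<^sup>2 \<le> (2 - x / 4)\<^sup>2" using x by (smt (verit) zero_le_power2)
    show "0 \<le> 2 - x / 4" using x by (smt (verit) zero_le_power2 divide_le_eq_1 field_sum_of_halves)
  qed
  moreover have "1 + (\<Sum>i=1..d. z i) = (1 + z i) + (\<Sum>j\<in>{1..d} - {i}. z j)"
    using i by (simp add: sum.remove)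
  moreover have "cmod (\<Sum>j\<in>{1..d} - {i}. z j) \<le> (\<Sum>j\<in>{1..d} - {i}. 1)"
    by (rule sum_norm_le) (use z in auto)
  ultimately have "cmod (1 + (\<Sum>i=1..d. z i)) \<le> 2 - x / 4 + real (card ({1..d} - {i}))"
    by (smt (verit) norm_triangle_ineq real_of_card)
  also have "\<dots> = real (d + 1) - x / 4" using i d by (simp add: of_nat_diff)
  finally have "cmod (1 + (\<Sum>i=1..d. z i)) / real (d + 1) \<le> (real (d + 1) - x / 4) / real (d + 1)"
    by (intro divide_right_mono) auto
  also have "\<dots> = 1 - \<kappa>\<^sup>2 / (4 * real d ^ 2 * real (d + 1))"
    using d by (simp add: x_def power_divide diff_divide_distrib mult.assoc)
  finally show ?thesis .
qed

text \<open>
  In \<open>bohr_kernel\<close> the parameter \<open>\<mu>\<close> is the proportion of frequencies of \<open>k\<close> that are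
  indistinguishable from \<open>0\<close> at scale \<open>H\<close>; by the spectral gap it is about the mean of \<open>k\<close> at that
  scale.
\<close>
definition is_bohr_kernel ::
    "nat \<Rightarrow> (nat \<Rightarrow> real) \<Rightarrow> nat \<Rightarrow> real \<Rightarrow> (int \<Rightarrow> real) \<Rightarrow> real \<Rightarrow> real \<Rightarrow> bool" where
  "is_bohr_kernel d \<alpha> H \<kappa> k \<mu> \<tau> \<longleftrightarrow> 0 \<le> \<tau> \<and> (\<forall>t. 0 \<le> k t \<and> k t \<le> 1) \<and>
     (\<forall>t. \<tau> < k t \<longrightarrow> (\<Sum>i=1..d. cmod (e_char (of_int t * \<alpha> i) - 1)) \<le> \<kappa>) \<and>
     (\<Sum>t\<in>{1 - int H..<int H}. k t) \<le> 3 * \<mu> * real H \<and>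
     (\<forall>U\<subseteq>{1..int H}. \<mu> * (real (card U))\<^sup>2 / 4 \<le> (\<Sum>b\<in>U. \<Sum>b'\<in>U. k (b - b')))"

text \<open>All constants are chosen before \<open>H\<close> and \<open>\<alpha>\<close>, hence
  serve every window at once. This is possible because \<open>m0\<close> comes from frequencies that
  vanish whatever \<open>\<alpha>\<close> is: pairs of words with equal letter counts.\<close>

lemma bohr_kernel:
  fixes \<kappa> \<rho> \<eta> :: real
  assumes d: "d \<ge> 1" and \<kappa>: "\<kappa> > 0" and \<rho>: "0 < \<rho>" "\<rho> \<le> 1 / 2" and \<eta>: "0 < \<eta>" "\<eta> \<le> 1" and L: "L \<ge> 1"
  shows "\<exists>C\<ge>1. \<exists>H0. \<exists>m0>0. \<forall>H\<ge>H0. \<forall>\<alpha>. H \<ge> 1 \<and> spectral_gap d C H \<alpha> \<longrightarrow>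
    (\<exists>k \<mu> \<tau>. m0 \<le> \<mu> \<and> \<tau> \<le> \<rho> * \<mu> \<and> is_bohr_kernel d \<alpha> H \<kappa> k \<mu> \<tau> \<and>
      (\<exists>Q. H \<le> Q \<and> real Q \<le> (1 + \<eta>) * real H \<and> L dvd Q \<and> \<tau> < k (int Q)))"
proof -
  define \<delta> where "\<delta> = min (1 / 2) (\<kappa>\<^sup>2 / (4 * real d ^ 2 * real (d + 1)))"
  have \<delta>: "0 < \<delta>" "\<delta> < 1" using d \<kappa> by (auto simp: \<delta>_def)
  obtain R where R: "R \<ge> 1" "(1 - \<delta>) ^ (2 * R) \<le> \<rho> / real (R + 1) ^ d"
    using exists_power_beating_polynomial[OF \<delta> \<rho>(1)] by blast
  define m0 where "m0 = 1 / real (R + 1) ^ d"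
  define \<tau> where "\<tau> = (1 - \<delta>) ^ (2 * R)"
  have m0: "m0 > 0" by (simp add: m0_def)
  have \<tau>: "0 \<le> \<tau>" "\<tau> \<le> \<rho> * m0" using R \<delta> by (auto simp: \<tau>_def m0_def)
  \<comment> \<open>The summands serve in turn the phases near 1, the integer coefficients of L
    times a frequency, the tail of the kernel sum against \<open>\<mu>\<close>, and the error along
    the multiples of \<open>L\<close>.\<close>
  define C where "C = 4 * pi + real (L * R) + 1 / m0 + 8 * real L / (\<eta> * m0)"
  have pos: "0 \<le> real (L * R)" "0 \<le> 1 / m0" "0 \<le> 8 * real L / (\<eta> * m0)" using m0 \<eta> by auto
  have C: "4 * pi \<le> C" "real (L * R) \<le> C" "1 / m0 \<le> C" "8 * real L / (\<eta> * m0) \<le> C"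
    using pos pi_gt_zero unfolding C_def by linarith+
  have C1: "C \<ge> 1" using C(1) pi_gt3 by linarith
  have RC: "real R \<le> C"
    using C(2) L by (metis le_trans mult_le_mono1 nat_mult_1 of_nat_le_iff order_trans)
  \<comment> \<open>This gives \<open>2 * L \<le> \<eta> * H\<close>, so rounding up to a multiple
    of \<open>L\<close> uses at most half of the allowed excess.\<close>
  define H0 where "H0 = nat \<lceil>2 * real L / \<eta>\<rceil>"
  define W where "W = {..<R} \<rightarrow>\<^sub>E {0..d}"
  define cnt where "cnt f = restrict (\<lambda>i. card {j\<in>{..<R}. f j = i}) {1..d}" for f :: "nat \<Rightarrow> nat"
  have finW: "finite W" by (simp add: W_def finite_PiE)
  have neW: "W \<noteq> {}" by (simp add: W_def PiE_eq_empty_iff)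
  have cnt_le: "cnt f i \<le> R" if "i \<in> {1..d}" for f i
  proof -
    have "card {j\<in>{..<R}. f j = i} \<le> card {..<R}" by (rule card_mono) auto
    then show ?thesis using that by (simp add: cnt_def)
  qed
  show ?thesis
  proof (rule exI[of _ C], rule conjI[OF C1], rule exI[of _ H0], rule exI[of _ m0], rule conjI[OF m0],
      intro allI impI, elim conjE)
    fix H :: nat and \<alpha> :: "nat \<Rightarrow> real"
    assume HH0: "H \<ge> H0" and H: "H \<ge> 1" and gap: "spectral_gap d C H \<alpha>"
    define \<theta> where "\<theta> p = (\<Sum>i=1..d. real_of_int (int (cnt (fst p) i) - int (cnt (snd p) i)) * \<alpha> i)" for p
    define P where "P = W \<times> W"
    have P: "finite P" "P \<noteq> {}" using finW neW by (auto simp: P_def)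
    have cP: "real (card P) > 0" using P by (simp add: card_gt_0_iff)
    define k where "k = phase_kernel P \<theta>"
    have k_eq: "k t = (cmod (1 + (\<Sum>i=1..d. e_char (of_int t * \<alpha> i))) / real (d + 1)) ^ (2 * R)" for t
      unfolding k_def P_def \<theta>_def[abs_def] cnt_def[abs_def] W_def by (rule bohr_phase_kernel)
    define \<mu> where "\<mu> = real (card {q\<in>P. circle_norm (\<theta> q) \<le> 1 / (C * real H)}) / real (card P)"
    define \<mu>0 where "\<mu>0 = real (card {q\<in>P. \<theta> q = 0}) / real (card P)"
    \<comment> \<open>Factor 1 is for the kernel sum over an interval, factor \<open>L\<close> for
      the sum over multiples of \<open>L\<close>.\<close>
    have near: "circle_norm (real l * \<theta> q) \<le> 1 / (C * real H) \<or> C / real H \<le> circle_norm (real l * \<theta> q)"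
      if "l \<in> {1, L}" for l q
    proof -
      define w where "w i = int l * (int (cnt (fst q) i) - int (cnt (snd q) i))" for i
      have "\<bar>real_of_int (w i)\<bar> \<le> C" if i: "i \<in> {1..d}" for i
      proof -
        have "\<bar>int (cnt (fst q) i) - int (cnt (snd q) i)\<bar> \<le> int R"
          using cnt_le[OF i, of "fst q"] cnt_le[OF i, of "snd q"] by linarith
        then have "\<bar>w i\<bar> \<le> int l * int R" by (simp add: w_def abs_mult mult_left_mono)
        then have "\<bar>real_of_int (w i)\<bar> \<le> real (l * R)" by (metis of_int_abs of_int_le_iff of_int_of_nat_eq of_nat_mult)
        then show ?thesis using that \<open>l \<in> {1, L}\<close> RC C(2) by auto
      qed
      moreover have "(\<Sum>i=1..d. real_of_int (w i) * \<alpha> i) = real l * \<theta> q"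
        by (simp add: w_def \<theta>_def sum_distrib_left mult.assoc)
      ultimately show ?thesis using gap unfolding spectral_gap_def by (metis (no_types, lifting))
    qed
    have \<mu>0: "m0 \<le> \<mu>0"
    proof -
      \<comment> \<open>Letter counts take at most \<open>card V\<close> values, so by
        Cauchy-Schwarz at least the proportion \<open>1 / card V\<close> of all pairs of words
        collide.\<close>
      define V where "V = {1..d} \<rightarrow>\<^sub>E {0..R}"
      have cV: "real (card V) = real (R + 1) ^ d" by (simp add: V_def card_PiE)
      have "(real (card W))\<^sup>2 \<le> real (card V) * real (card {p \<in> W \<times> W. cnt (fst p) = cnt (snd p)})"
        by (rule card_square_le_pairs_in_fibres)
           (use cnt_le in \<open>auto simp: finW V_def finite_PiE cnt_def\<close>)
      also have "\<dots> \<le> real (card V) * real (card {q\<in>P. \<theta> q = 0})"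
        by (intro mult_left_mono of_nat_mono card_mono) (auto simp: P_def \<theta>_def finW)
      finally have "real (card P) \<le> real (card V) * real (card {q\<in>P. \<theta> q = 0})"
        by (simp add: P_def card_cartesian_product power2_eq_square)
      then show ?thesis using cP cV by (simp add: m0_def \<mu>0_def field_simps)
    qed
    have "\<mu>0 \<le> \<mu>"
      unfolding \<mu>0_def \<mu>_def using P C1
      by (intro divide_right_mono of_nat_mono card_mono) (auto simp: circle_norm_eq)
    then have \<mu>: "m0 \<le> \<mu>" using \<mu>0 by linarith
    have k01: "0 \<le> k t \<and> k t \<le> 1" for t
    proof -
      have "cmod (1 + (\<Sum>i=1..d. e_char (of_int t * \<alpha> i))) \<le> 1 + (\<Sum>i=1..d. 1)"
        by (intro order_trans[OF norm_triangle_ineq] add_mono sum_norm_le) auto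
      then have "cmod (1 + (\<Sum>i=1..d. e_char (of_int t * \<alpha> i))) / real (d + 1) \<le> 1" by simp
      then show ?thesis unfolding k_eq by (auto intro!: power_le_one)
    qed
    have tail: "(\<Sum>i=1..d. cmod (e_char (of_int t * \<alpha> i) - 1)) \<le> \<kappa>" if t: "\<tau> < k t" for t
    proof (rule ccontr)
      assume "\<not> ?thesis"
      then have "cmod (1 + (\<Sum>i=1..d. e_char (of_int t * \<alpha> i))) / real (d + 1) \<le> 1 - \<kappa>\<^sup>2 / (4 * real d ^ 2 * real (d + 1))"
        by (intro norm_average_le_of_far_from_one d \<kappa>) auto
      also have "\<dots> \<le> 1 - \<delta>" by (simp add: \<delta>_def)
      finally have "k t \<le> \<tau>" unfolding k_eq \<tau>_def by (intro power_mono) auto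
      then show False using t by simp
    qed
    have sum_k: "(\<Sum>t\<in>{1 - int H..<int H}. k t) \<le> 3 * \<mu> * real H"
    proof -
      have "(\<Sum>t\<in>{1 - int H..<int H}. k t) \<le> 2 * real H * \<mu> + real H / C"
        unfolding k_def \<mu>_def using C1 near[of 1] by (intro phase_kernel_sum_le P H) auto
      also have "real H / C \<le> real H * \<mu>"
      proof -
        have "1 / C \<le> m0" using C(3) C1 m0 by (simp add: field_simps)
        then have "1 / C \<le> \<mu>" using \<mu> by linarith
        then have "real H * (1 / C) \<le> real H * \<mu>" by (intro mult_left_mono) auto
        then show ?thesis by simp
      qed
      finally show ?thesis by (simp add: algebra_simps)
    qed
    have exQ: "\<exists>Q. H \<le> Q \<and> real Q \<le> (1 + \<eta>) * real H \<and> L dvd Q \<and> \<tau> < k (int Q)"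
    proof -
      \<comment> \<open>The candidates for \<open>Q\<close> are \<open>n\<close> consecutive
        multiples of \<open>L\<close>, beginning with the first that is at least \<open>H\<close>
        and spanning about \<eta>H/2.\<close>
      define n where "n = nat \<lceil>\<eta> * real H / (2 * real L)\<rceil>"
      define j0 where "j0 = (H + L - 1) div L"
      have "2 * real L / \<eta> \<le> real H0" unfolding H0_def by (rule real_nat_ceiling_ge)
      also have "\<dots> \<le> real H" using HH0 by simp
      finally have HL: "2 * real L \<le> \<eta> * real H" using \<eta> by (simp add: field_simps)
      have npos: "0 < \<eta> * real H / (2 * real L)" using \<eta> H L by simp
      have n1: "\<eta> * real H / (2 * real L) \<le> real n" unfolding n_def by (rule real_nat_ceiling_ge)
      have n2: "real n < \<eta> * real H / (2 * real L) + 1" unfolding n_def using npos by linarith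
      have Hj0: "H \<le> L * j0" 
      proof -
        have "H + L - 1 = L * j0 + (H + L - 1) mod L" by (simp add: j0_def)
        moreover have "(H + L - 1) mod L \<le> L - 1" using L by (metis Suc_pred' less_Suc_eq_le mod_less_divisor less_le_trans zero_less_one)
        ultimately show ?thesis using L by linarith
      qed
      have Lj0: "L * j0 \<le> H + L - 1" by (simp add: j0_def)
      have upper: "real (L * (j0 + j)) \<le> (1 + \<eta>) * real H" if "j < n" for j
      proof -
        have "real L * real j \<le> real L * (\<eta> * real H / (2 * real L))"
          using that n2 by (intro mult_left_mono) auto
        also have "\<dots> = \<eta> * real H / 2" using L by simp
        finally have "real (L * j) \<le> \<eta> * real H / 2" by simp
        moreover have "real (L * j0) \<le> real H + real L" using Lj0 by linarith
        ultimately show ?thesis using HL by (simp add: algebra_simps)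
      qed
      have n0: "n > 0" using n1 npos by (metis gr0I leD of_nat_0)
      have J: "j0 + n \<le> 2 * H"
      proof -
        have "real (L * (j0 + (n - 1))) \<le> (1 + \<eta>) * real H" using n0 by (intro upper) simp
        also have "\<dots> \<le> 2 * real H" using \<eta> by (intro mult_right_mono) auto
        finally have a: "L * (j0 + (n - 1)) \<le> 2 * H" by linarith
        \<comment> \<open>For \<open>L \<ge> 2\<close> halving the bound on the last multiple
          suffices; step 1 offers no such saving, so \<open>j0\<close> and \<open>n\<close> are
          bounded separately.\<close>
        show ?thesis
        proof (cases "L = 1")
          case True
          have "real n < real H / 2 + 1"
          proof -
            have "\<eta> * real H / (2 * real L) \<le> real H / 2" using \<eta> True mult_right_mono[of \<eta> 1 "real H"] by simp
            then show ?thesis using n2 by linarith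
          qed
          moreover have "2 \<le> real H"
            using HL True \<eta> mult_right_mono[of \<eta> 1 "real H"] by simp
          ultimately have "real n \<le> real H" by linarith
          moreover have "j0 \<le> H" using Lj0 True by simp
          ultimately show ?thesis by linarith
        next
          case False
          then have "2 * (j0 + (n - 1)) \<le> 2 * H" using L a mult_le_mono1[of 2 L "j0 + (n - 1)"] by linarith
          then show ?thesis using H by arith
        qed
      qed
      \<comment> \<open>If all candidates had kernel value at most \<tau> \<le> m0/2, the lower
        bound for the sum would force n m0/2 \<le> H/C, whereas the last summand of \<open>C\<close>
        gives H/C \<le> n m0/4.\<close>
      have "\<exists>j<n. \<tau> < k (int (L * (j0 + j)))"
      proof (rule ccontr)
        assume "\<not> ?thesis"
        then have "(\<Sum>j<n. k (int (L * (j0 + j)))) \<le> (\<Sum>j<n. \<tau>)" by (intro sum_mono) force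
        moreover have "real n * \<mu>0 - real H / C \<le> (\<Sum>j<n. k (int (L * (j0 + j))))"
          unfolding \<mu>0_def k_def using near[of L] by (intro phase_kernel_progression_sum_ge P C H J) auto
        ultimately have "real n * \<mu>0 - real H / C \<le> real n * \<tau>" by simp
        moreover have "real n * m0 \<le> real n * \<mu>0" using \<mu>0 by (intro mult_left_mono) auto
        moreover have "real n * \<tau> \<le> real n * (m0 / 2)"
        proof (rule mult_left_mono)
          have "\<rho> * m0 \<le> 1 / 2 * m0" using \<rho> m0 by (intro mult_right_mono) auto
          then show "\<tau> \<le> m0 / 2" using \<tau> by linarith
        qed simp
        moreover have "real n * m0 = 2 * (real n * (m0 / 2))" by simp
        ultimately have "real n * (m0 / 2) \<le> real H / C" by linarith
        moreover have "real H / C \<le> real n * (m0 / 4)"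
        proof -
          have "2 * real L / \<eta> / C \<le> m0 / 4"
            using C(4) C1 m0 \<eta> by (simp add: field_simps)
          then have "real n * (2 * real L / \<eta> / C) \<le> real n * (m0 / 4)" by (intro mult_left_mono) auto
          moreover have "real H \<le> real n * (2 * real L / \<eta>)" using n1 \<eta> L by (simp add: field_simps)
          then have "real H / C \<le> real n * (2 * real L / \<eta>) / C" using C1 by (intro divide_right_mono) auto
          moreover have "real n * (2 * real L / \<eta>) / C = real n * (2 * real L / \<eta> / C)" by simp
          ultimately show ?thesis by linarith
        qed
        ultimately have "real n * (m0 / 2) \<le> real n * (m0 / 4)" by linarith
        then show False using n0 m0 by simp
      qed
      then obtain j where j: "j < n" "\<tau> < k (int (L * (j0 + j)))" by blast
      have "H \<le> L * (j0 + j)" using Hj0 by (simp add: distrib_left trans_le_add1)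
      then show ?thesis using upper[OF j(1)] j(2) by (intro exI[of _ "L * (j0 + j)"]) auto
    qed
    have "\<tau> \<le> \<rho> * \<mu>" using \<tau>(2) \<mu> \<rho> mult_left_mono[of m0 \<mu> \<rho>] by linarith
    moreover have "is_bohr_kernel d \<alpha> H \<kappa> k \<mu> \<tau>"
      unfolding is_bohr_kernel_def
    proof (intro conjI \<tau>(1) sum_k)
      show "\<forall>t. 0 \<le> k t \<and> k t \<le> 1" using k01 by simp
      show "\<forall>t. \<tau> < k t \<longrightarrow> (\<Sum>i=1..d. cmod (e_char (of_int t * \<alpha> i) - 1)) \<le> \<kappa>" using tail by simp
      show "\<forall>U\<subseteq>{1..int H}. \<mu> * (real (card U))\<^sup>2 / 4 \<le> (\<Sum>b\<in>U. \<Sum>b'\<in>U. k (b - b'))"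
        unfolding k_def \<mu>_def by (intro allI impI phase_kernel_positive_definite P C H)
    qed
    ultimately show "\<exists>k \<mu> \<tau>. m0 \<le> \<mu> \<and> \<tau> \<le> \<rho> * \<mu> \<and> is_bohr_kernel d \<alpha> H \<kappa> k \<mu> \<tau> \<and>
      (\<exists>Q. H \<le> Q \<and> real Q \<le> (1 + \<eta>) * real H \<and> L dvd Q \<and> \<tau> < k (int Q))"
      using \<mu> exQ by (intro exI[of _ k] exI[of _ \<mu>] exI[of _ \<tau>] conjI)
  qed
qed

section \<open>Sumsets in a structured window\<close>

text \<open>The approximated function is real, so taking the real part cannot increase the
  error.\<close>

definition trig_poly :: "nat \<Rightarrow> (nat \<Rightarrow> complex) \<Rightarrow> (nat \<Rightarrow> real) \<Rightarrow> int \<Rightarrow> real" where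
  "trig_poly d c \<alpha> z = Re (\<Sum>i=1..d. c i * e_char (of_int z * \<alpha> i))"

lemma abs_trig_poly_le:
  assumes "\<And>i. i \<in> {1..d} \<Longrightarrow> cmod (c i) \<le> 1"
  shows "\<bar>trig_poly d c \<alpha> z\<bar> \<le> real d"
proof -
  have "\<bar>trig_poly d c \<alpha> z\<bar> \<le> cmod (\<Sum>i=1..d. c i * e_char (of_int z * \<alpha> i))"
    unfolding trig_poly_def by (rule abs_Re_le_cmod)
  also have "\<dots> \<le> (\<Sum>i=1..d. 1)" by (rule sum_norm_le) (use assms in \<open>auto simp: norm_mult\<close>)
  finally show ?thesis by simp
qed

lemma trig_poly_shift_le:
  assumes "\<And>i. i \<in> {1..d} \<Longrightarrow> cmod (c i) \<le> 1"
  shows "\<bar>trig_poly d c \<alpha> (z + t) - trig_poly d c \<alpha> z\<bar> \<le> (\<Sum>i=1..d. cmod (e_char (of_int t * \<alpha> i) - 1))"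
proof -
  have "trig_poly d c \<alpha> (z + t) - trig_poly d c \<alpha> z
      = Re (\<Sum>i=1..d. c i * e_char (of_int z * \<alpha> i) * (e_char (of_int t * \<alpha> i) - 1))"
    unfolding trig_poly_def minus_complex.simps(1)[symmetric] sum_subtractf[symmetric]
    by (simp add: e_char_add algebra_simps)
  also have "\<bar>\<dots>\<bar> \<le> cmod (\<Sum>i=1..d. c i * e_char (of_int z * \<alpha> i) * (e_char (of_int t * \<alpha> i) - 1))"
    by (rule abs_Re_le_cmod)
  also have "\<dots> \<le> (\<Sum>i=1..d. cmod (e_char (of_int t * \<alpha> i) - 1))"
    by (rule sum_norm_le) (use assms in \<open>auto simp: norm_mult intro!: mult_left_le_one_le\<close>)
  finally show ?thesis .
qed

text \<open>One factor of the polynomial turns a phase sum into a combination of phase sums at the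
  frequencies \<theta> + \<alpha>_i and \<theta> - \<alpha>_i, of total weight at most
  \<open>d\<close>. The induction therefore needs a bound uniform in \<theta>.\<close>

lemma phase_sum_trig_poly_power_le:
  fixes g :: "int \<Rightarrow> real"
  assumes c: "\<And>i. i \<in> {1..d} \<Longrightarrow> cmod (c i) \<le> 1"
    and S: "\<And>\<theta>. cmod (\<Sum>z\<in>J. of_real (g z) * e_char (of_int z * \<theta>)) \<le> S"
  shows "cmod (\<Sum>z\<in>J. of_real (g z * trig_poly d c \<alpha> z ^ k) * e_char (of_int z * \<theta>)) \<le> real d ^ k * S"
proof (induction k arbitrary: \<theta>)
  case 0
  then show ?case using S by simp
next
  case (Suc k)
  define F where "F \<theta> = (\<Sum>z\<in>J. of_real (g z * trig_poly d c \<alpha> z ^ k) * e_char (of_int z * \<theta>))" for \<theta>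
  have p: "complex_of_real (trig_poly d c \<alpha> z) =
     (\<Sum>i=1..d. c i / 2 * e_char (of_int z * \<alpha> i) + cnj (c i) / 2 * e_char (- (of_int z * \<alpha> i)))" for z
  proof -
    define w where "w = (\<Sum>i=1..d. c i * e_char (of_int z * \<alpha> i))"
    have "complex_of_real (Re w) = (w + cnj w) / 2" by (simp add: complex_add_cnj)
    also have "\<dots> = (\<Sum>i=1..d. c i / 2 * e_char (of_int z * \<alpha> i) + cnj (c i) / 2 * e_char (- (of_int z * \<alpha> i)))"
      by (simp add: w_def cnj_sum e_char_minus sum.distrib add_divide_distrib flip: sum_divide_distrib)
    finally show ?thesis by (simp add: trig_poly_def w_def)
  qed
  have "(\<Sum>z\<in>J. of_real (g z * trig_poly d c \<alpha> z ^ Suc k) * e_char (of_int z * \<theta>))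
      = (\<Sum>z\<in>J. of_real (g z * trig_poly d c \<alpha> z ^ k) * e_char (of_int z * \<theta>) * of_real (trig_poly d c \<alpha> z))"
    by (simp add: mult_ac)
  also have "\<dots> = (\<Sum>z\<in>J. \<Sum>i=1..d. of_real (g z * trig_poly d c \<alpha> z ^ k) * e_char (of_int z * \<theta>) *
       (c i / 2 * e_char (of_int z * \<alpha> i) + cnj (c i) / 2 * e_char (- (of_int z * \<alpha> i))))"
    by (simp only: p sum_distrib_left)
  also have "\<dots> = (\<Sum>i=1..d. \<Sum>z\<in>J. of_real (g z * trig_poly d c \<alpha> z ^ k) * e_char (of_int z * \<theta>) *
       (c i / 2 * e_char (of_int z * \<alpha> i) + cnj (c i) / 2 * e_char (- (of_int z * \<alpha> i))))"
    by (rule sum.swap)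
  also have "\<dots> = (\<Sum>i=1..d. c i / 2 * F (\<theta> + \<alpha> i) + cnj (c i) / 2 * F (\<theta> - \<alpha> i))"
  proof (rule sum.cong[OF refl])
    fix i
    have "of_real (g z * trig_poly d c \<alpha> z ^ k) * e_char (of_int z * \<theta>) *
       (c i / 2 * e_char (of_int z * \<alpha> i) + cnj (c i) / 2 * e_char (- (of_int z * \<alpha> i)))
      = c i / 2 * (of_real (g z * trig_poly d c \<alpha> z ^ k) * e_char (of_int z * (\<theta> + \<alpha> i)))
       + cnj (c i) / 2 * (of_real (g z * trig_poly d c \<alpha> z ^ k) * e_char (of_int z * (\<theta> - \<alpha> i)))" for z
      by (simp add: distrib_left right_diff_distrib e_char_add e_char_diff e_char_minus mult_ac)
    then show "(\<Sum>z\<in>J. of_real (g z * trig_poly d c \<alpha> z ^ k) * e_char (of_int z * \<theta>) *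
       (c i / 2 * e_char (of_int z * \<alpha> i) + cnj (c i) / 2 * e_char (- (of_int z * \<alpha> i))))
      = c i / 2 * F (\<theta> + \<alpha> i) + cnj (c i) / 2 * F (\<theta> - \<alpha> i)"
      by (simp only: sum.distrib F_def sum_distrib_left)
  qed
  also have "cmod \<dots> \<le> (\<Sum>i=1..d. real d ^ k * S)"
  proof (rule sum_norm_le)
    fix i assume i: "i \<in> {1..d}"
    have F: "cmod (F x) \<le> real d ^ k * S" for x unfolding F_def by (rule Suc.IH)
    have F0: "0 \<le> real d ^ k * S" using F[of 0] norm_ge_zero order_trans by blast
    have "cmod (c i / 2 * F (\<theta> + \<alpha> i) + cnj (c i) / 2 * F (\<theta> - \<alpha> i))
       \<le> cmod (c i) / 2 * cmod (F (\<theta> + \<alpha> i)) + cmod (c i) / 2 * cmod (F (\<theta> - \<alpha> i))"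
      by (rule order_trans[OF norm_triangle_ineq]) (simp add: norm_mult norm_divide)
    also have "\<dots> \<le> 1 / 2 * (real d ^ k * S) + 1 / 2 * (real d ^ k * S)"
      using c[OF i] F0 by (intro add_mono mult_mono F) auto
    finally show "cmod (c i / 2 * F (\<theta> + \<alpha> i) + cnj (c i) / 2 * F (\<theta> - \<alpha> i)) \<le> real d ^ k * S" by linarith
  qed
  finally show ?case by simp
qed

text \<open>A polynomial cutoff, unlike a sharp one, expands into powers of the trigonometric
  polynomial, whose correlations with the uniform part are under control.\<close>

lemma exists_polynomial_cutoff:
  fixes e D :: real
  assumes e: "0 < e" "e \<le> 1"
  shows "\<exists>a n. \<forall>x. \<bar>x\<bar> \<le> D \<longrightarrow> 0 \<le> (\<Sum>i\<le>(n::nat). a i * x ^ i) \<and> (\<Sum>i\<le>n. a i * x ^ i) \<le> 2 \<and>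
     (x \<le> e \<longrightarrow> 1 \<le> (\<Sum>i\<le>n. a i * x ^ i)) \<and> (2 * e \<le> x \<longrightarrow> (\<Sum>i\<le>n. a i * x ^ i) \<le> (e::real))"
proof -
  \<comment> \<open>Raising the continuous cutoff by e/2 leaves room for an approximation error
    below e/2 in all four bounds.\<close>
  define f where "f x = e / 2 + max 0 (min 1 ((2 * e - x) / e))" for x
  have "continuous_on {-D..D} f" unfolding f_def by (intro continuous_intros) (use e in auto)
  then obtain h where h: "real_polynomial_function h" "\<And>x. x \<in> {-D..D} \<Longrightarrow> \<bar>f x - h x\<bar> < e / 2"
    using Stone_Weierstrass_real_polynomial_function[of "{-D..D}" f "e / 2"] e by auto
  obtain a n where an: "h = (\<lambda>x. \<Sum>i\<le>n. a i * x ^ i)"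
    using h(1) by (auto simp: real_polynomial_function_iff_sum)
  show ?thesis
  proof (intro exI[of _ a] exI[of _ n] allI impI)
    fix x assume x: "\<bar>x\<bar> \<le> D"
    have hx: "(\<Sum>i\<le>n. a i * x ^ i) = h x" by (simp add: an)
    have b: "\<bar>f x - h x\<bar> < e / 2" using x by (intro h(2)) auto
    have f: "e / 2 \<le> f x" "f x \<le> 1 + e / 2" by (auto simp: f_def)
    have "1 \<le> h x" if "x \<le> e"
    proof -
      have "f x = 1 + e / 2" using that e by (auto simp: f_def min_def field_simps)
      then show ?thesis using b by linarith
    qed
    moreover have "h x \<le> e" if "2 * e \<le> x"
    proof -
      have "f x = e / 2" using that e by (auto simp: f_def max_def min_def field_simps)
      then show ?thesis using b by linarith
    qed
    moreover have "0 \<le> h x" "h x \<le> 2" using b f e by linarith+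
    ultimately show "0 \<le> (\<Sum>i\<le>n. a i * x ^ i) \<and> (\<Sum>i\<le>n. a i * x ^ i) \<le> 2 \<and>
     (x \<le> e \<longrightarrow> 1 \<le> (\<Sum>i\<le>n. a i * x ^ i)) \<and> (2 * e \<le> x \<longrightarrow> (\<Sum>i\<le>n. a i * x ^ i) \<le> e)"
      unfolding hx by blast
  qed
qed

text \<open>Positions are relative to \<open>n\<close>; \<open>s\<close> is the structured part of the indicator function of \<open>A\<close>.\<close>
definition structured_window ::
    "nat \<Rightarrow> (nat \<Rightarrow> real) \<Rightarrow> real \<Rightarrow> real \<Rightarrow> nat \<Rightarrow> nat set \<Rightarrow> nat \<Rightarrow> bool" where
  "structured_window d \<alpha> \<epsilon> \<sigma> H A n \<longleftrightarrow> 3 * H \<le> n \<and>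
     (\<exists>(c :: nat \<Rightarrow> complex) (s :: int \<Rightarrow> real). (\<forall>i\<in>{1..d}. cmod (c i) \<le> 1) \<and>
        (\<forall>z\<in>{-3 * int H..3 * int H}. 0 \<le> s z \<and> s z \<le> 1) \<and>
        (\<Sum>z\<in>{-3 * int H..3 * int H}. \<bar>trig_poly d c \<alpha> z - s z\<bar>) \<le> \<epsilon> * real H \<and>
        (\<forall>x y \<theta>. {x..y} \<subseteq> {-3 * int H..3 * int H} \<longrightarrow>
           cmod (\<Sum>z\<in>{x..y}. of_real (indicator A (nat (int n + z)) - s z) * e_char (of_int z * \<theta>))
             \<le> \<sigma> * real H))"

text \<open>\<open>Bt\<close> is quantified inside because \<open>Q\<close> must serve every choice
  of it. The last clause reserves the small elements for the residue classes.\<close>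

definition approximable_window :: "nat set \<Rightarrow> nat \<Rightarrow> nat \<Rightarrow> nat \<Rightarrow> real \<Rightarrow> bool" where
  "approximable_window A n H Q \<eta> \<longleftrightarrow> (\<forall>Bt\<subseteq>{1..H}. \<exists>An Bn. window_sumset_approx A Bt n Q \<eta> An Bn \<and>
     Bt \<inter> {b. real b \<le> \<eta> / 4 * real H} \<subseteq> Bn)"

lemma card_mult_le_sum:
  fixes f :: "'a \<Rightarrow> real"
  assumes "finite X" and "\<And>x. x \<in> X \<Longrightarrow> 0 \<le> f x" and "Y \<subseteq> X" and "\<And>y. y \<in> Y \<Longrightarrow> v \<le> f y"
  shows "real (card Y) * v \<le> (\<Sum>x\<in>X. f x)"
proof -
  have "real (card Y) * v = (\<Sum>y\<in>Y. v)" by simp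
  also have "\<dots> \<le> (\<Sum>y\<in>Y. f y)" by (intro sum_mono assms)
  also have "\<dots> \<le> (\<Sum>x\<in>X. f x)" by (rule sum_mono2) (use assms in auto)
  finally show ?thesis .
qed

lemma sum_inj_on_le:
  fixes f :: "'b \<Rightarrow> real"
  assumes "finite Y" "inj_on h X" "h ` X \<subseteq> Y" "\<And>y. y \<in> Y \<Longrightarrow> 0 \<le> f y"
  shows "(\<Sum>x\<in>X. f (h x)) \<le> (\<Sum>y\<in>Y. f y)"
proof -
  have "(\<Sum>x\<in>X. f (h x)) = (\<Sum>y\<in>h ` X. f y)" by (simp add: sum.reindex[OF assms(2)])
  also have "\<dots> \<le> (\<Sum>y\<in>Y. f y)" by (rule sum_mono2) (use assms in auto)
  finally show ?thesis .
qed

lemma window_approximation: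
  fixes A :: "nat set" and n H Q d :: nat and k :: "int \<Rightarrow> real" and \<eta> \<mu> \<tau> \<sigma> m0 e \<zeta> :: real
  assumes e_def: "e = \<eta> / 40" and \<zeta>_def: "\<zeta> = \<eta> * e / 128"
    and \<eta>: "0 < \<eta>" "\<eta> \<le> 1" and H: "H \<ge> 1" "H \<le> Q" "Q \<le> 2 * H"
    and window: "structured_window d \<alpha> (\<zeta> * \<eta> / 12) \<sigma> H A n"
    and \<psi>: "\<And>x. \<bar>x\<bar> \<le> real d \<Longrightarrow> 0 \<le> (\<Sum>i\<le>l. a i * x ^ i) \<and> (\<Sum>i\<le>l. a i * x ^ i) \<le> 2 \<and>
      (x \<le> e \<longrightarrow> 1 \<le> (\<Sum>i\<le>l. a i * x ^ i)) \<and> (2 * e \<le> x \<longrightarrow> (\<Sum>i\<le>l. a i * x ^ i) \<le> e)"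
    and \<sigma>: "\<sigma> > 0" "\<sigma> * (\<Sum>i\<le>l. \<bar>a i\<bar> * real d ^ i) \<le> \<eta> / 8" "\<sigma>\<^sup>2 \<le> (\<eta> * e * m0 / 64)\<^sup>2 * \<eta> / 4"
    and m0: "m0 > 0" "m0 \<le> \<mu>"
    and \<tau>_le: "\<tau> \<le> \<eta> / 16 * \<mu>" and kernel: "is_bohr_kernel d \<alpha> H (e / 4) k \<mu> \<tau>"
    and kQ: "\<tau> < k (int Q)"
  shows "approximable_window A n H Q \<eta>"
  unfolding approximable_window_def
proof (intro allI impI)
  fix Bt :: "nat set" assume Bt: "Bt \<subseteq> {1..H}"
  have \<tau>: "0 \<le> \<tau>" "\<tau> \<le> \<eta> / 16 * \<mu>"
    and k01: "\<And>t. 0 \<le> k t \<and> k t \<le> 1"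
    and tail: "\<And>t. \<tau> < k t \<Longrightarrow> (\<Sum>i=1..d. cmod (e_char (of_int t * \<alpha> i) - 1)) \<le> e / 4"
    and sum_k: "(\<Sum>t\<in>{1 - int H..<int H}. k t) \<le> 3 * \<mu> * real H"
    and pos_def: "\<And>U. U \<subseteq> {1..int H} \<Longrightarrow> \<mu> * (real (card U))\<^sup>2 / 4 \<le> (\<Sum>b\<in>U. \<Sum>b'\<in>U. k (b - b'))"
    using kernel \<tau>_le unfolding is_bohr_kernel_def by blast+
  obtain c s where n: "3 * H \<le> n" and c: "\<And>i. i \<in> {1..d} \<Longrightarrow> cmod (c i) \<le> 1"
    and s: "\<And>z. z \<in> {-3 * int H..3 * int H} \<Longrightarrow> 0 \<le> s z \<and> s z \<le> 1"
    and err_le: "(\<Sum>z\<in>{-3 * int H..3 * int H}. \<bar>trig_poly d c \<alpha> z - s z\<bar>) \<le> \<zeta> * \<eta> / 12 * real H"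
    and unf0: "\<And>x y \<theta>. {x..y} \<subseteq> {-3 * int H..3 * int H} \<Longrightarrow>
      cmod (\<Sum>z\<in>{x..y}. of_real (indicator A (nat (int n + z)) - s z) * e_char (of_int z * \<theta>)) \<le> \<sigma> * real H"
    using window unfolding structured_window_def by blast
  define g where "g z = indicator A (nat (int n + z)) - s z" for z
  note unf = unf0[folded g_def]
  define p where "p = trig_poly d c \<alpha>"
  define err where "err z = \<bar>p z - s z\<bar>" for z
  define T where "T = {1 - int H..<int H}"
  define I where "I = {-3 * int H..3 * int H}"
  define \<psi>p where "\<psi>p z = (\<Sum>i\<le>l. a i * p z ^ i)" for z
  define A0 where "A0 = shift_down A n \<inter> {0..<Q}"
  \<comment> \<open>Few elements of A lie here: where the polynomial is small, so is the structured
    part up to the error, and the uniform part hardly correlates with the cutoff.\<close>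
  define bad1 where "bad1 = {x\<in>A0. p (int x) < e}"
  \<comment> \<open>The error is weighted around \<open>x - Q\<close> because, for a wrapped sum a0
    + b = y + Q, the points y - b' equal (a0 - Q) + (b - b').\<close>
  define bad2 where "bad2 = {x\<in>{0..<Q}. \<zeta> * \<mu> * real H < (\<Sum>t\<in>T. k t * err (int x - int Q + t))}"
  define An where "An = A0 - bad1 - bad2"
  define Bpop where "Bpop = {b\<in>Bt. \<eta> / 8 * \<mu> * real H \<le> (\<Sum>b'\<in>Bt. k (int b - int b'))}"
  define Bn where "Bn = Bpop \<union> (Bt \<inter> {b. real b \<le> \<eta> / 4 * real H})"
  have e: "0 < e" "e \<le> 1" and \<zeta>: "0 < \<zeta>" "\<zeta> \<le> \<eta> / 128" using \<eta> by (auto simp: e_def \<zeta>_def mult_le_one)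
  have \<mu>: "0 < \<mu>" using m0 by linarith
  have H0: "real H > 0" using H by simp
  have finBt: "finite Bt" using Bt finite_subset by blast
  have cBt: "card Bt \<le> H" using Bt card_mono[of "{1..H}" Bt] by simp
  have err0: "0 \<le> err z" for z by (simp add: err_def)
  have err_sum: "(\<Sum>z\<in>I. err z) \<le> \<zeta> * \<eta> / 12 * real H"
    using err_le by (simp add: err_def I_def p_def)
  have pd: "\<bar>p z\<bar> \<le> real d" for z unfolding p_def using c by (rule abs_trig_poly_le)
  note \<psi>p = \<psi>[OF pd, folded \<psi>p_def]

  have bad2_card: "real (card bad2) \<le> \<eta> / 4 * real H"
  proof -
    \<comment> \<open>Markov's inequality after exchanging sums. The translates stay in
      \<open>I\<close> since Q \<le> 2H and |t| < H, whence the windows of radius 3H.\<close>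
    have "real (card bad2) * (\<zeta> * \<mu> * real H) \<le> (\<Sum>x\<in>{0..<Q}. \<Sum>t\<in>T. k t * err (int x - int Q + t))"
      by (rule card_mult_le_sum) (use k01 err0 in \<open>auto simp: bad2_def intro!: sum_nonneg\<close>)
    also have "\<dots> = (\<Sum>t\<in>T. k t * (\<Sum>x\<in>{0..<Q}. err (int x - int Q + t)))"
      by (subst sum.swap) (simp add: sum_distrib_left)
    also have "\<dots> \<le> (\<Sum>t\<in>T. k t * (\<zeta> * \<eta> / 12 * real H))"
    proof (intro sum_mono mult_left_mono)
      fix t assume t: "t \<in> T"
      have "(\<Sum>x\<in>{0..<Q}. err (int x - int Q + t)) \<le> (\<Sum>z\<in>I. err z)"
        by (rule sum_inj_on_le[where h = "\<lambda>x. int x - int Q + t"])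
           (use t H err0 in \<open>auto simp: I_def T_def inj_on_def\<close>)
      then show "(\<Sum>x\<in>{0..<Q}. err (int x - int Q + t)) \<le> \<zeta> * \<eta> / 12 * real H" using err_sum by linarith
    qed (use k01 in auto)
    also have "\<dots> = (\<Sum>t\<in>T. k t) * (\<zeta> * \<eta> / 12 * real H)" by (simp add: sum_distrib_right)
    also have "\<dots> \<le> (3 * \<mu> * real H) * (\<zeta> * \<eta> / 12 * real H)"
      using sum_k \<zeta> \<eta> by (intro mult_right_mono) (auto simp: T_def)
    also have "\<dots> = (\<eta> / 4 * real H) * (\<zeta> * \<mu> * real H)" by simp
    finally show ?thesis using \<zeta> \<mu> H0 by (metis mult_pos_pos mult_le_cancel_right_pos)
  qed

  have bad1_card: "real (card bad1) \<le> 5 * \<eta> / 8 * real Q"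
  proof -
    define J where "J = {0..int Q - 1}"
    have JI: "J \<subseteq> I" using H by (auto simp: J_def I_def)
    have cJ: "card J = Q" by (simp add: J_def)
    have finJ: "finite J" by (simp add: J_def)
    have ind: "indicator A (nat (int n + z)) = g z + s z" for z by (simp add: g_def)
    \<comment> \<open>On A the cutoff majorises the indicator of the set where p < e; writing the
      indicator of A as s + g leaves a structured and a uniform sum.\<close>
    have "real (card (int ` bad1)) * 1 \<le> (\<Sum>z\<in>J. indicator A (nat (int n + z)) * \<psi>p z)"
    proof (rule card_mult_le_sum[OF finJ])
      show "0 \<le> indicator A (nat (int n + z)) * \<psi>p z" for z using \<psi>p[of z] by simp
      show "int ` bad1 \<subseteq> J" by (auto simp: bad1_def A0_def J_def)
      show "1 \<le> indicator A (nat (int n + z)) * \<psi>p z" if z: "z \<in> int ` bad1" for z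
      proof -
        obtain x where x: "z = int x" "x \<in> bad1" using z by blast
        then have "nat (int n + z) \<in> A" by (auto simp: bad1_def A0_def shift_down_def nat_add_distrib add.commute)
        moreover have "1 \<le> \<psi>p z" using \<psi>p[of z] x by (auto simp: bad1_def)
        ultimately show ?thesis by simp
      qed
    qed
    also have "\<dots> = (\<Sum>z\<in>J. s z * \<psi>p z) + (\<Sum>z\<in>J. g z * \<psi>p z)"
      by (simp add: ind sum.distrib distrib_right)
    also have "(\<Sum>z\<in>J. s z * \<psi>p z) \<le> (\<Sum>z\<in>J. 2 * err z + 5 * e)"
    proof (rule sum_mono)
      fix z assume "z \<in> J"
      then have sz: "0 \<le> s z" "s z \<le> 1" using s[of z] JI by (auto simp: I_def)
      \<comment> \<open>Where p \<le> 2e the structured part is at most err + 2e and the cutoff at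
        most 2; elsewhere the cutoff is at most e.\<close>
      show "s z * \<psi>p z \<le> 2 * err z + 5 * e"
      proof (cases "p z \<le> 2 * e")
        case True
        then have "s z \<le> err z + 2 * e" by (auto simp: err_def)
        then have "s z * \<psi>p z \<le> (err z + 2 * e) * 2" using sz \<psi>p[of z] by (intro mult_mono) auto
        then show ?thesis using e by simp
      next
        case False
        then have "s z * \<psi>p z \<le> 1 * e" using sz \<psi>p[of z] by (intro mult_mono) auto
        then show ?thesis using e err0[of z] by simp
      qed
    qed
    also have "\<dots> = 2 * (\<Sum>z\<in>J. err z) + real Q * (5 * e)" by (simp add: sum.distrib sum_distrib_left cJ)
    also have "(\<Sum>z\<in>J. err z) \<le> (\<Sum>z\<in>I. err z)" by (rule sum_mono2) (use JI err0 in \<open>auto simp: I_def\<close>)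
    also have "(\<Sum>z\<in>I. err z) \<le> \<eta> / 16 * real H"
    proof -
      have "\<zeta> * \<eta> \<le> \<eta> / 128 * 1" using \<zeta> \<eta> by (intro mult_mono) auto
      then have "\<zeta> * \<eta> / 12 * real H \<le> \<eta> / 16 * real H" using \<eta> by (intro mult_right_mono) auto
      then show ?thesis using err_sum by linarith
    qed
    also have "(\<Sum>z\<in>J. g z * \<psi>p z) \<le> \<eta> / 8 * real H"
    proof -
      have G: "\<bar>\<Sum>z\<in>J. g z * p z ^ i\<bar> \<le> real d ^ i * (\<sigma> * real H)" for i
      proof -
        have "cmod (\<Sum>z\<in>J. of_real (g z * p z ^ i) * e_char (of_int z * 0)) \<le> real d ^ i * (\<sigma> * real H)"
          unfolding p_def
          by (rule phase_sum_trig_poly_power_le[OF c]) (use unf[of 0 "int Q - 1"] JI in \<open>auto simp: J_def I_def\<close>)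
        then show ?thesis by (simp add: norm_of_real flip: of_real_mult of_real_sum of_real_power)
      qed
      have "(\<Sum>z\<in>J. g z * \<psi>p z) = (\<Sum>z\<in>J. \<Sum>i\<le>l. a i * (g z * p z ^ i))"
        by (simp add: \<psi>p_def sum_distrib_left mult_ac)
      also have "\<dots> = (\<Sum>i\<le>l. a i * (\<Sum>z\<in>J. g z * p z ^ i))"
        by (subst sum.swap) (simp add: sum_distrib_left)
      also have "\<dots> \<le> (\<Sum>i\<le>l. \<bar>a i\<bar> * (real d ^ i * (\<sigma> * real H)))"
      proof (rule sum_mono)
        fix i
        have "a i * (\<Sum>z\<in>J. g z * p z ^ i) \<le> \<bar>a i\<bar> * \<bar>\<Sum>z\<in>J. g z * p z ^ i\<bar>"
          by (metis abs_ge_self abs_mult)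
        also have "\<dots> \<le> \<bar>a i\<bar> * (real d ^ i * (\<sigma> * real H))" by (intro mult_left_mono G) auto
        finally show "a i * (\<Sum>z\<in>J. g z * p z ^ i) \<le> \<bar>a i\<bar> * (real d ^ i * (\<sigma> * real H))" .
      qed
      also have "\<dots> = \<sigma> * (\<Sum>i\<le>l. \<bar>a i\<bar> * real d ^ i) * real H"
        by (simp add: sum_distrib_left sum_distrib_right mult_ac)
      also have "\<dots> \<le> \<eta> / 8 * real H" by (intro mult_right_mono \<sigma>) auto
      finally show ?thesis .
    qed
    finally have "real (card (int ` bad1)) \<le> 2 * (\<eta> / 16 * real H) + real Q * (5 * e) + \<eta> / 8 * real H" by simp
    moreover have "\<eta> * real H \<le> \<eta> * real Q" using H \<eta> by (intro mult_left_mono) auto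
    moreover have "card (int ` bad1) = card bad1" by (intro card_image) (auto simp: inj_on_def)
    ultimately show ?thesis by (simp add: e_def algebra_simps)
  qed

  have I_goal: "real (card (A0 - An)) \<le> \<eta> * real Q"
  proof -
    have "card (A0 - An) \<le> card (bad1 \<union> bad2)"
      by (rule card_mono) (auto simp: An_def bad1_def A0_def bad2_def)
    also have "\<dots> \<le> card bad1 + card bad2" by (rule card_Un_le)
    finally have "real (card (A0 - An)) \<le> 5 * \<eta> / 8 * real Q + \<eta> / 4 * real H"
      using bad1_card bad2_card by linarith
    moreover have "\<eta> * real H \<le> \<eta> * real Q" using H \<eta> by (intro mult_left_mono) auto
    moreover have "0 \<le> \<eta> * real Q" using \<eta> by simp
    ultimately show ?thesis by (simp add: algebra_simps)
  qed

  have II_goal: "real (card (Bt - Bn)) \<le> \<eta> * real Q"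
  proof -
    \<comment> \<open>For elements with few partners, positive definiteness bounds the kernel mass
      below by \<mu>|U|^2/4 and unpopularity bounds it above by \<eta>\<mu>H|U|/8; the factor \<mu>
      cancels.\<close>
    define U where "U = Bt - Bpop"
    have finU: "finite U" using finBt by (simp add: U_def)
    have cU: "card (int ` U) = card U" by (intro card_image) (auto simp: inj_on_def)
    have "\<mu> * (real (card (int ` U)))\<^sup>2 / 4 \<le> (\<Sum>b\<in>int ` U. \<Sum>b'\<in>int ` U. k (b - b'))"
      by (rule pos_def) (use Bt in \<open>auto simp: U_def\<close>)
    also have "\<dots> = (\<Sum>b\<in>U. \<Sum>b'\<in>U. k (int b - int b'))"
      by (simp add: sum.reindex inj_on_def)
    also have "\<dots> \<le> (\<Sum>b\<in>U. \<eta> / 8 * \<mu> * real H)"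
    proof (rule sum_mono)
      fix b assume b: "b \<in> U"
      have "(\<Sum>b'\<in>U. k (int b - int b')) \<le> (\<Sum>b'\<in>Bt. k (int b - int b'))"
        by (rule sum_mono2) (use finBt k01 in \<open>auto simp: U_def\<close>)
      then show "(\<Sum>b'\<in>U. k (int b - int b')) \<le> \<eta> / 8 * \<mu> * real H"
        using b by (auto simp: U_def Bpop_def)
    qed
    finally have "\<mu> * (real (card U) * real (card U)) \<le> \<mu> * (real (card U) * (\<eta> / 2 * real H))"
      by (simp add: cU power2_eq_square algebra_simps)
    then have "real (card U) * real (card U) \<le> real (card U) * (\<eta> / 2 * real H)"
      using \<mu> by simp
    then have "real (card U) \<le> \<eta> / 2 * real H"
      using \<eta> by (cases "card U = 0") auto
    moreover have "card (Bt - Bn) \<le> card U" by (rule card_mono) (use finU in \<open>auto simp: U_def Bn_def\<close>)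
    moreover have "\<eta> * real H \<le> \<eta> * real Q" using H \<eta> by (intro mult_left_mono) auto
    moreover have "0 \<le> \<eta> * real Q" using \<eta> by simp
    ultimately show ?thesis by (simp add: algebra_simps)
  qed

  define \<nu> where "\<nu> = \<eta> * e * \<mu> / 64"
  have \<nu>0: "\<nu> > 0" using \<eta> e \<mu> by (simp add: \<nu>_def)
  \<comment> \<open>All points x - b' lie in this range, and the convolution bound asks for bounded
    support.\<close>
  define gc where "gc z = (if z \<in> {- int H..int Q} then g z else 0)" for z
  define badX where "badX = {x\<in>{0..<Q}. \<nu> * real H \<le> \<bar>\<Sum>b'\<in>Bt. gc (int x - int b')\<bar>}"
  have badX_card: "real (card badX) \<le> \<eta> / 4 * real H"
  proof -
    have "(\<Sum>x\<in>int ` {0..<Q}. (\<Sum>b\<in>int ` Bt. gc (x - b))\<^sup>2) \<le> (\<sigma> * real H)\<^sup>2 * real (card (int ` Bt))"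
    proof (rule convolution_L2_bound[where u = "- int H" and v = "int Q" and K = "int H"])
      show "gc z = 0" if "z \<notin> {- int H..int Q}" for z using that by (auto simp: gc_def)
      show "cmod (\<Sum>z\<in>{- int H..int Q}. of_real (gc z) * e_char (of_int z * \<theta>)) \<le> \<sigma> * real H" for \<theta>
      proof -
        have "(\<Sum>z\<in>{- int H..int Q}. of_real (gc z) * e_char (of_int z * \<theta>)) =
           (\<Sum>z\<in>{- int H..int Q}. of_real (g z) * e_char (of_int z * \<theta>))"
          by (intro sum.cong) (auto simp: gc_def)
        then show ?thesis using unf[of "- int H" "int Q" \<theta>] H by simp
      qed
    qed (use Bt in auto)
    also have "\<dots> \<le> (\<sigma> * real H)\<^sup>2 * real H"
      using cBt by (intro mult_left_mono) (auto simp: card_image inj_on_def)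
    finally have le: "(\<Sum>x\<in>{0..<Q}. (\<Sum>b\<in>Bt. gc (int x - int b))\<^sup>2) \<le> (\<sigma> * real H)\<^sup>2 * real H"
      by (simp add: sum.reindex inj_on_def)
    \<comment> \<open>Chebyshev's inequality. The L2 bound carries no factor \<mu>, so here \<sigma>
      has to be small against m0.\<close>
    have "real (card badX) * (\<nu> * real H)\<^sup>2 \<le> (\<Sum>x\<in>{0..<Q}. (\<Sum>b\<in>Bt. gc (int x - int b))\<^sup>2)"
    proof (rule card_mult_le_sum)
      fix x assume x: "x \<in> badX"
      then have "(\<nu> * real H)\<^sup>2 \<le> \<bar>\<Sum>b'\<in>Bt. gc (int x - int b')\<bar>\<^sup>2"
        using \<nu>0 by (intro power_mono) (auto simp: badX_def)
      then show "(\<nu> * real H)\<^sup>2 \<le> (\<Sum>b\<in>Bt. gc (int x - int b))\<^sup>2" by simp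
    qed (auto simp: badX_def)
    also have "\<dots> \<le> (\<sigma> * real H)\<^sup>2 * real H" by (rule le)
    also have "\<dots> \<le> (\<nu>\<^sup>2 * \<eta> / 4) * (real H)\<^sup>2 * real H"
    proof -
      have "(\<eta> * e * m0 / 64)\<^sup>2 \<le> \<nu>\<^sup>2"
        unfolding \<nu>_def using m0 \<eta> e by (intro power_mono divide_right_mono mult_left_mono) auto
      then have "(\<eta> * e * m0 / 64)\<^sup>2 * \<eta> / 4 \<le> \<nu>\<^sup>2 * \<eta> / 4" using \<eta> by (intro divide_right_mono mult_right_mono) auto
      then have "\<sigma>\<^sup>2 \<le> \<nu>\<^sup>2 * \<eta> / 4" using \<sigma>(3) by linarith
      then show ?thesis unfolding power_mult_distrib by (intro mult_right_mono) auto
    qed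
    also have "\<dots> = (\<eta> / 4 * real H) * (\<nu> * real H)\<^sup>2" by (simp add: power_mult_distrib)
    finally show ?thesis using \<nu>0 H0 by (simp add: mult_le_cancel_right)
  qed

  \<comment> \<open>If x is not a sum, the indicator of A vanishes at every n + x - b', so g = -s
    there. The convolution is then minus the sum of the s(x - b'), which almost periodicity makes
    large.\<close>
  have wrap: "x \<in> badX" if a0: "a0 \<in> An" and b: "b \<in> Bpop" and x: "a0 + b = x + Q" "x < Q"
    and notin: "x \<notin> shift_down (A + Bt) n" for x a0 b
  proof -
    have a0': "a0 < Q" "a0 \<in> A0" "e \<le> p (int a0)"
      and a0_err: "(\<Sum>t\<in>T. k t * err (int a0 - int Q + t)) \<le> \<zeta> * \<mu> * real H"
      using a0 by (auto simp: An_def A0_def bad1_def bad2_def)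
    have bH: "b \<in> {1..H}" using b Bt by (auto simp: Bpop_def)
    have z: "int x - int b' = int a0 - int Q + (int b - int b')" for b' using x by linarith
    have bound: "k (int b - int b') * (e / 2) - \<tau> * (e / 2) - k (int b - int b') * err (int x - int b')
        \<le> s (int x - int b')" if b': "b' \<in> Bt" for b'
    proof -
      define t where "t = int b - int b'"
      define y where "y = int x - int b'"
      have bH': "b' \<in> {1..H}" using b' Bt by auto
      have sy: "0 \<le> s y" "s y \<le> 1" using s[of y] bH' x H by (auto simp: y_def)
      have "k t * (e / 2) - \<tau> * (e / 2) - k t * err y \<le> k t * s y"
      proof (cases "\<tau> < k t")
        case False
        then have "k t * (e / 2) \<le> \<tau> * (e / 2)" using e by (intro mult_right_mono) auto
        moreover have "0 \<le> k t * err y" "0 \<le> k t * s y" using k01 err0 sy by auto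
        ultimately show ?thesis by linarith
      next
        case True
        \<comment> \<open>Both Q and b - b' are almost periods, each costing e/4, so p(x - b') \<ge>
          e/2.\<close>
        have "\<bar>p (int a0 - int Q + int Q) - p (int a0 - int Q)\<bar> \<le> e / 4"
          unfolding p_def by (rule order_trans[OF trig_poly_shift_le[OF c] tail[OF kQ]])
        then have "\<bar>p (int a0) - p (int a0 - int Q)\<bar> \<le> e / 4" by simp
        moreover have "\<bar>p (int a0 - int Q + t) - p (int a0 - int Q)\<bar> \<le> e / 4"
          unfolding p_def by (rule order_trans[OF trig_poly_shift_le[OF c] tail[OF True]])
        moreover have "int a0 - int Q + t = y" using z[of b'] by (simp add: t_def y_def)
        ultimately have "e / 2 \<le> p y" using a0'(3) by (simp only:)
        then have "e / 2 - err y \<le> s y" by (auto simp: err_def)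
        then have "k t * (e / 2 - err y) \<le> k t * s y" using k01 by (intro mult_left_mono) auto
        moreover have "0 \<le> \<tau> * (e / 2)" using \<tau> e by simp
        ultimately show ?thesis by (simp add: algebra_simps)
      qed
      also have "k t * s y \<le> s y" using k01 sy by (intro mult_left_le_one_le) auto
      finally show ?thesis by (simp add: t_def y_def)
    qed
    have none: "gc (int x - int b') = - s (int x - int b')" if b': "b' \<in> Bt" for b'
    proof -
      have bH': "b' \<in> {1..H}" using b' Bt by auto
      have "nat (int n + (int x - int b')) \<notin> A"
      proof
        assume inA: "nat (int n + (int x - int b')) \<in> A"
        have "x + n = nat (int n + (int x - int b')) + b'" using bH' n by auto
        then have "x + n \<in> A + Bt" using inA b' by (auto simp: set_plus_def)
        then show False using notin by (simp add: shift_down_def)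
      qed
      then show ?thesis using bH' x by (auto simp: gc_def g_def)
    qed
    have "(\<Sum>b'\<in>Bt. k (int b - int b') * err (int x - int b'))
        = (\<Sum>b'\<in>Bt. k (int b - int b') * err (int a0 - int Q + (int b - int b')))" by (simp only: z)
    also have "\<dots> \<le> (\<Sum>t\<in>T. k t * err (int a0 - int Q + t))"
      by (rule sum_inj_on_le[where h = "\<lambda>b'. int b - int b'" and f = "\<lambda>t. k t * err (int a0 - int Q + t)"])
         (use Bt bH k01 err0 in \<open>auto simp: T_def inj_on_def\<close>)
    finally have e1: "(\<Sum>b'\<in>Bt. k (int b - int b') * err (int x - int b')) \<le> \<zeta> * \<mu> * real H"
      using a0_err by linarith
    have "(\<Sum>b'\<in>Bt. k (int b - int b')) * (e / 2) - real (card Bt) * (\<tau> * (e / 2))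
         - (\<Sum>b'\<in>Bt. k (int b - int b') * err (int x - int b'))
        = (\<Sum>b'\<in>Bt. k (int b - int b') * (e / 2) - \<tau> * (e / 2) - k (int b - int b') * err (int x - int b'))"
      by (simp add: sum_subtractf sum_distrib_right)
    also have "\<dots> \<le> (\<Sum>b'\<in>Bt. s (int x - int b'))" by (intro sum_mono bound)
    finally have low: "(\<Sum>b'\<in>Bt. k (int b - int b')) * (e / 2) - real (card Bt) * (\<tau> * (e / 2))
         - (\<Sum>b'\<in>Bt. k (int b - int b') * err (int x - int b')) \<le> (\<Sum>b'\<in>Bt. s (int x - int b'))" .
    \<comment> \<open>In units of \<open>Y\<close> the kernel mass of a popular b gives 1/16, the
      threshold \<tau> costs 1/32 and the error 1/128; the remaining 3/128 exceeds the 1/64 of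
      \<open>\<nu>\<close>.\<close>
    define Y where "Y = \<eta> * e * \<mu> * real H"
    have "\<eta> / 8 * \<mu> * real H * (e / 2) \<le> (\<Sum>b'\<in>Bt. k (int b - int b')) * (e / 2)"
      using b e by (intro mult_right_mono) (auto simp: Bpop_def)
    moreover have "\<eta> / 8 * \<mu> * real H * (e / 2) = Y / 16" by (simp add: Y_def)
    moreover have "real (card Bt) * (\<tau> * (e / 2)) \<le> real H * (\<eta> / 16 * \<mu> * (e / 2))"
      using cBt \<tau> e by (intro mult_mono) auto
    moreover have "real H * (\<eta> / 16 * \<mu> * (e / 2)) = Y / 32" by (simp add: Y_def)
    moreover have "\<zeta> * \<mu> * real H = Y / 128" by (simp add: \<zeta>_def Y_def)
    moreover have "\<nu> * real H = Y / 64" by (simp add: \<nu>_def Y_def)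
    moreover have "0 \<le> Y" using \<eta> e \<mu> by (simp add: Y_def)
    ultimately have "\<nu> * real H \<le> (\<Sum>b'\<in>Bt. s (int x - int b'))"
      using low e1 by linarith
    moreover have "(\<Sum>b'\<in>Bt. gc (int x - int b')) = - (\<Sum>b'\<in>Bt. s (int x - int b'))"
      by (simp add: none sum_negf)
    ultimately show ?thesis using x by (simp add: badX_def)
  qed

  have III_goal: "real (card (mod_sumset Q An Bn - (shift_down (A + Bt) n \<inter> {0..<Q}))) \<le> \<eta> * real Q"
  proof -
    \<comment> \<open>A wrapped sum lies below its summand b, so all b \<le> w together account for
      at most w points.\<close>
    define w where "w = nat \<lfloor>\<eta> / 4 * real H\<rfloor>"
    have w: "real w \<le> \<eta> / 4 * real H" unfolding w_def using \<eta> by (intro of_nat_floor) simp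
    have "mod_sumset Q An Bn - (shift_down (A + Bt) n \<inter> {0..<Q}) \<subseteq> badX \<union> {..<w}"
    proof
      fix x assume x: "x \<in> mod_sumset Q An Bn - (shift_down (A + Bt) n \<inter> {0..<Q})"
      then obtain a0 b where ab: "x = (a0 + b) mod Q" "a0 \<in> An" "b \<in> Bn" by (auto simp: mod_sumset_def)
      have Q0: "Q > 0" using H by linarith
      have xQ: "x < Q" using ab Q0 by simp
      then have notin: "x \<notin> shift_down (A + Bt) n" using x by auto
      have bBt: "b \<in> Bt" using ab by (auto simp: Bn_def Bpop_def)
      then have bH: "b \<in> {1..H}" using Bt by auto
      have a0: "a0 < Q" "a0 + n \<in> A" using ab by (auto simp: An_def A0_def shift_down_def)
      have "\<not> a0 + b < Q"
      proof
        assume "a0 + b < Q"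
        then have "x + n = (a0 + n) + b" using ab by simp
        then have "x + n \<in> A + Bt" using set_plus_intro[OF a0(2) bBt] by (simp add: ac_simps)
        then show False using notin by (simp add: shift_down_def)
      qed
      \<comment> \<open>At most one wrap occurs, also when b = Q.\<close>
      moreover have "a0 + b - Q < Q" using a0 bH H by auto
      ultimately have "x = a0 + b - Q" using ab(1) by (simp add: mod_if)
      then have wr: "a0 + b = x + Q" using \<open>\<not> a0 + b < Q\<close> by simp
      show "x \<in> badX \<union> {..<w}"
      proof (cases "b \<in> Bpop")
        case True
        then show ?thesis using wrap[OF ab(2) True wr xQ notin] by simp
      next
        case False
        then have "real b \<le> \<eta> / 4 * real H" using ab by (auto simp: Bn_def)
        then have "b \<le> w" by (simp add: w_def le_nat_floor)
        then show ?thesis using wr a0 by auto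
      qed
    qed
    then have "card (mod_sumset Q An Bn - (shift_down (A + Bt) n \<inter> {0..<Q})) \<le> card (badX \<union> {..<w})"
      by (intro card_mono) (auto simp: badX_def)
    also have "\<dots> \<le> card badX + w" using card_Un_le[of badX "{..<w}"] by simp
    finally have "real (card (mod_sumset Q An Bn - (shift_down (A + Bt) n \<inter> {0..<Q}))) \<le> \<eta> / 2 * real H"
      using badX_card w by linarith
    also have "\<dots> \<le> \<eta> * real Q" using H \<eta> by (intro mult_mono) auto
    finally show ?thesis .
  qed
  have "window_sumset_approx A Bt n Q \<eta> An Bn"
    unfolding window_sumset_approx_def
  proof (intro conjI)
    show "An \<subseteq> shift_down A n \<inter> {0..<Q}" by (auto simp: An_def A0_def)
    show "Bn \<subseteq> Bt" by (auto simp: Bn_def Bpop_def)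
  qed (use I_goal II_goal III_goal in \<open>simp_all only: A0_def\<close>)
  then show "\<exists>An Bn. window_sumset_approx A Bt n Q \<eta> An Bn \<and> Bt \<inter> {b. real b \<le> \<eta> / 4 * real H} \<subseteq> Bn"
    by (intro exI[of _ An] exI[of _ Bn]) (auto simp: Bn_def)
qed

text \<open>
  The number \<open>d\<close> of frequencies depends on the accuracy \<open>\<epsilon>\<close> of the approximation, so \<open>\<epsilon>\<close> must be chosen
  before \<open>d\<close>.
\<close>
lemma window_lemma:
  fixes \<eta> :: real
  assumes \<eta>: "0 < \<eta>" "\<eta> \<le> 1" and L: "L \<ge> 1"
  shows "\<exists>\<epsilon>>0. \<forall>d\<ge>1. \<exists>C\<ge>1. \<exists>\<sigma>>0. \<exists>H0. \<forall>H\<ge>H0. \<forall>\<alpha>. H \<ge> 1 \<and> spectral_gap d C H \<alpha> \<longrightarrow>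
    (\<exists>Q. H \<le> Q \<and> real Q \<le> (1 + \<eta>) * real H \<and> L dvd Q \<and>
      (\<forall>A n. structured_window d \<alpha> \<epsilon> \<sigma> H A n \<longrightarrow> approximable_window A n H Q \<eta>))"
proof -
  define e where "e = \<eta> / 40"
  define \<zeta> where "\<zeta> = \<eta> * e / 128"
  have e: "0 < e" "e \<le> 1" and \<zeta>: "\<zeta> > 0" using \<eta> by (auto simp: e_def \<zeta>_def)
  show ?thesis
  proof (rule exI[of _ "\<zeta> * \<eta> / 12"], intro conjI allI impI)
    show "0 < \<zeta> * \<eta> / 12" using \<zeta> \<eta> by simp
    fix d :: nat assume d: "d \<ge> 1"
    obtain a l where \<psi>: "\<And>x. \<bar>x\<bar> \<le> real d \<Longrightarrow> 0 \<le> (\<Sum>i\<le>(l::nat). a i * x ^ i) \<and> (\<Sum>i\<le>l. a i * x ^ i) \<le> 2 \<and>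
      (x \<le> e \<longrightarrow> 1 \<le> (\<Sum>i\<le>l. a i * x ^ i)) \<and> (2 * e \<le> x \<longrightarrow> (\<Sum>i\<le>l. a i * x ^ i) \<le> e)"
      using exists_polynomial_cutoff[OF e, of "real d"] by blast
    have e4: "0 < e / 4" and \<eta>16: "0 < \<eta> / 16" "\<eta> / 16 \<le> 1 / 2" using e \<eta> by auto
    obtain C H0 m0 where C: "C \<ge> 1" and m0: "m0 > 0" and kernel: "\<forall>H\<ge>H0. \<forall>\<alpha>. H \<ge> 1 \<and> spectral_gap d C H \<alpha> \<longrightarrow>
     (\<exists>k \<mu> \<tau>. m0 \<le> \<mu> \<and> \<tau> \<le> \<eta> / 16 * \<mu> \<and> is_bohr_kernel d \<alpha> H (e / 4) k \<mu> \<tau> \<and>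
      (\<exists>Q. H \<le> Q \<and> real Q \<le> (1 + \<eta>) * real H \<and> L dvd Q \<and> \<tau> < k (int Q)))"
      using bohr_kernel[OF d e4 \<eta>16 \<eta> L] by blast
    define S where "S = (\<Sum>i\<le>l. \<bar>a i\<bar> * real d ^ i)"
    have S0: "S \<ge> 0" by (simp add: S_def sum_nonneg)
    \<comment> \<open>The first bound controls the uniform sum against the cutoff, the second the
      count of \<open>badX\<close>; both may depend on \<open>d\<close>, through \<open>S\<close>
      and \<open>m0\<close>.\<close>
    define \<sigma> where "\<sigma> = min (\<eta> / 8 / (S + 1)) (\<eta> * e * m0 / 64 * (\<eta> / 2))"
    have \<sigma>1: "\<sigma> > 0" using S0 \<eta> e m0 by (auto simp: \<sigma>_def)
    have \<sigma>2: "\<sigma> * S \<le> \<eta> / 8"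
    proof -
      have "\<sigma> * S \<le> \<eta> / 8 / (S + 1) * (S + 1)"
        using S0 \<eta> by (intro mult_mono) (auto simp: \<sigma>_def)
      also have "\<dots> = \<eta> / 8" using S0 by (intro nonzero_eq_divide_eq[THEN iffD1]) auto
      finally show ?thesis .
    qed
    have \<sigma>3: "\<sigma>\<^sup>2 \<le> (\<eta> * e * m0 / 64)\<^sup>2 * \<eta> / 4"
    proof -
      have "\<sigma> \<le> \<eta> * e * m0 / 64 * (\<eta> / 2)" unfolding \<sigma>_def by (rule min.cobounded2)
      then have "\<sigma>\<^sup>2 \<le> (\<eta> * e * m0 / 64 * (\<eta> / 2))\<^sup>2" using \<sigma>1 by (intro power_mono) auto
      also have "\<dots> = (\<eta> * e * m0 / 64)\<^sup>2 * (\<eta> * \<eta>) / 4" by (simp add: power2_eq_square)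
      also have "\<dots> \<le> (\<eta> * e * m0 / 64)\<^sup>2 * \<eta> / 4"
        using \<eta> by (intro divide_right_mono mult_left_mono) (auto simp: mult_left_le_one_le)
      finally show ?thesis .
    qed
    show "\<exists>C\<ge>1. \<exists>\<sigma>>0. \<exists>H0. \<forall>H\<ge>H0. \<forall>\<alpha>. H \<ge> 1 \<and> spectral_gap d C H \<alpha> \<longrightarrow>
    (\<exists>Q. H \<le> Q \<and> real Q \<le> (1 + \<eta>) * real H \<and> L dvd Q \<and>
      (\<forall>A n. structured_window d \<alpha> (\<zeta> * \<eta> / 12) \<sigma> H A n \<longrightarrow> approximable_window A n H Q \<eta>))"
    proof (rule exI[of _ C], rule conjI[OF C], rule exI[of _ \<sigma>], rule conjI[OF \<sigma>1],
        rule exI[of _ H0], intro allI impI, elim conjE)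
      fix H \<alpha> assume H: "H0 \<le> H" "1 \<le> H" and gap: "spectral_gap d C H \<alpha>"
      obtain k \<mu> \<tau> Q where k: "m0 \<le> \<mu>" "\<tau> \<le> \<eta> / 16 * \<mu>" "is_bohr_kernel d \<alpha> H (e / 4) k \<mu> \<tau>"
        and Q: "H \<le> Q" "real Q \<le> (1 + \<eta>) * real H" "L dvd Q" "\<tau> < k (int Q)"
        using kernel H gap by blast
      have "real Q \<le> 2 * real H" using Q(2) \<eta> mult_right_mono[of "1 + \<eta>" 2 "real H"] by linarith
      then have Q2: "Q \<le> 2 * H" by linarith
      show "\<exists>Q. H \<le> Q \<and> real Q \<le> (1 + \<eta>) * real H \<and> L dvd Q \<and>
      (\<forall>A n. structured_window d \<alpha> (\<zeta> * \<eta> / 12) \<sigma> H A n \<longrightarrow> approximable_window A n H Q \<eta>)"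
      proof (intro exI[of _ Q] conjI Q(1-3) allI impI)
        fix A n assume window: "structured_window d \<alpha> (\<zeta> * \<eta> / 12) \<sigma> H A n"
        show "approximable_window A n H Q \<eta>"
          by (rule window_approximation[OF e_def \<zeta>_def \<eta> H(2) Q(1) Q2 window \<psi> \<sigma>1 \<sigma>2[unfolded S_def] \<sigma>3 m0 k Q(4)])
      qed
    qed
  qed
qed

section \<open>Almost all windows are structured\<close>

text \<open>Consecutive blocks overlap because the step is smaller than the block length, so their
  constants agree. A good scale gives constancy over length \<open>H\<close> only, while windows of
  radius 3H are used.\<close>

lemma constant_on_chain:
  fixes f :: "nat \<Rightarrow> 'a"
  assumes g: "1 \<le> g" "g < h"
    and const: "\<And>j. j \<le> J \<Longrightarrow> (\<lambda>i. f (m + j * g + i)) constant_on {1..h}"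
    and i: "i \<in> {1..J * g + h}"
  shows "f (m + i) = f (m + 1)"
  using const i
proof (induction J arbitrary: i)
  case 0
  obtain y where y: "\<And>t. t \<in> {1..h} \<Longrightarrow> f (m + t) = y"
    using 0(1)[of 0] by (auto simp: constant_on_def)
  then show ?case using y[of i] y[of 1] 0(2) g by auto
next
  case (Suc J)
  show ?case
  proof (cases "i \<le> J * g + h")
    case True
    then show ?thesis using Suc by auto
  next
    case False
    obtain y where y: "\<And>r. r \<in> {1..h} \<Longrightarrow> f (m + Suc J * g + r) = y"
      using Suc.prems(1)[of "Suc J"] by (auto simp: constant_on_def)
    have i: "J * g + h < i" "i \<le> J * g + g + h" using False Suc.prems(2) by auto
    have "f (m + Suc J * g + (i - Suc J * g)) = y" by (rule y) (use i g in auto)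
    moreover have "m + Suc J * g + (i - Suc J * g) = m + i" using i g by auto
    ultimately have "f (m + i) = y" by simp
    \<comment> \<open>The last position of the old range lies in the new block, at offset
      \<open>h - g\<close>.\<close>
    moreover have "f (m + (J * g + h)) = y" using y[of "h - g"] g by (simp add: add.assoc)
    moreover have "f (m + (J * g + h)) = f (m + 1)" by (rule Suc.IH) (use Suc.prems g in auto)
    ultimately show ?thesis by simp
  qed
qed

text \<open>Markov's inequality for sliding windows: each point lies in at most
  \<open>2 * r + 1\<close> of them.\<close>

lemma window_markov:
  fixes w :: "nat \<Rightarrow> real"
  assumes Y: "finite Y" "\<And>n. n \<in> G \<Longrightarrow> r \<le> n \<and> {n - r..n + r} \<subseteq> Y" and G: "finite G"
    and w: "\<And>m. m \<in> Y \<Longrightarrow> 0 \<le> w m"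
    and v: "\<And>n. n \<in> G \<Longrightarrow> v \<le> (\<Sum>m\<in>{n - r..n + r}. w m)"
  shows "real (card G) * v \<le> real (2 * r + 1) * (\<Sum>m\<in>Y. w m)"
proof -
  have "real (card G) * v = (\<Sum>n\<in>G. v)" by simp
  also have "\<dots> \<le> (\<Sum>n\<in>G. \<Sum>m\<in>{n - r..n + r}. w m)" by (intro sum_mono v)
  also have "\<dots> = (\<Sum>n\<in>G. \<Sum>j\<in>{0..2 * r}. w (n - r + j))"
  proof (rule sum.cong[OF refl])
    fix n assume "n \<in> G"
    then have "r \<le> n" using Y by blast
    then show "(\<Sum>m\<in>{n - r..n + r}. w m) = (\<Sum>j\<in>{0..2 * r}. w (n - r + j))"
      by (intro sum.reindex_bij_witness[of _ "\<lambda>j. n - r + j" "\<lambda>m. m - (n - r)"]) auto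
  qed
  also have "\<dots> = (\<Sum>j\<in>{0..2 * r}. \<Sum>n\<in>G. w (n - r + j))" by (rule sum.swap)
  also have "\<dots> \<le> (\<Sum>j\<in>{0..2 * r}. \<Sum>m\<in>Y. w m)"
  proof (intro sum_mono sum_inj_on_le[where h = "\<lambda>n. n - r + _"] Y w)
    fix j assume j: "j \<in> {0..2 * r}"
    \<comment> \<open>On \<open>G\<close> one has r \<le> n, so truncation cannot spoil
      injectivity.\<close>
    show "inj_on (\<lambda>n. n - r + j) G"
      by (rule inj_onI) (use Y in \<open>metis add_right_cancel eq_diff_iff\<close>)
    show "(\<lambda>n. n - r + j) ` G \<subseteq> Y"
    proof (rule image_subsetI)
      fix n assume n: "n \<in> G"
      then have "n - r + j \<in> {n - r..n + r}" using j Y(2)[OF n] by auto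
      then show "n - r + j \<in> Y" using Y(2)[OF n] by blast
    qed
  qed
  finally show ?thesis by simp
qed

lemma good_start_structured_window:
  fixes A :: "nat set" and f_str f_unf :: "nat \<Rightarrow> real" and c :: "nat \<Rightarrow> nat \<Rightarrow> complex" and \<alpha> :: "nat \<Rightarrow> nat \<Rightarrow> real"
  assumes f: "\<And>n. n \<ge> 1 \<Longrightarrow> indicator A n = f_str n + f_unf n" "\<And>n. n \<ge> 1 \<Longrightarrow> 0 \<le> f_str n \<and> f_str n \<le> 1"
    and c: "\<And>i n. i \<in> {1..d} \<Longrightarrow> n \<ge> 1 \<Longrightarrow> cmod (c i n) \<le> 1"
    and h: "h \<ge> 4" "n > 4 * h"
    and const_\<alpha>: "\<And>j i. j \<le> 20 \<Longrightarrow> i \<in> {1..d} \<Longrightarrow> (\<lambda>t. \<alpha> i (n - 4 * h + j * (h div 2) + t)) constant_on {1..h}"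
    and const_c: "\<And>j i. j \<le> 20 \<Longrightarrow> i \<in> {1..d} \<Longrightarrow> (\<lambda>t. c i (n - 4 * h + j * (h div 2) + t)) constant_on {1..h}"
    and err: "(\<Sum>m\<in>{n - 3 * h..n + 3 * h}.
      cmod ((\<Sum>i=1..d. c i m * e_char (real m * \<alpha> i m)) - complex_of_real (f_str m))) \<le> \<epsilon> * real h"
    and K: "1 \<le> K" "real K \<le> \<sigma> / 8 * real h"
    and U2: "(\<Sum>t\<in>{n - 3 * h..n + 3 * h}. U2_interval t K (\<lambda>m. complex_of_real (f_unf m))) \<le> \<sigma> / 4 * real h"
  shows "structured_window d (\<lambda>i. \<alpha> i n) \<epsilon> \<sigma> h A n"
proof -
  \<comment> \<open>Recentring at \<open>n\<close> moves the phase of the start into the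
    coefficient.\<close>
  define c' where "c' i = c i n * e_char (real n * \<alpha> i n)" for i
  define s where "s z = f_str (nat (int n + z))" for z
  have g: "1 \<le> h div 2" "h div 2 < h" using h by auto
  have cover: "n - 4 * h + i = m \<Longrightarrow> i \<in> {1..20 * (h div 2) + h}"
    if "m \<in> {n - 3 * h..n + 3 * h}" for m i
  proof -
    assume i: "n - 4 * h + i = m"
    \<comment> \<open>The 21 overlapping blocks from \<open>n - 4 * h\<close> on reach at least
      \<open>n + 3 * h\<close>, also for odd \<open>h\<close>.\<close>
    have "7 * h \<le> 20 * (h div 2) + h" using h by linarith
    then show ?thesis using that i h by auto
  qed
  have eq: "f m = f n" if const: "\<And>j. j \<le> 20 \<Longrightarrow> (\<lambda>t. f (n - 4 * h + j * (h div 2) + t)) constant_on {1..h}"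
    and m: "m \<in> {n - 3 * h..n + 3 * h}" for f :: "nat \<Rightarrow> 'z" and m
  proof -
    have all: "f m' = f (n - 4 * h + 1)" if m': "m' \<in> {n - 3 * h..n + 3 * h}" for m'
    proof -
      have e: "n - 4 * h + (m' - (n - 4 * h)) = m'" using m' h by auto
      have "f (n - 4 * h + (m' - (n - 4 * h))) = f (n - 4 * h + 1)"
        by (rule constant_on_chain[OF g const cover[OF m' e]])
      then show ?thesis by (simp only: e)
    qed
    show ?thesis using all[OF m] all[of n] by simp
  qed
  have \<alpha>_eq: "\<alpha> i m = \<alpha> i n" and c_eq: "c i m = c i n" if "i \<in> {1..d}" "m \<in> {n - 3 * h..n + 3 * h}" for i m
    using eq[of "\<alpha> i" m] eq[of "c i" m] const_\<alpha> const_c that by auto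
  have pos: "nat (int n + z) \<in> {n - 3 * h..n + 3 * h}" "nat (int n + z) \<ge> 1" "int (nat (int n + z)) = int n + z"
    if "z \<in> {-3 * int h..3 * int h}" for z
    using that h by auto
  have "(\<Sum>z\<in>{-3 * int h..3 * int h}. \<bar>trig_poly d c' (\<lambda>i. \<alpha> i n) z - s z\<bar>) \<le> \<epsilon> * real h"
  proof -
    have "(\<Sum>z\<in>{-3 * int h..3 * int h}. \<bar>trig_poly d c' (\<lambda>i. \<alpha> i n) z - s z\<bar>)
      \<le> (\<Sum>z\<in>{-3 * int h..3 * int h}. cmod ((\<Sum>i=1..d. c i (nat (int n + z)) * e_char (real (nat (int n + z)) * \<alpha> i (nat (int n + z))))
            - complex_of_real (f_str (nat (int n + z)))))"
    proof (rule sum_mono)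
      fix z assume z: "z \<in> {-3 * int h..3 * int h}"
      define m where "m = nat (int n + z)"
      note p = pos[OF z, folded m_def]
      have m: "real m = real n + of_int z" using p(3) by (metis of_int_add of_int_of_nat_eq)
      have "(\<Sum>i=1..d. c' i * e_char (of_int z * \<alpha> i n)) = (\<Sum>i=1..d. c i m * e_char (real m * \<alpha> i m))"
      proof (rule sum.cong[OF refl])
        fix i assume i: "i \<in> {1..d}"
        show "c' i * e_char (of_int z * \<alpha> i n) = c i m * e_char (real m * \<alpha> i m)"
          unfolding \<alpha>_eq[OF i p(1)] c_eq[OF i p(1)] by (simp add: c'_def m distrib_right e_char_add mult.assoc)
      qed
      then have "trig_poly d c' (\<lambda>i. \<alpha> i n) z - s z
          = Re ((\<Sum>i=1..d. c i m * e_char (real m * \<alpha> i m)) - complex_of_real (f_str m))"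
        by (simp only: trig_poly_def s_def m_def minus_complex.simps Re_complex_of_real)
      then show "\<bar>trig_poly d c' (\<lambda>i. \<alpha> i n) z - s z\<bar> \<le>
         cmod ((\<Sum>i=1..d. c i (nat (int n + z)) * e_char (real (nat (int n + z)) * \<alpha> i (nat (int n + z))))
            - complex_of_real (f_str (nat (int n + z))))"
        unfolding m_def[symmetric] by (simp only: abs_Re_le_cmod)
    qed
    also have "\<dots> = (\<Sum>m\<in>{n - 3 * h..n + 3 * h}.
      cmod ((\<Sum>i=1..d. c i m * e_char (real m * \<alpha> i m)) - complex_of_real (f_str m)))"
      by (rule sum.reindex_bij_witness[of _ "\<lambda>m. int m - int n" "\<lambda>z. nat (int n + z)"])
         (use h in auto)
    finally show ?thesis using err by linarith
  qed
  moreover have "cmod (\<Sum>z\<in>{x..y}. of_real (indicator A (nat (int n + z)) - s z) * e_char (of_int z * \<theta>)) \<le> \<sigma> * real h"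
    if xy: "{x..y} \<subseteq> {-3 * int h..3 * int h}" for x y \<theta>
  proof (cases "x \<le> y")
    case False
    have "0 \<le> \<sigma> / 8 * real h" using K by linarith
    then have "0 \<le> \<sigma> * real h" by simp
    then show ?thesis using False by simp
  next
    case True
    define x' y' where "x' = nat (int n + x)" and "y' = nat (int n + y)"
    have x: "- 3 * int h \<le> x" and y: "y \<le> 3 * int h" using xy True by auto
    have sub: "{x'..y'} \<subseteq> {n - 3 * h..n + 3 * h}" using x y by (auto simp: x'_def y'_def)
    have x'1: "x' \<ge> 1" using x h by (auto simp: x'_def)
    have "(\<Sum>z\<in>{x..y}. of_real (indicator A (nat (int n + z)) - s z) * e_char (of_int z * \<theta>))
       = (\<Sum>m\<in>{x'..y'}. e_char (- (real n * \<theta>)) * (of_real (f_unf m) * e_char (real m * \<theta>)))"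
    proof (rule sum.reindex_bij_witness[of _ "\<lambda>m. int m - int n" "\<lambda>z. nat (int n + z)"])
      fix z assume z: "z \<in> {x..y}"
      then have p: "nat (int n + z) \<ge> 1" "int (nat (int n + z)) = int n + z" using pos[of z] xy by blast+
      have m: "real (nat (int n + z)) = real n + of_int z" using p(2) by (metis of_int_add of_int_of_nat_eq)
      have "indicator A (nat (int n + z)) - s z = f_unf (nat (int n + z))"
        using f(1)[OF p(1)] by (simp add: s_def)
      moreover have "e_char (of_int z * \<theta>) = e_char (- (real n * \<theta>)) * e_char ((real n + of_int z) * \<theta>)"
        by (simp add: algebra_simps flip: e_char_add)
      ultimately show "e_char (- (real n * \<theta>)) * (of_real (f_unf (nat (int n + z))) * e_char (real (nat (int n + z)) * \<theta>))
         = of_real (indicator A (nat (int n + z)) - s z) * e_char (of_int z * \<theta>)"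
        by (simp only: m mult_ac)
    qed (use x y True h in \<open>auto simp: x'_def y'_def\<close>)
    also have "\<dots> = e_char (- (real n * \<theta>)) * (\<Sum>m\<in>{x'..y'}. of_real (f_unf m) * e_char (real m * \<theta>))"
      by (simp add: sum_distrib_left)
    also have "cmod \<dots> = cmod (\<Sum>m\<in>{x'..y'}. of_real (f_unf m) * e_char (real m * \<theta>))"
      by (simp add: norm_mult)
    also have "\<dots> \<le> 2 * (\<Sum>t\<in>{x'..y'}. U2_interval t K (\<lambda>n. of_real (f_unf n))) + 2 * real K"
    proof (rule long_phase_le_short_U2[OF K(1)])
      fix z assume "z \<in> {x'..y' + K}"
      then have "z \<ge> 1" using x'1 by auto
      \<comment> \<open>A difference of a value in {0,1} and a value in [0,1].\<close>
      then show "\<bar>f_unf z\<bar> \<le> 1" using f(1)[of z] f(2)[of z] by (cases "z \<in> A") auto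
    qed
    also have "(\<Sum>t\<in>{x'..y'}. U2_interval t K (\<lambda>n. of_real (f_unf n)))
       \<le> (\<Sum>t\<in>{n - 3 * h..n + 3 * h}. U2_interval t K (\<lambda>n. of_real (f_unf n)))"
      by (rule sum_mono2) (use sub in \<open>auto simp: U2_interval_nonneg[OF K(1)]\<close>)
    finally have "cmod (\<Sum>z\<in>{x..y}. of_real (indicator A (nat (int n + z)) - s z) * e_char (of_int z * \<theta>))
       \<le> 2 * (\<sigma> / 4 * real h) + 2 * (\<sigma> / 8 * real h)" using K U2 by linarith
    also have "\<dots> = 3 / 4 * (\<sigma> * real h)" by simp
    also have "\<dots> \<le> \<sigma> * real h"
    proof -
      have "0 \<le> \<sigma> / 8 * real h" using K by linarith
      then show ?thesis by simp
    qed
    finally show ?thesis .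
  qed
  moreover have "\<forall>i\<in>{1..d}. cmod (c' i) \<le> 1" using c h by (auto simp: c'_def norm_mult)
  moreover have "\<forall>z\<in>{-3 * int h..3 * int h}. 0 \<le> s z \<and> s z \<le> 1" using f(2) pos(2) by (auto simp: s_def)
  ultimately show ?thesis unfolding structured_window_def using h by (intro conjI exI[of _ c'] exI[of _ s]) auto
qed

lemma almost_all_starts_eventually:
  assumes P: "almost_all_starts N H P" and \<beta>: "\<beta> > 0" and H: "eventually (\<lambda>s. 1 \<le> H s \<and> H s \<le> N s) sequentially"
  shows "eventually (\<lambda>s. real (card {n\<in>{1..N s + 1 - H s}. \<not> P s n}) \<le> \<beta> * real (N s)) sequentially"
proof -
  have "eventually (\<lambda>s. 1 - \<beta> < real (card {n \<in> {1..N s + 1 - H s}. P s n}) / real (N s + 1 - H s)) sequentially"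
    using P \<beta> unfolding almost_all_starts_def by (intro order_tendstoD) auto
  then show ?thesis using H
  proof eventually_elim
    case (elim s)
    define M where "M = N s + 1 - H s"
    have M: "M > 0" "M \<le> N s" using elim by (auto simp: M_def)
    have "card {1..M} = card ({n \<in> {1..M}. P s n} \<union> {n \<in> {1..M}. \<not> P s n})" by (rule arg_cong[where f = card]) auto
    also have "\<dots> = card {n \<in> {1..M}. P s n} + card {n \<in> {1..M}. \<not> P s n}" by (rule card_Un_disjoint) auto
    finally have "real M = real (card {n \<in> {1..M}. P s n}) + real (card {n \<in> {1..M}. \<not> P s n})" by simp
    moreover have "(1 - \<beta>) * real M < real (card {n \<in> {1..M}. P s n})"
      using elim(1) M unfolding M_def[symmetric] by (simp add: pos_less_divide_eq)
    ultimately have "real (card {n \<in> {1..M}. \<not> P s n}) \<le> \<beta> * real M" by (simp add: algebra_simps)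
    also have "\<dots> \<le> \<beta> * real (N s)" using M \<beta> by (intro mult_left_mono) auto
    finally show ?case by (simp add: M_def)
  qed
qed

text \<open>A union bound in units of \<eta>M/200: the ends of the range cost 12, the two constancy
  conditions 21 each, the gap 1, the approximation error 11 and the Gowers norms 14, in total
  80.\<close>

lemma card_bad_starts_le:
  fixes err U :: "nat \<Rightarrow> real" and P :: "nat \<Rightarrow> nat \<Rightarrow> bool"
  assumes \<eta>: "0 < \<eta>" "\<eta> \<le> 1" and h: "h \<ge> 4" "real h \<le> \<eta> / 200 * real M" and K: "1 \<le> K" "K \<le> h"
    and \<epsilon>: "\<epsilon> > 0" and \<sigma>: "\<sigma> > 0"
    and S: "\<And>i. i < 3 \<Longrightarrow> real (card {n\<in>{1..M + 1 - h}. \<not> P i n}) \<le> \<eta> / 200 * real M"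
    and err: "\<And>m. 0 \<le> err m" "(\<Sum>m=1..M. (err m)\<^sup>2) \<le> 2 * (\<epsilon> * \<eta> / 200)\<^sup>2 * real M"
    and U: "\<And>m. 0 \<le> U m" "(\<Sum>t=1..M + 1 - K. U (t - 1)) \<le> \<sigma> * \<eta> / 400 * real M"
  defines "good \<equiv> \<lambda>n. 4 * h < n \<and> n + 8 * h \<le> M \<and>
    (\<forall>j\<le>20. P 0 (n - 4 * h + j * (h div 2)) \<and> P 1 (n - 4 * h + j * (h div 2))) \<and> P 2 n \<and>
    (\<Sum>m\<in>{n - 3 * h..n + 3 * h}. err m) \<le> \<epsilon> * real h \<and> (\<Sum>t\<in>{n - 3 * h..n + 3 * h}. U t) \<le> \<sigma> / 4 * real h"
  shows "real (card {n\<in>{1..M}. \<not> good n}) \<le> \<eta> * real M"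
proof -
  define R where "R = {n. 4 * h < n \<and> n + 8 * h \<le> M}"
  define Z where "Z i = {n\<in>{1..M + 1 - h}. \<not> P i n}" for i
  have finR: "finite R" by (rule finite_subset[of _ "{..M}"]) (auto simp: R_def)
  have finZ: "finite (Z i)" for i by (simp add: Z_def)
  define E where "E = {1..4 * h} \<union> {M - 8 * h<..M}"
  define Y where "Y i j = {n\<in>R. n - 4 * h + j * (h div 2) \<in> Z i}" for i j
  define X4 where "X4 = {n\<in>R. \<epsilon> * real h < (\<Sum>m\<in>{n - 3 * h..n + 3 * h}. err m)}"
  define X5 where "X5 = {n\<in>R. \<sigma> / 4 * real h < (\<Sum>t\<in>{n - 3 * h..n + 3 * h}. U t)}"
  \<comment> \<open>The last block starts no later than \<open>n + 6 * h\<close>, which is an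
    admissible start since \<open>n + 8 * h \<le> M\<close>.\<close>
  have start: "n - 4 * h + j * (h div 2) \<in> {1..M + 1 - h}" if "n \<in> R" "j \<le> 20" for n j
  proof -
    have "j * (h div 2) \<le> 20 * (h div 2)" using that by (intro mult_right_mono) auto
    then have "j * (h div 2) \<le> 10 * h" by linarith
    then show ?thesis using that by (auto simp: R_def)
  qed
  have "{n\<in>{1..M}. \<not> good n} \<subseteq> E \<union> (\<Union>j\<in>{..20}. Y 0 j) \<union> (\<Union>j\<in>{..20}. Y 1 j) \<union> Z 2 \<union> X4 \<union> X5"
  proof
    fix n assume n: "n \<in> {n\<in>{1..M}. \<not> good n}"
    show "n \<in> E \<union> (\<Union>j\<in>{..20}. Y 0 j) \<union> (\<Union>j\<in>{..20}. Y 1 j) \<union> Z 2 \<union> X4 \<union> X5"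
    proof (cases "n \<in> R")
      case False
      then have "n \<in> E" using n by (auto simp: R_def E_def)
      then show ?thesis by blast
    next
      case True
      then have r: "4 * h < n" "n + 8 * h \<le> M" by (auto simp: R_def)
      then have M: "n \<in> {1..M + 1 - h}" by auto
      consider j where "j \<le> 20" "\<not> P 0 (n - 4 * h + j * (h div 2)) \<or> \<not> P 1 (n - 4 * h + j * (h div 2))"
        | "\<not> P 2 n" | "\<epsilon> * real h < (\<Sum>m\<in>{n - 3 * h..n + 3 * h}. err m)"
        | "\<sigma> / 4 * real h < (\<Sum>t\<in>{n - 3 * h..n + 3 * h}. U t)"
        using n r unfolding good_def by force
      then show ?thesis
      proof cases
        case 1
        then have "n \<in> Y 0 j \<or> n \<in> Y 1 j" using start[OF True] True by (auto simp: Y_def Z_def)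
        then show ?thesis using 1(1) by blast
      next
        case 2
        then have "n \<in> Z 2" using M by (simp add: Z_def)
        then show ?thesis by blast
      qed (use True in \<open>auto simp: X4_def X5_def\<close>)
    qed
  qed
  then have "card {n\<in>{1..M}. \<not> good n} \<le> card (E \<union> (\<Union>j\<in>{..20}. Y 0 j) \<union> (\<Union>j\<in>{..20}. Y 1 j) \<union> Z 2 \<union> X4 \<union> X5)"
    by (intro card_mono) (auto simp: E_def Y_def X4_def X5_def finR finZ)
  also have "\<dots> \<le> card E + card (\<Union>j\<in>{..20}. Y 0 j) + card (\<Union>j\<in>{..20}. Y 1 j) + card (Z 2) + card X4 + card X5"
    by (intro order_trans[OF card_Un_le] add_mono order_refl)
  finally have total: "card {n\<in>{1..M}. \<not> good n} \<le>
     card E + card (\<Union>j\<in>{..20}. Y 0 j) + card (\<Union>j\<in>{..20}. Y 1 j) + card (Z 2) + card X4 + card X5" .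
  have fin: "finite X4" "finite X5" by (simp_all add: X4_def X5_def finR)
  have cE: "real (card E) \<le> \<eta> * real M * (12 / 200)"
  proof -
    have "card E \<le> 4 * h + 8 * h" unfolding E_def by (rule order_trans[OF card_Un_le]) auto
    then have "real (card E) \<le> 12 * real h" by linarith
    then show ?thesis using h by simp
  qed
  have cY: "real (card (\<Union>j\<in>{..20}. Y i j)) \<le> \<eta> * real M * (21 / 200)" if "i < 3" for i
  proof -
    have "card (Y i j) \<le> card (Z i)" for j
    proof (rule card_inj_on_le[where f = "\<lambda>n. n - 4 * h + j * (h div 2)"])
      show "inj_on (\<lambda>n. n - 4 * h + j * (h div 2)) (Y i j)"
        by (rule inj_onI) (auto simp: Y_def R_def)
    qed (auto simp: Y_def finZ)
    then have "(\<Sum>j\<in>{..20::nat}. card (Y i j)) \<le> (\<Sum>j\<in>{..20::nat}. card (Z i))" by (intro sum_mono)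
    then have "card (\<Union>j\<in>{..20}. Y i j) \<le> 21 * card (Z i)"
      using card_UN_le[of "{..20::nat}" "Y i"] by simp
    moreover have "real (card (Z i)) \<le> \<eta> / 200 * real M" unfolding Z_def by (rule S[OF that])
    ultimately show ?thesis by simp
  qed
  have cZ: "real (card (Z 2)) \<le> \<eta> * real M / 200" using S[of 2] by (simp add: Z_def)
  have c4: "real (card X4) \<le> \<eta> * real M * (11 / 200)"
  proof -
    define \<epsilon>' where "\<epsilon>' = \<epsilon> * \<eta> / 200"
    have \<epsilon>': "\<epsilon>' > 0" using \<epsilon> \<eta> by (simp add: \<epsilon>'_def)
    \<comment> \<open>The inequality of arithmetic and geometric means passes from the mean square
      to the mean.\<close>
    have "(\<Sum>m=1..M. err m) \<le> (\<Sum>m=1..M. \<epsilon>' / 2 + (err m)\<^sup>2 / (2 * \<epsilon>'))"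
    proof (rule sum_mono)
      fix m
      have "0 \<le> (\<epsilon>' - err m)\<^sup>2" by simp
      then have "2 * \<epsilon>' * err m \<le> \<epsilon>' * \<epsilon>' + (err m)\<^sup>2" by (simp add: power2_eq_square algebra_simps)
      then show "err m \<le> \<epsilon>' / 2 + (err m)\<^sup>2 / (2 * \<epsilon>')" using \<epsilon>' by (simp add: field_simps)
    qed
    also have "\<dots> = real M * (\<epsilon>' / 2) + (\<Sum>m=1..M. (err m)\<^sup>2) / (2 * \<epsilon>')"
      by (simp add: sum.distrib sum_divide_distrib)
    also have "\<dots> \<le> real M * (\<epsilon>' / 2) + 2 * \<epsilon>'\<^sup>2 * real M / (2 * \<epsilon>')"
      using err(2) \<epsilon>' by (intro add_left_mono divide_right_mono) (auto simp: \<epsilon>'_def)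
    also have "\<dots> = 3 / 2 * \<epsilon>' * real M" using \<epsilon>' by (simp add: power2_eq_square field_simps)
    finally have se: "(\<Sum>m=1..M. err m) \<le> 3 / 2 * \<epsilon>' * real M" .
    have "real (card X4) * (\<epsilon> * real h) \<le> real (2 * (3 * h) + 1) * (\<Sum>m=1..M. err m)"
      by (rule window_markov[OF _ _ fin(1)]) (use err in \<open>auto simp: X4_def R_def\<close>)
    also have "\<dots> \<le> (7 * real h) * (3 / 2 * \<epsilon>' * real M)"
      using se h err by (intro mult_mono sum_nonneg) auto
    also have "\<dots> = (\<eta> * real M * (21 / 400)) * (\<epsilon> * real h)" by (simp add: \<epsilon>'_def)
    finally have "real (card X4) \<le> \<eta> * real M * (21 / 400)"
      by (rule mult_right_le_imp_le) (use \<epsilon> h in simp)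
    also have "\<dots> \<le> \<eta> * real M * (11 / 200)" using \<eta> by (intro mult_left_mono) auto
    finally show ?thesis .
  qed
  have c5: "real (card X5) \<le> \<eta> * real M * (14 / 200)"
  proof -
    have "\<eta> / 200 * real M \<le> 1 * real M" using \<eta> by (intro mult_right_mono) auto
    then have hM: "h \<le> M" using h(2) by linarith
    \<comment> \<open>\<open>U2_interval x\<close> refers to the interval beginning at
      \<open>x + 1\<close>, hence the index shift.\<close>
    have "(\<Sum>t\<in>{0..M - K}. U t) = (\<Sum>t=1..M + 1 - K. U (t - 1))"
      using K hM by (intro sum.reindex_bij_witness[of _ "\<lambda>t. t - 1" Suc]) auto
    then have su: "(\<Sum>t\<in>{0..M - K}. U t) \<le> \<sigma> * \<eta> / 400 * real M" using U by simp
    have "real (card X5) * (\<sigma> / 4 * real h) \<le> real (2 * (3 * h) + 1) * (\<Sum>t\<in>{0..M - K}. U t)"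
      by (rule window_markov[OF _ _ fin(2)]) (use U K in \<open>auto simp: X5_def R_def\<close>)
    also have "\<dots> \<le> (7 * real h) * (\<sigma> * \<eta> / 400 * real M)"
      using su h U by (intro mult_mono sum_nonneg) auto
    also have "\<dots> = (\<eta> * real M * (14 / 200)) * (\<sigma> / 4 * real h)" by simp
    finally show ?thesis by (rule mult_right_le_imp_le) (use \<sigma> h in simp)
  qed
  have "0 \<le> \<eta> * real M" using \<eta> by simp
  moreover have "real (card {n\<in>{1..M}. \<not> good n}) \<le>
     real (card E) + real (card (\<Union>j\<in>{..20}. Y 0 j)) + real (card (\<Union>j\<in>{..20}. Y 1 j)) + real (card (Z 2)) + real (card X4) + real (card X5)"
    using of_nat_mono[OF total, where ?'a = real] by (simp only: of_nat_add)
  ultimately show ?thesis using cE cY[of 0] cY[of 1] cZ c4 c5 by simp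
qed

text \<open>The order of choice is forced: \<open>\<eta>\<close> and \<open>L\<close> determine
  \<epsilon>, this yields \<open>d\<close> with its frequencies and coefficients, then come
  \<open>C\<close>, \<open>\<sigma>\<close> and \<open>H0\<close>, and only then is \<open>s\<close>
  taken large.\<close>

lemma good_scale_windows:
  fixes A :: "nat set" and N H :: "nat \<Rightarrow> nat" and \<eta> :: real
  assumes N1: "\<forall>s\<ge>1. N s \<ge> 1" and H1: "\<forall>s\<ge>1. H s \<ge> 1"
    and Hinf: "tends_to_infinity H" and HN: "H \<prec>\<^sub>s N" and good: "U2_good_scale N H (indicator A)"
    and \<eta>: "0 < \<eta>" "\<eta> \<le> 1" and L: "L \<ge> 1"
  shows "eventually (\<lambda>s. \<exists>Q X. X \<subseteq> {1..N s} \<and> real (card X) \<le> \<eta> * real (N s) \<and>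
    (\<forall>n. H s \<le> Q n \<and> real (Q n) \<le> (1 + \<eta>) * real (H s) \<and> L dvd Q n) \<and>
    (\<forall>n\<in>{1..N s} - X. approximable_window A n (H s) (Q n) \<eta>)) sequentially"
proof -
  obtain f_str f_unf :: "nat \<Rightarrow> real" and H' where
    f: "\<forall>n\<ge>1. indicator A n = f_str n + f_unf n" "\<forall>n\<ge>1. 0 \<le> f_str n \<and> f_str n \<le> 1"
    and str: "\<forall>\<epsilon>>0. \<exists>d\<ge>1. \<exists>(c :: nat \<Rightarrow> nat \<Rightarrow> complex) (\<alpha> :: nat \<Rightarrow> nat \<Rightarrow> real).
           (\<forall>i\<in>{1..d}. \<forall>n\<ge>1. cmod (c i n) \<le> 1) \<and>
           (\<exists>v\<le>\<epsilon>. has_L2_norm N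
              (\<lambda>n. (\<Sum>i=1..d. c i n * e_char (real n * \<alpha> i n)) - complex_of_real (f_str n)) v) \<and>
           (\<forall>C\<ge>1.
              almost_all_starts N H (\<lambda>s n. \<forall>i\<in>{1..d}. (\<lambda>h. \<alpha> i (n + h)) constant_on {1..H s}) \<and>
              almost_all_starts N H (\<lambda>s n. \<forall>i\<in>{1..d}. (\<lambda>h. c i (n + h)) constant_on {1..H s}) \<and>
              almost_all_starts N H (\<lambda>s n. spectral_gap d C (H s) (\<lambda>i. \<alpha> i n)))"
    and H': "tends_to_infinity H'" "H' \<prec>\<^sub>s H" "has_U2_norm N H' (\<lambda>n. complex_of_real (f_unf n)) 0"
    using good[unfolded U2_good_scale_def, folded spectral_gap_def]
    by (elim exE conjE) (rule that; assumption)
  obtain \<epsilon> where \<epsilon>: "\<epsilon> > 0" and window: "\<forall>d\<ge>1. \<exists>C\<ge>1. \<exists>\<sigma>>0. \<exists>H0. \<forall>H\<ge>H0. \<forall>\<alpha>. H \<ge> 1 \<and> spectral_gap d C H \<alpha> \<longrightarrow>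
    (\<exists>Q. H \<le> Q \<and> real Q \<le> (1 + \<eta>) * real H \<and> L dvd Q \<and>
      (\<forall>A n. structured_window d \<alpha> \<epsilon> \<sigma> H A n \<longrightarrow> approximable_window A n H Q \<eta>))"
    using window_lemma[OF \<eta> L] by blast
  \<comment> \<open>The factor \<eta>/200 pays for passing from the global mean to all but few
    windows.\<close>
  define \<epsilon>' where "\<epsilon>' = \<epsilon> * \<eta> / 200"
  have \<epsilon>': "\<epsilon>' > 0" using \<epsilon> \<eta> by (simp add: \<epsilon>'_def)
  obtain d c \<alpha> v where d: "d \<ge> 1" and c: "\<forall>i\<in>{1..d}. \<forall>n\<ge>1. cmod (c i n) \<le> 1"
    and v: "v \<le> \<epsilon>'" "has_L2_norm N (\<lambda>n. (\<Sum>i=1..d. c i n * e_char (real n * \<alpha> i n)) - complex_of_real (f_str n)) v"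
    and starts: "\<forall>C\<ge>1.
              almost_all_starts N H (\<lambda>s n. \<forall>i\<in>{1..d}. (\<lambda>h. \<alpha> i (n + h)) constant_on {1..H s}) \<and>
              almost_all_starts N H (\<lambda>s n. \<forall>i\<in>{1..d}. (\<lambda>h. c i (n + h)) constant_on {1..H s}) \<and>
              almost_all_starts N H (\<lambda>s n. spectral_gap d C (H s) (\<lambda>i. \<alpha> i n))"
    using str \<epsilon>' by blast
  obtain C \<sigma> H0 where C: "C \<ge> 1" and \<sigma>: "\<sigma> > 0" and win: "\<forall>H\<ge>H0. \<forall>\<alpha>. H \<ge> 1 \<and> spectral_gap d C H \<alpha> \<longrightarrow>
    (\<exists>Q. H \<le> Q \<and> real Q \<le> (1 + \<eta>) * real H \<and> L dvd Q \<and>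
      (\<forall>A n. structured_window d \<alpha> \<epsilon> \<sigma> H A n \<longrightarrow> approximable_window A n H Q \<eta>))"
    using mp[OF spec[OF window] d] by (elim exE conjE) (rule that; assumption)
  define err where "err m = cmod ((\<Sum>i=1..d. c i m * e_char (real m * \<alpha> i m)) - complex_of_real (f_str m))" for m
  define P where "P s i n \<longleftrightarrow> (if i = 0 then (\<forall>i\<in>{1..d}. (\<lambda>h. \<alpha> i (n + h)) constant_on {1..H s})
     else if i = 1 then (\<forall>i\<in>{1..d}. (\<lambda>h. c i (n + h)) constant_on {1..H s})
     else spectral_gap d C (H s) (\<lambda>i. \<alpha> i n))" for s i n :: nat

  have ev_ge: "eventually (\<lambda>s. s \<ge> 1) sequentially" by (rule eventually_ge_at_top)
  have ev_H: "eventually (\<lambda>s. H s \<ge> m) sequentially" for m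
    using Hinf unfolding tends_to_infinity_def filterlim_at_top by blast
  have ev_HN: "eventually (\<lambda>s. real (H s) \<le> \<eta> / 200 * real (N s)) sequentially"
  proof -
    have "eventually (\<lambda>s. real (H s) / real (N s) < \<eta> / 200) sequentially"
      using HN \<eta> unfolding seq_prec_def by (intro order_tendstoD) auto
    then show ?thesis using ev_ge
    proof eventually_elim
      case (elim s)
      then have "real (N s) > 0" using N1 by fastforce
      then show ?case using elim by (simp add: field_simps)
    qed
  qed
  have ev_HN1: "eventually (\<lambda>s. 1 \<le> H s \<and> H s \<le> N s) sequentially"
    using ev_HN ev_H[of 1]
  proof eventually_elim
    case (elim s)
    have "\<eta> / 200 * real (N s) \<le> 1 * real (N s)" using \<eta> by (intro mult_right_mono) auto
    then show ?case using elim by linarith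
  qed
  have ev_P: "eventually (\<lambda>s. real (card {n\<in>{1..N s + 1 - H s}. \<not> P s i n}) \<le> \<eta> / 200 * real (N s)) sequentially"
    if "i < 3" for i :: nat
  proof -
    have "almost_all_starts N H (\<lambda>s. P s i)"
    proof -
      have "i = 0 \<or> i = 1 \<or> i = 2" using that by linarith
      then show ?thesis using mp[OF spec[OF starts] C] by (auto simp: P_def[abs_def])
    qed
    then show ?thesis using \<eta> by (intro almost_all_starts_eventually ev_HN1) auto
  qed
  have ev_err: "eventually (\<lambda>s. (\<Sum>m=1..N s. (err m)\<^sup>2) \<le> 2 * \<epsilon>'\<^sup>2 * real (N s)) sequentially"
  proof -
    obtain l where l: "(\<lambda>s. (\<Sum>n=1..N s. (err n)\<^sup>2) / real (N s)) \<longlonglongrightarrow> l" "v = sqrt l"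
      using v(2) unfolding has_L2_norm_def has_average_def err_def by blast
    have "sqrt l \<le> sqrt (\<epsilon>'\<^sup>2)" using v l \<epsilon>' by simp
    \<comment> \<open>The limit may equal \<epsilon>'^2; the factor 2 gives the strict inequality
      that passes to large \<open>s\<close>.\<close>
    then have "l < 2 * \<epsilon>'\<^sup>2" using \<epsilon>' by (smt (verit) real_sqrt_le_iff zero_less_power)
    then have "eventually (\<lambda>s. (\<Sum>n=1..N s. (err n)\<^sup>2) / real (N s) < 2 * \<epsilon>'\<^sup>2) sequentially"
      by (rule order_tendstoD(2)[OF l(1)])
    then show ?thesis using ev_ge
    proof eventually_elim
      case (elim s)
      then have "real (N s) > 0" using N1 by fastforce
      then show ?case using elim by (simp add: pos_divide_less_eq)
    qed
  qed
  have ev_H': "eventually (\<lambda>s. 1 \<le> H' s) sequentially"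
    using H'(1) unfolding tends_to_infinity_def filterlim_at_top by blast
  have ev_H'H: "eventually (\<lambda>s. real (H' s) \<le> min 1 (\<sigma> / 8) * real (H s)) sequentially"
  proof -
    have "eventually (\<lambda>s. real (H' s) / real (H s) < min 1 (\<sigma> / 8)) sequentially"
      using H'(2) \<sigma> unfolding seq_prec_def by (intro order_tendstoD) auto
    then show ?thesis using ev_ge
    proof eventually_elim
      case (elim s)
      then have "real (H s) > 0" using H1 by fastforce
      then show ?case using elim(1) by (simp only: pos_divide_less_eq less_imp_le)
    qed
  qed
  have ev_U: "eventually (\<lambda>s. (\<Sum>n=1..N s + 1 - H' s. U2_interval (n - 1) (H' s) (\<lambda>n. complex_of_real (f_unf n)))
      / real (N s + 1 - H' s) < \<sigma> * \<eta> / 400) sequentially"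
    using H'(3) \<sigma> \<eta> unfolding has_U2_norm_def by (intro order_tendstoD) auto
  have lt3: "(0::nat) < 3" "(1::nat) < 3" "(2::nat) < 3" by simp_all
  show ?thesis
    using ev_H[of "max (max 4 H0) (nat \<lceil>real L / \<eta>\<rceil>)"] ev_HN ev_HN1 ev_P[OF lt3(1)] ev_P[OF lt3(2)] ev_P[OF lt3(3)] ev_err ev_H' ev_H'H ev_U ev_ge
  proof eventually_elim
    case (elim s)
    define h where "h = H s"
    define M where "M = N s"
    define K where "K = H' s"
    define U where "U t = U2_interval t K (\<lambda>n. complex_of_real (f_unf n))" for t
    have h: "4 \<le> h" "H0 \<le> h" "nat \<lceil>real L / \<eta>\<rceil> \<le> h" using elim by (auto simp: h_def)
    have hM: "real h \<le> \<eta> / 200 * real M" "h \<le> M" using elim by (auto simp: h_def M_def)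
    have K: "1 \<le> K" "real K \<le> 1 * real h" "real K \<le> \<sigma> / 8 * real h"
    proof -
      show "1 \<le> K" using elim by (simp add: K_def)
      have *: "real K \<le> min 1 (\<sigma> / 8) * real h" using elim by (simp add: K_def h_def)
      show "real K \<le> 1 * real h" by (rule order_trans[OF * mult_right_mono]) auto
      show "real K \<le> \<sigma> / 8 * real h" by (rule order_trans[OF * mult_right_mono]) auto
    qed
    then have Kh: "K \<le> h" by simp
    define good where "good n \<longleftrightarrow> 4 * h < n \<and> n + 8 * h \<le> M \<and>
    (\<forall>j\<le>20. P s 0 (n - 4 * h + j * (h div 2)) \<and> P s 1 (n - 4 * h + j * (h div 2))) \<and> P s 2 n \<and>
    (\<Sum>m\<in>{n - 3 * h..n + 3 * h}. err m) \<le> \<epsilon> * real h \<and> (\<Sum>t\<in>{n - 3 * h..n + 3 * h}. U t) \<le> \<sigma> / 4 * real h" for n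
    define X where "X = {n\<in>{1..M}. \<not> good n}"
    have "real (card X) \<le> \<eta> * real M"
      unfolding X_def good_def
    proof (rule card_bad_starts_le[OF \<eta> h(1) hM(1) K(1) Kh \<epsilon> \<sigma>])
      show "real (card {n\<in>{1..M + 1 - h}. \<not> P s i n}) \<le> \<eta> / 200 * real M" if i: "i < 3" for i
      proof -
        have "i = 0 \<or> i = 1 \<or> i = 2" using i by linarith
        then show ?thesis using elim by (auto simp: h_def M_def)
      qed
      show "(\<Sum>m=1..M. (err m)\<^sup>2) \<le> 2 * (\<epsilon> * \<eta> / 200)\<^sup>2 * real M" using elim by (simp add: M_def \<epsilon>'_def)
      show "0 \<le> U m" for m unfolding U_def by (rule U2_interval_nonneg[OF K(1)])
      show "(\<Sum>t=1..M + 1 - K. U (t - 1)) \<le> \<sigma> * \<eta> / 400 * real M"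
      proof -
        have pos: "real (M + 1 - K) > 0" using Kh hM by auto
        have "(\<Sum>t=1..M + 1 - K. U (t - 1)) / real (M + 1 - K) < \<sigma> * \<eta> / 400"
          using elim(10) by (simp only: U_def M_def K_def)
        then have "(\<Sum>t=1..M + 1 - K. U (t - 1)) \<le> \<sigma> * \<eta> / 400 * real (M + 1 - K)"
          using pos by (simp only: pos_divide_less_eq less_imp_le)
        also have "\<dots> \<le> \<sigma> * \<eta> / 400 * real M"
          using \<sigma> \<eta> K by (intro mult_left_mono) auto
        finally show ?thesis .
      qed
    qed (simp add: err_def)
    moreover have "\<exists>Q. h \<le> Q \<and> real Q \<le> (1 + \<eta>) * real h \<and> L dvd Q \<and> (n \<in> {1..M} - X \<longrightarrow>
      approximable_window A n h Q \<eta>)" for n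
    proof (cases "n \<in> {1..M} - X")
      case False
      \<comment> \<open>At an exceptional start any admissible length will do: the first multiple of
        \<open>L\<close> from \<open>h\<close> on.\<close>
      define Q where "Q = L * ((h + L - 1) div L)"
      have "h + L - 1 = Q + (h + L - 1) mod L" by (simp add: Q_def)
      moreover have "(h + L - 1) mod L < L" using L by simp
      ultimately have "h \<le> Q" "Q \<le> h + L" by linarith+
      moreover have "real L \<le> \<eta> * real h"
      proof -
        have "real L / \<eta> \<le> real (nat \<lceil>real L / \<eta>\<rceil>)" by (rule real_nat_ceiling_ge)
        also have "\<dots> \<le> real h" using h(3) by simp
        finally show ?thesis using \<eta> by (simp add: field_simps)
      qed
      ultimately have "h \<le> Q \<and> real Q \<le> (1 + \<eta>) * real h" by (simp add: distrib_right)
      moreover have "L dvd Q" by (simp add: Q_def)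
      ultimately show ?thesis using False by blast
    next
      case True
      then have g: "good n" by (auto simp: X_def)
      have sw: "structured_window d (\<lambda>i. \<alpha> i n) \<epsilon> \<sigma> h A n"
      proof (rule good_start_structured_window[where c = c and \<alpha> = \<alpha> and ?f_str = f_str and ?f_unf = f_unf and K = K])
        show "n > 4 * h" using g by (simp add: good_def)
        show "(\<lambda>t. \<alpha> i (n - 4 * h + j * (h div 2) + t)) constant_on {1..h}" if "j \<le> 20" "i \<in> {1..d}" for j i
        proof -
          have "P s 0 (n - 4 * h + j * (h div 2))" using g that unfolding good_def by blast
          then show ?thesis using that by (simp add: P_def h_def)
        qed
        show "(\<lambda>t. c i (n - 4 * h + j * (h div 2) + t)) constant_on {1..h}" if "j \<le> 20" "i \<in> {1..d}" for j i
        proof -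
          have "P s 1 (n - 4 * h + j * (h div 2))" using g that unfolding good_def by blast
          then show ?thesis using that by (simp add: P_def h_def)
        qed
        show "(\<Sum>m\<in>{n - 3 * h..n + 3 * h}.
      cmod ((\<Sum>i=1..d. c i m * e_char (real m * \<alpha> i m)) - complex_of_real (f_str m))) \<le> \<epsilon> * real h"
          using g unfolding good_def err_def by blast
        show "(\<Sum>t\<in>{n - 3 * h..n + 3 * h}. U2_interval t K (\<lambda>m. complex_of_real (f_unf m))) \<le> \<sigma> / 4 * real h"
          using g unfolding good_def U_def by blast
      qed (use f c h K in auto)
      have gap: "spectral_gap d C h (\<lambda>i. \<alpha> i n)"
      proof -
        have "P s 2 n" using g unfolding good_def by blast
        then show ?thesis by (simp add: P_def h_def)
      qed
      have "1 \<le> h" using h by simp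
      then show ?thesis using win h(2) gap sw by blast
    qed
    then obtain Q where "\<And>n. h \<le> Q n \<and> real (Q n) \<le> (1 + \<eta>) * real h \<and> L dvd Q n \<and> (n \<in> {1..M} - X \<longrightarrow>
      approximable_window A n h (Q n) \<eta>)"
      by metis
    moreover have "X \<subseteq> {1..M}" by (auto simp: X_def)
    ultimately show ?case unfolding h_def[symmetric] M_def[symmetric] by (intro exI[of _ Q] exI[of _ X]) blast
  qed
qed

section \<open>Residue classes met by small elements\<close>

lemma meets_residues_mod_bounded:
  assumes B: "meets_residues_in_nat B" and m: "m \<ge> 1"
  shows "\<exists>w. meets_residues_mod (B \<inter> {..w}) m"
proof -
  have "\<exists>b\<in>B. [int b = int r] (mod int m)" for r
  proof -
    \<comment> \<open>The offset is \<open>r + m\<close>, not \<open>r\<close>, because the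
      progressions available have offset at least 1.\<close>
    obtain k where k: "m * k + (r + m) \<in> B" using B m unfolding meets_residues_in_nat_def by (metis add_leD2 le_add2 le_trans)
    have "[int (m * k + (r + m)) = int r] (mod int m)" by (simp add: cong_def)
    then show ?thesis using k by blast
  qed
  then obtain b where b: "\<And>r. b r \<in> B" "\<And>r. [int (b r) = int r] (mod int m)" by metis
  \<comment> \<open>The sum is a common bound for the witnesses of the finitely many
    classes.\<close>
  define w where "w = (\<Sum>r<m. b r)"
  have "\<exists>x\<in>B \<inter> {..w}. [int x = r] (mod int m)" for r :: int
  proof -
    define q where "q = nat (r mod int m)"
    have q: "q < m" "int q = r mod int m" using m by (auto simp: q_def nat_less_iff)
    have "b q \<le> w" unfolding w_def by (rule member_le_sum) (use q in auto)
    moreover have "[int (b q) = r] (mod int m)" using b(2)[of q] q by (simp add: cong_def)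
    ultimately show ?thesis using b(1) by blast
  qed
  then show ?thesis unfolding meets_residues_mod_def by blast
qed

lemma meets_residues_mod_mono:
  "meets_residues_mod B m \<Longrightarrow> B \<subseteq> B' \<Longrightarrow> meets_residues_mod B' m"
  unfolding meets_residues_mod_def by blast

lemma meets_residues_mod_upto_bounded:
  assumes B: "meets_residues_in_nat B"
  shows "\<exists>w. \<forall>m. 1 \<le> m \<and> m \<le> D \<longrightarrow> meets_residues_mod (B \<inter> {..w}) m"
proof -
  obtain w where w: "\<And>m. m \<ge> 1 \<Longrightarrow> meets_residues_mod (B \<inter> {..w m}) m"
    using meets_residues_mod_bounded[OF B] by metis
  have "meets_residues_mod (B \<inter> {..\<Sum>m\<le>D. w m}) m" if "1 \<le> m" "m \<le> D" for m
  proof (rule meets_residues_mod_mono[OF w[OF that(1)]])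
    have "w m \<le> (\<Sum>m\<le>D. w m)" by (rule member_le_sum) (use that in auto)
    then show "B \<inter> {..w m} \<subseteq> B \<inter> {..\<Sum>m\<le>D. w m}" by auto
  qed
  then show ?thesis by blast
qed

text \<open>For \<epsilon> \<ge> 1 the error may fill the whole window; this serves the finitely
  many early blocks.\<close>

lemma window_sumset_approx_trivial:
  assumes "1 \<le> \<epsilon>" "Q \<ge> 1"
  shows "window_sumset_approx A Bt n Q \<epsilon> (shift_down A n \<inter> {0..<Q}) Bt"
proof -
  have "card (mod_sumset Q (shift_down A n \<inter> {0..<Q}) Bt - (shift_down (A + Bt) n \<inter> {0..<Q})) \<le> card {0..<Q}"
    by (rule card_mono) (use assms in \<open>auto simp: mod_sumset_def\<close>)
  moreover have "1 * real Q \<le> \<epsilon> * real Q" using assms by (intro mult_right_mono) auto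
  ultimately have "real (card (mod_sumset Q (shift_down A n \<inter> {0..<Q}) Bt - (shift_down (A + Bt) n \<inter> {0..<Q}))) \<le> \<epsilon> * real Q"
    by simp
  then show ?thesis using assms by (simp add: window_sumset_approx_def)
qed

section \<open>Diagonalisation\<close>

text \<open>\<open>K s\<close> is the largest index whose threshold is at most \<open>s\<close>; the
  cap \<open>k \<le> s\<close> makes the maximum one over a finite set.\<close>

lemma slow_diagonal_sequence:
  fixes S :: "nat \<Rightarrow> nat"
  obtains K where "\<And>s. s \<ge> S 0 \<Longrightarrow> S (K s) \<le> s" "filterlim K at_top sequentially"
proof -
  define K where "K s = Max {k. k \<le> s \<and> S k \<le> s}" for s
  have fin: "finite {k. k \<le> s \<and> S k \<le> s}" for s by simp
  have "S (K s) \<le> s" if "s \<ge> S 0" for s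
  proof -
    have "K s \<in> {k. k \<le> s \<and> S k \<le> s}" unfolding K_def by (rule Max_in[OF fin]) (use that in auto)
    then show ?thesis by simp
  qed
  moreover have "filterlim K at_top sequentially"
    unfolding filterlim_at_top
  proof
    fix k
    have "K s \<ge> k" if "s \<ge> max k (S k)" for s unfolding K_def using that by (intro Max_ge[OF fin]) auto
    then show "eventually (\<lambda>s. k \<le> K s) sequentially" unfolding eventually_sequentially by blast
  qed
  ultimately show thesis using that by blast
qed

text \<open>The ratio condition makes \<open>N\<close> increasing only eventually, so early blocks
  may overlap. Beyond \<open>s1\<close> they are disjoint, and all earlier ones lie below
  \<open>N s1\<close>.\<close>

lemma eventual_block_index:
  fixes N :: "nat \<Rightarrow> nat"
  assumes N: "\<forall>s\<ge>1. N s \<ge> 1" and ratio: "(\<lambda>s. real (N s) / real (N (s + 1))) \<longlonglongrightarrow> 0"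
  obtains s1 where "s1 \<ge> S" "\<And>s. s \<le> s1 \<Longrightarrow> N s \<le> N s1" "\<And>s t. s1 \<le> s \<Longrightarrow> s < t \<Longrightarrow> N s < N t"
proof -
  have "eventually (\<lambda>s. real (N s) / real (N (s + 1)) < 1) sequentially"
    by (rule order_tendstoD(2)[OF ratio]) simp
  then obtain s0 where s0: "\<And>s. s \<ge> s0 \<Longrightarrow> real (N s) / real (N (s + 1)) < 1"
    unfolding eventually_sequentially by blast
  have step: "N s < N (s + 1)" if "s \<ge> s0" for s
  proof -
    have "N (s + 1) \<ge> 1" using N by simp
    then have "real (N (s + 1)) > 0" by linarith
    then show ?thesis using s0[OF that] by (simp add: pos_divide_less_eq)
  qed
  have mono: "N s + j \<le> N (s + j)" if "s \<ge> s0" for s j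
  proof (induction j)
    case (Suc j)
    then show ?case using step[of "s + j"] that by simp
  qed simp
  have less: "N s < N t" if "s \<ge> s0" "s < t" for s t
    using mono[OF that(1), of "t - s"] that(2) by simp
  \<comment> \<open>After \<open>s0\<close> the values of \<open>N\<close> grow by at least 1 per
    step, so within \<open>m\<close> steps they reach every early value.\<close>
  define m where "m = (\<Sum>s\<le>s0. N s)"
  define s1 where "s1 = s0 + m + S"
  have "N s \<le> N s1" if "s \<le> s1" for s
  proof (cases "s \<le> s0")
    case True
    then have "N s \<le> m" unfolding m_def by (intro member_le_sum) auto
    also have "m \<le> N (s0 + (m + S))" using mono[of s0 "m + S"] by simp
    finally show ?thesis by (simp add: s1_def add.assoc)
  next
    case False
    then show ?thesis using less[of s s1] that by (cases "s = s1") auto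
  qed
  moreover have "s1 \<ge> S" "s1 \<ge> s0" by (auto simp: s1_def)
  ultimately show thesis using that less by (meson le_trans)
qed

theorem theorem9p1:
  fixes A :: "nat set" and \<delta> :: real and N H :: "nat \<Rightarrow> nat"
  assumes "A \<subseteq> {1..}"
    and "has_density A \<delta>" and "\<delta> > 0"
    and "N 0 = 0" and "\<forall>s\<ge>1. N s \<ge> 1" and "\<forall>s\<ge>1. H s \<ge> 1"
    and "tends_to_infinity H" and "H \<prec>\<^sub>s N"
    and "(\<lambda>s. real (N s) / real (N (s + 1))) \<longlonglongrightarrow> 0"
    and "U2_good_scale N H (indicator A)"
  shows "\<exists>\<epsilon> :: nat \<Rightarrow> real. \<epsilon> \<longlonglongrightarrow> 0 \<and>
    (\<exists>Q :: nat \<Rightarrow> nat.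
      (\<forall>n\<ge>1. Q n \<ge> 1) \<and>
      (\<forall>s\<ge>1. \<forall>n\<in>{N (s - 1) + 1..N s}.
         H s \<le> Q n \<and> real (Q n) \<le> (1 + \<epsilon> s) * real (H s)) \<and>
      tends_to_infinity (\<lambda>n. LEAST m. m \<ge> 1 \<and> \<not> m dvd Q n) \<and>
      (\<forall>Bt :: nat \<Rightarrow> nat set. (\<forall>s\<ge>1. Bt s \<subseteq> {1..H s}) \<longrightarrow>
        (\<exists>X :: nat \<Rightarrow> nat set.
          (\<forall>s\<ge>1. X s \<subseteq> {N (s - 1) + 1..N s}) \<and>
          (\<lambda>s. real (card (X s)) / real (N s)) \<longlonglongrightarrow> 0 \<and>
          (\<forall>s\<ge>1. \<forall>n\<in>{N (s - 1) + 1..N s} - X s.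
             \<exists>An Bn. window_sumset_approx A (Bt s) n (Q n) (\<epsilon> s) An Bn) \<and>
          (\<forall>B. B \<subseteq> {1..} \<and> meets_residues_in_nat B \<and> (\<forall>s\<ge>1. Bt s = B \<inter> {1..H s}) \<longrightarrow>
             (\<exists>D :: nat \<Rightarrow> nat. tends_to_infinity D \<and>
               (\<forall>s\<ge>1. \<forall>n\<in>{N (s - 1) + 1..N s} - X s.
                  \<exists>An Bn. window_sumset_approx A (Bt s) n (Q n) (\<epsilon> s) An Bn \<and>
                    (\<forall>m. 1 \<le> m \<and> m \<le> D s \<longrightarrow> meets_residues_mod Bn m)))))))"
proof -
  note N1 = assms(5) and H1 = assms(6)
  define \<eta> where "\<eta> k = 1 / real (k + 1)" for k :: nat
  have \<eta>: "0 < \<eta> k" "\<eta> k \<le> 1" for k by (auto simp: \<eta>_def)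
  \<comment> \<open>Divisibility by \<open>fact (k + 1)\<close> pushes the least nondivisor of each
    window length beyond \<open>k + 1\<close>.\<close>
  define G where "G k s Q X \<longleftrightarrow> X \<subseteq> {1..N s} \<and> real (card X) \<le> \<eta> k * real (N s) \<and>
    (\<forall>n. H s \<le> Q n \<and> real (Q n) \<le> (1 + \<eta> k) * real (H s) \<and> fact (k + 1) dvd Q n) \<and>
    (\<forall>n\<in>{1..N s} - X. approximable_window A n (H s) (Q n) (\<eta> k))" for k s Q X
  have "eventually (\<lambda>s. (\<exists>Q X. G k s Q X) \<and> (k + 1) ^ 2 \<le> H s) sequentially" for k
  proof (rule eventually_conj)
    show "eventually (\<lambda>s. \<exists>Q X. G k s Q X) sequentially"
      unfolding G_def by (rule good_scale_windows[OF assms(5-8,10) \<eta>]) (rule fact_ge_1)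
    \<comment> \<open>This makes \<open>\<eta> k * H s\<close> at least \<open>k + 1\<close>, so the
      range of reserved small elements grows to infinity along the diagonal.\<close>
    show "eventually (\<lambda>s. (k + 1) ^ 2 \<le> H s) sequentially"
      using assms(7) unfolding tends_to_infinity_def filterlim_at_top by blast
  qed
  then have "\<forall>k. \<exists>S. \<forall>s\<ge>S. (\<exists>Q X. G k s Q X) \<and> (k + 1) ^ 2 \<le> H s"
    unfolding eventually_sequentially by blast
  then obtain S where S: "\<And>k s. s \<ge> S k \<Longrightarrow> \<exists>Q X. G k s Q X" "\<And>k s. s \<ge> S k \<Longrightarrow> (k + 1) ^ 2 \<le> H s"
    by metis
  obtain K where K: "\<And>s. s \<ge> S 0 \<Longrightarrow> S (K s) \<le> s" "filterlim K at_top sequentially"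
    using slow_diagonal_sequence[of S] by blast
  have "\<exists>Q X. s \<ge> S 0 \<longrightarrow> G (K s) s Q X" for s using S(1) K(1) by blast
  then obtain Qs Xs where QX: "\<And>s. s \<ge> S 0 \<Longrightarrow> G (K s) s (Qs s) (Xs s)" by metis
  have HK: "(K s + 1) ^ 2 \<le> H s" if "s \<ge> S 0" for s using S(2) K(1) that by blast
  obtain s1 where s1: "s1 \<ge> max 1 (S 0)" "\<And>s. s \<le> s1 \<Longrightarrow> N s \<le> N s1" "\<And>s t. s1 \<le> s \<Longrightarrow> s < t \<Longrightarrow> N s < N t"
    using eventual_block_index[OF assms(5,9), where S = "max 1 (S 0)"] by metis
  \<comment> \<open>\<open>T\<close> is at least every early \<open>H s\<close> and serves as window
    length in all early blocks; the value \<open>T\<close> for \<epsilon> there makes the length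
    bound and the approximation trivial.\<close>
  define T where "T = (\<Sum>s=1..s1. H s)"
  have HT: "H s \<le> T" if "1 \<le> s" "s \<le> s1" for s unfolding T_def by (rule member_le_sum) (use that in auto)
  have T1: "T \<ge> 1" using HT[of 1] H1 s1(1) by force
  \<comment> \<open>Blocks beyond \<open>s1\<close> are disjoint, so \<open>Q\<close> can be defined
    through the unique block containing \<open>n\<close>.\<close>
  define blk where "blk n = (LEAST s. s > s1 \<and> n \<le> N s)" for n
  have blk_eq: "blk n = s" and late: "N s1 < n" if s: "s > s1" and n: "n \<in> {N (s - 1) + 1..N s}" for s n
  proof -
    have *: "N t < n" if "s1 \<le> t" "t < s" for t
    proof (cases "t = s - 1")
      case False
      then have "t < s - 1" using that by linarith
      then show ?thesis using s1(3)[of t "s - 1"] that n by auto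
    qed (use n in auto)
    show "blk n = s" unfolding blk_def
    proof (rule Least_equality)
      show "s \<le> t" if "t > s1 \<and> n \<le> N t" for t using *[of t] that by (meson leI less_imp_le not_le)
    qed (use s n in auto)
    show "N s1 < n" using *[of s1] s by simp
  qed
  have N_ge: "s - s1 \<le> N s" if "s1 \<le> s" for s
    using that
  proof (induction s rule: dec_induct)
    case (step s)
    then show ?case using s1(3)[of s "Suc s"] by linarith
  qed simp
  have blk_ex: "blk n > s1 \<and> n \<le> N (blk n)" for n
    unfolding blk_def by (rule LeastI[of _ "s1 + n + 1"]) (use N_ge[of "s1 + n + 1"] in auto)
  define Q where "Q n = (if n \<le> N s1 then T else Qs (blk n) n)" for n
  define \<epsilon> where "\<epsilon> s = (if s \<le> s1 then real T else \<eta> (K s))" for s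
  have Q_early: "Q n = T" if "s \<le> s1" "n \<in> {N (s - 1) + 1..N s}" for s n
    using that s1(2)[of s] by (auto simp: Q_def)
  have Q_late: "Q n = Qs s n" if "s > s1" "n \<in> {N (s - 1) + 1..N s}" for s n
    using blk_eq[OF that] late[OF that] by (simp add: Q_def)
  have late_S: "s \<ge> S 0" if "s > s1" for s using that s1(1) by simp
  have \<eta>K: "(\<lambda>s. \<eta> (K s)) \<longlonglongrightarrow> 0"
  proof -
    have "(\<lambda>k. \<eta> k) \<longlonglongrightarrow> 0" unfolding \<eta>_def by real_asymp
    then show ?thesis by (rule filterlim_compose[OF _ K(2)])
  qed
  have \<epsilon>_lim: "\<epsilon> \<longlonglongrightarrow> 0"
    using \<eta>K by (rule Lim_transform_eventually)
      (auto simp: \<epsilon>_def eventually_sequentially intro!: exI[of _ "Suc s1"])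
  have Q1: "Q n \<ge> 1" if "n \<ge> 1" for n
  proof (cases "n \<le> N s1")
    case False
    have "H (blk n) \<le> Qs (blk n) n" using QX[OF late_S] blk_ex[of n] unfolding G_def by blast
    moreover have "H (blk n) \<ge> 1" using H1 blk_ex[of n] s1(1) by auto
    ultimately show ?thesis using False by (simp add: Q_def)
  qed (use T1 in \<open>simp add: Q_def\<close>)
  have Q_bounds: "H s \<le> Q n \<and> real (Q n) \<le> (1 + \<epsilon> s) * real (H s)"
    if s: "s \<ge> 1" and n: "n \<in> {N (s - 1) + 1..N s}" for s n
  proof (cases "s \<le> s1")
    case True
    have "real T * 1 \<le> (1 + real T) * real (H s)" using H1 s by (intro mult_mono) auto
    then show ?thesis using Q_early[OF True n] HT[OF s True] True by (simp add: \<epsilon>_def)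
  next
    case False
    then show ?thesis using QX[OF late_S, of s] Q_late[of s n] n unfolding G_def by (auto simp: \<epsilon>_def)
  qed
  have least: "tends_to_infinity (\<lambda>n. LEAST m. m \<ge> 1 \<and> \<not> m dvd Q n)"
    unfolding tends_to_infinity_def filterlim_at_top
  proof
    fix k
    obtain s2 where s2: "\<And>s. s \<ge> s2 \<Longrightarrow> k \<le> K s"
      using K(2) unfolding filterlim_at_top eventually_sequentially by blast
    have "k \<le> (LEAST m. m \<ge> 1 \<and> \<not> m dvd Q n)" if n: "n \<ge> N (max s1 s2) + 1" for n
    proof -
      define s where "s = blk n"
      have s: "s > s1" "n \<le> N s" using blk_ex[of n] by (auto simp: s_def)
      have "N s1 \<le> N (max s1 s2)" using s1(3)[of s1 s2] by (cases "s1 < s2") (auto simp: max_def)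
      then have "N s1 < n" using n by linarith
      then have Qn: "Q n = Qs s n" by (simp add: Q_def s_def)
      have "s2 \<le> s"
      proof (rule ccontr)
        assume "\<not> s2 \<le> s"
        then have "N s < N (max s1 s2)" using s by (intro s1(3)) auto
        then show False using s n by linarith
      qed
      then have "k \<le> K s" by (rule s2)
      moreover have dv: "fact (K s + 1) dvd Q n" and "H s \<le> Q n"
        using QX[OF late_S[OF s(1)]] unfolding G_def Qn by blast+
      define m where "m = (LEAST m. m \<ge> 1 \<and> \<not> m dvd Q n)"
      have "Q n \<ge> 1" using \<open>H s \<le> Q n\<close> H1 s s1(1) by (metis le_trans less_imp_le max.bounded_iff)
      \<comment> \<open>A positive number is not divisible by its successor, so a least nondivisor
        exists.\<close>
      then have "\<not> Suc (Q n) dvd Q n" by (auto dest: dvd_imp_le)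
      then have m: "m \<ge> 1 \<and> \<not> m dvd Q n"
        unfolding m_def by (intro LeastI[where P = "\<lambda>m. m \<ge> 1 \<and> \<not> m dvd Q n" and k = "Suc (Q n)"]) simp
      have "K s + 1 < m"
      proof (rule ccontr)
        assume "\<not> ?thesis"
        then have "m dvd fact (K s + 1)" using m by (intro dvd_fact) auto
        then show False using dv m dvd_trans by blast
      qed
      ultimately show ?thesis by (simp add: m_def)
    qed
    then show "eventually (\<lambda>n. k \<le> (LEAST m. m \<ge> 1 \<and> \<not> m dvd Q n)) sequentially"
      unfolding eventually_sequentially by blast
  qed
  have main: "\<exists>X. (\<forall>s\<ge>1. X s \<subseteq> {N (s - 1) + 1..N s}) \<and>
          (\<lambda>s. real (card (X s)) / real (N s)) \<longlonglongrightarrow> 0 \<and>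
          (\<forall>s\<ge>1. \<forall>n\<in>{N (s - 1) + 1..N s} - X s.
             \<exists>An Bn. window_sumset_approx A (Bt s) n (Q n) (\<epsilon> s) An Bn) \<and>
          (\<forall>B. B \<subseteq> {1..} \<and> meets_residues_in_nat B \<and> (\<forall>s\<ge>1. Bt s = B \<inter> {1..H s}) \<longrightarrow>
             (\<exists>D :: nat \<Rightarrow> nat. tends_to_infinity D \<and>
               (\<forall>s\<ge>1. \<forall>n\<in>{N (s - 1) + 1..N s} - X s.
                  \<exists>An Bn. window_sumset_approx A (Bt s) n (Q n) (\<epsilon> s) An Bn \<and>
                    (\<forall>m. 1 \<le> m \<and> m \<le> D s \<longrightarrow> meets_residues_mod Bn m))))"
    if Bt: "\<forall>s\<ge>1. Bt s \<subseteq> {1..H s}" for Bt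
  proof -
    \<comment> \<open>Early blocks have no exceptions, since the trivial choice works at every
      start.\<close>
    define X where "X s = (if s \<le> s1 then {} else Xs s \<inter> {N (s - 1) + 1..N s})" for s
    define w where "w s = \<eta> (K s) / 4 * real (H s)" for s
    have early: "\<exists>An Bn. window_sumset_approx A (Bt s) n (Q n) (\<epsilon> s) An Bn"
      if "s \<le> s1" "n \<in> {N (s - 1) + 1..N s}" for s n
      using window_sumset_approx_trivial[of "\<epsilon> s" "Q n" A "Bt s" n] Q_early[OF that] T1 that by (auto simp: \<epsilon>_def)
    have latew: "\<exists>An Bn. window_sumset_approx A (Bt s) n (Q n) (\<epsilon> s) An Bn \<and> Bt s \<inter> {b. real b \<le> w s} \<subseteq> Bn"
      if s: "s > s1" and n: "n \<in> {N (s - 1) + 1..N s} - X s" for s n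
    proof -
      have "n \<in> {1..N s} - Xs s" using s n by (auto simp: X_def)
      moreover have "Bt s \<subseteq> {1..H s}" using Bt s s1(1) by auto
      ultimately have "\<exists>An Bn. window_sumset_approx A (Bt s) n (Qs s n) (\<eta> (K s)) An Bn \<and> Bt s \<inter> {b. real b \<le> w s} \<subseteq> Bn"
        using QX[OF late_S[OF s]] unfolding G_def w_def approximable_window_def by blast
      then show ?thesis using s n Q_late[of s n] by (simp add: \<epsilon>_def)
    qed
    have X_sub: "\<forall>s\<ge>1. X s \<subseteq> {N (s - 1) + 1..N s}" by (auto simp: X_def)
    have X_lim: "(\<lambda>s. real (card (X s)) / real (N s)) \<longlonglongrightarrow> 0"
    proof (rule Lim_null_comparison[OF _ \<eta>K])
      have "norm (real (card (X s)) / real (N s)) \<le> \<eta> (K s)" if s: "s \<ge> Suc s1" for s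
      proof -
        have G: "Xs s \<subseteq> {1..N s}" "real (card (Xs s)) \<le> \<eta> (K s) * real (N s)"
          using QX[OF late_S, of s] s unfolding G_def by auto
        have "card (X s) \<le> card (Xs s)"
          by (rule card_mono) (use G(1) s in \<open>auto simp: X_def intro: finite_subset\<close>)
        moreover have "real (N s) > 0" using N1 s by (simp add: Suc_le_eq)
        ultimately show ?thesis using G(2) by (simp add: field_simps)
      qed
      then show "eventually (\<lambda>s. norm (real (card (X s)) / real (N s)) \<le> \<eta> (K s)) sequentially"
        unfolding eventually_sequentially by blast
    qed
    have IV: "\<exists>D :: nat \<Rightarrow> nat. tends_to_infinity D \<and>
               (\<forall>s\<ge>1. \<forall>n\<in>{N (s - 1) + 1..N s} - X s.
                  \<exists>An Bn. window_sumset_approx A (Bt s) n (Q n) (\<epsilon> s) An Bn \<and>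
                    (\<forall>m. 1 \<le> m \<and> m \<le> D s \<longrightarrow> meets_residues_mod Bn m))"
      if B: "B \<subseteq> {1..}" "meets_residues_in_nat B" "\<forall>s\<ge>1. Bt s = B \<inter> {1..H s}" for B
    proof -
      \<comment> \<open>\<open>D s\<close> will be the largest bound on moduli for which the
        reserved small elements already meet all classes; the cap \<open>D \<le> s\<close> keeps the
        candidates finite.\<close>
      define V where "V s = {D. D \<le> s \<and> (\<forall>m. 1 \<le> m \<and> m \<le> D \<longrightarrow> meets_residues_mod (B \<inter> {b. real b \<le> w s}) m)}" for s
      define D where "D s = (if s \<le> s1 then 0 else Max (V s))" for s
      have finV: "finite (V s)" for s by (rule finite_subset[of _ "{..s}"]) (auto simp: V_def)
      have DV: "D s \<in> V s" if "s > s1" for s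
      proof -
        have "0 \<in> V s" by (auto simp: V_def)
        then have "Max (V s) \<in> V s" using Max_in[OF finV] by blast
        then show ?thesis using that by (simp add: D_def)
      qed
      have w_lim: "eventually (\<lambda>s. real u \<le> w s) sequentially" for u :: nat
      proof -
        have "eventually (\<lambda>s. 4 * u \<le> K s) sequentially" using K(2) unfolding filterlim_at_top by blast
        then show ?thesis using eventually_ge_at_top[of "S 0"]
        proof eventually_elim
          case (elim s)
          have "real ((K s + 1) ^ 2) \<le> real (H s)" using HK[OF elim(2)] by (simp only: of_nat_le_iff)
          then have "real (K s + 1) * real (K s + 1) \<le> real (H s)" by (simp only: power2_eq_square of_nat_mult)
          then have "real (K s + 1) \<le> \<eta> (K s) * real (H s)" by (simp add: \<eta>_def pos_le_divide_eq)
          then show ?case using elim(1) by (simp add: w_def)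
        qed
      qed
      have "tends_to_infinity D"
        unfolding tends_to_infinity_def filterlim_at_top
      proof
        fix k
        obtain u where u: "\<forall>m. 1 \<le> m \<and> m \<le> k \<longrightarrow> meets_residues_mod (B \<inter> {..u}) m"
          using meets_residues_mod_upto_bounded[OF B(2)] by blast
        show "eventually (\<lambda>s. k \<le> D s) sequentially"
          using w_lim[of u] eventually_ge_at_top[of "max k (Suc s1)"]
        proof eventually_elim
          case (elim s)
          have sub: "B \<inter> {..u} \<subseteq> B \<inter> {b. real b \<le> w s}" using elim(1) by auto
          have "\<forall>m. 1 \<le> m \<and> m \<le> k \<longrightarrow> meets_residues_mod (B \<inter> {b. real b \<le> w s}) m"
            using u meets_residues_mod_mono[OF _ sub] by blast
          then have "k \<in> V s" using elim(2) by (simp add: V_def)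
          then show ?case using elim(2) Max_ge[OF finV] by (simp add: D_def)
        qed
      qed
      moreover have "\<exists>An Bn. window_sumset_approx A (Bt s) n (Q n) (\<epsilon> s) An Bn \<and>
                    (\<forall>m. 1 \<le> m \<and> m \<le> D s \<longrightarrow> meets_residues_mod Bn m)"
        if s: "s \<ge> 1" and n: "n \<in> {N (s - 1) + 1..N s} - X s" for s n
      proof (cases "s \<le> s1")
        case True
        then show ?thesis using early[OF True, of n] n by (simp add: D_def)
      next
        case False
        then obtain An Bn where AB: "window_sumset_approx A (Bt s) n (Q n) (\<epsilon> s) An Bn" "Bt s \<inter> {b. real b \<le> w s} \<subseteq> Bn"
          using latew[of s n] n by auto
        \<comment> \<open>The small elements survive the truncation to {1..H s} because
          \<open>w s \<le> H s\<close>.\<close>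
        have "B \<inter> {b. real b \<le> w s} \<subseteq> Bt s \<inter> {b. real b \<le> w s}"
        proof -
          have "\<eta> (K s) / 4 \<le> 1" using \<eta>[of "K s"] by linarith
          then have "w s \<le> 1 * real (H s)" unfolding w_def by (intro mult_right_mono) auto
          then have "b \<le> H s" if "real b \<le> w s" for b using that by linarith
          then show ?thesis using B s by auto
        qed
        then have "B \<inter> {b. real b \<le> w s} \<subseteq> Bn" using AB(2) by blast
        moreover have "D s \<in> V s" using DV False by simp
        ultimately have "\<forall>m. 1 \<le> m \<and> m \<le> D s \<longrightarrow> meets_residues_mod Bn m"
          unfolding V_def using meets_residues_mod_mono by blast
        then show ?thesis using AB(1) by blast
      qed
      ultimately show ?thesis by blast
    qed
    have III: "\<exists>An Bn. window_sumset_approx A (Bt s) n (Q n) (\<epsilon> s) An Bn"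
      if "s \<ge> 1" "n \<in> {N (s - 1) + 1..N s} - X s" for s n
      using early[of s n] latew[of s n] that by (cases "s \<le> s1") auto
    show ?thesis
    proof (intro exI[of _ X] conjI X_sub X_lim)
      show "\<forall>s\<ge>1. \<forall>n\<in>{N (s - 1) + 1..N s} - X s.
             \<exists>An Bn. window_sumset_approx A (Bt s) n (Q n) (\<epsilon> s) An Bn"
        using III by (intro allI impI ballI)
    qed (rule allI, rule impI, elim conjE, rule IV; assumption)
  qed
  show ?thesis
  proof (intro exI[of _ \<epsilon>] exI[of _ Q] conjI \<epsilon>_lim least)
    show "\<forall>n\<ge>1. Q n \<ge> 1" using Q1 by simp
    show "\<forall>s\<ge>1. \<forall>n\<in>{N (s - 1) + 1..N s}. H s \<le> Q n \<and> real (Q n) \<le> (1 + \<epsilon> s) * real (H s)"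
      using Q_bounds by (intro allI impI ballI)
  qed (rule allI, rule impI, erule main)
qed

end
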